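(* Suppose that the conditions (H1), (H2) and (H3) listed in the context hold. Let $u_\ell$ and $u_{\ell,h}$ be the $\ell$-th eigenfunctions of the continuous and the discrete eigenvalue problem, respectively (normalized as in the context). Then, for $h$ small enough, $$\|u_\ell-u_{\ell,h}\|_h\lesssim h^{s}\,|u_\ell|_{H^{m+s}(\Omega)},$$ provided that $u_\ell\in V\cap H^{m+s}(\Omega)$ with $0<s\le 1$.
   Context: Continuous problem. $\Omega\subset\mathbb{R}^n$ is a bounded Lipschitz domain with piecewise flat boundary, $V\subset H^m(\Omega)$ is a standard Sobolev space with norm $\|\cdot\|_V$, $\rho\in L^\infty(\Omega)$ is a positive function, and $a(\cdot,\cdot)$ is a bilinear form on $V$ (associated with a $2m$-th order elliptic operator) that is symmetric, bounded ($|a(u,v)|\lesssim\|u\|_V\|v\|_V$) and coercive ($\|v\|_V^2\lesssim a(v,v)$). The eigenvalue problem is: find $(\lambda,u)\in\mathbb{R}\times V$ with $a(u,v)=\lambda(\rho u,v)_{L^2(\Omega)}$ for all $v\in V$ and $\|\rho^{1/2}u\|_{L^2(\Omega)}=1$. Its eigenvalues are $0<\lambda_1\le\lambda_2\le\cdots\nearrow+\infty$, with eigenfunctions $u_1,u_2,\dots$ satisfying $(\rho u_i,u_j)_{L^2(\Omega)}=\delta_{ij}$. The operator $A$ is defined by $a(u,v)=(Au,v)_{L^2(\Omega)}$ for all $v\in V$. Discrete problem. $\{\mathcal{T}_h\}$ is a family of regular (shape-regular) triangulations of $\overline\Omega$ into simplexes or $n$-rectangles with mesh size $h$, and $V_h$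 is a finite-dimensional, possibly nonconforming ($V_h\not\subset V$), finite element space over $\mathcal{T}_h$. The form $a_h(\cdot,\cdot)$ is the piecewise counterpart of $a(\cdot,\cdot)$, in which differential operators are applied element by element; it is defined on $V+V_h$ and agrees with $a$ on $V$. The discrete eigenvalue problem is: find $(\lambda_h,u_h)\in\mathbb{R}\times V_h$ with $a_h(u_h,v_h)=\lambda_h(\rho u_h,v_h)_{L^2(\Omega)}$ for all $v_h\in V_h$ and $\|\rho^{1/2}u_h\|_{L^2(\Omega)}=1$. With $N=\dim V_h$, its eigenvalues are $0<\lambda_{1,h}\le\cdots\le\lambda_{N,h}$ with $\rho$-orthonormal eigenfunctions $u_{1,h},\dots,u_{N,h}$. Conditions: (H1) $\|\cdot\|_h:=a_h(\cdot,\cdot)^{1/2}$ is a norm on $V_h$ (the same expression is used for functions in $V+V_h$). (H2) If $v\in V\cap H^{m+\mathcal{S}}(\Omega)$ with $0<\mathcal{S}\le 1$, then $\inf_{v_h\in V_h}\|v-v_h\|_h\lesssim h^{\mathcal{S}}|v|_{H^{m+\mathcal{S}}(\Omega)}$. (H3) If $v\in V\cap H^{m+s}(\Omega)$ with $0<s\le\mathcal{S}\le1$ (and $Av\in L^2(\Omega)$, so that the expression makes sense), then $\sup_{0\ne v_h\in V_h}\frac{a_h(v,v_h)-(Av,v_h)_{L^2(\Omega)}}{\|v_h\|_h}\lesssim h^{s}|v|_{H^{m+s}(\Omega)}$. Standing assumptions. $\lambda_\ell$ has multiplicity $1$. Regularity: for the same exponent $s$ ($0<s\le1$), for every $f\in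 L^2(\Omega)$ the solution $u_f\in V$ of $a(u_f,v)=(\rho f,v)_{L^2(\Omega)}$ for all $v\in V$ belongs to $V\cap H^{m+s}(\Omega)$ with $\|u_f\|_{H^{m+s}(\Omega)}\lesssim\|\rho^{1/2}f\|_{L^2(\Omega)}$. The sign of $u_{\ell,h}$ relative to $u_\ell$ is chosen such that $(\rho P_h'u_\ell,u_{\ell,h})_{L^2(\Omega)}\ge0$, where $P_h'u_\ell\in V_h$ is defined by $a_h(P_h'u_\ell,v_h)=\lambda_\ell(\rho u_\ell,v_h)_{L^2(\Omega)}$ for all $v_h\in V_h$. Notation: $A\lesssim B$ means $A\le CB$ with a constant $C>0$ independent of the mesh size $h$ (it may depend on $\Omega$, the shape regularity of the elements, and the fixed continuous problem and eigenpair, including norms of the eigenfunction).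
   Formalization: Where the seminorm of u_l in H^{m+s} is zero, it is additionally assumed that ‖·‖_h vanishes on V+V_h only for the zero function (the claim can fail otherwise); a_h is taken to be symmetric and nonnegative on V+V_h as part of (H1). *)

theory Defs
  imports "HOL-Analysis.Analysis"
begin

text \<open>
  Conventions. Real-valued functions on a domain \<open>\<Omega>\<close> are represented by total functions on
  \<open>real^'n\<close> of which only the values on \<open>\<Omega>\<close> matter, up to equality almost everywhere.
  A partial derivative of order \<open>k\<close> is indexed by a list \<open>\<alpha>\<close> of \<open>k\<close> coordinate directions
  instead of a multi-index; sums over all lists of length \<open>k\<close> give the Frobenius norm of the
  tensor of \<open>k\<close>-th derivatives.
\<close>

section \<open>Domains\<close>

text \<open>Near each boundary point, in direction \<open>e\<close>, the domain is the set above the graph of a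
  Lipschitz function of the coordinates orthogonal to \<open>e\<close>.\<close>

definition lipschitz_domain :: "(real^'n) set \<Rightarrow> bool" where
  "lipschitz_domain \<Omega> \<longleftrightarrow>
     open \<Omega> \<and> connected \<Omega> \<and> \<Omega> \<noteq> {} \<and>
     (\<forall>p \<in> frontier \<Omega>. \<exists>e r g L. norm e = 1 \<and> 0 < r \<and> lipschitz_on L UNIV g \<and>
        (\<forall>x \<in> ball p r. x \<in> \<Omega> \<longleftrightarrow> g (x - (x \<bullet> e) *\<^sub>R e) < x \<bullet> e))"

definition piecewise_flat_boundary :: "(real^'n) set \<Rightarrow> bool" where
  "piecewise_flat_boundary \<Omega> \<longleftrightarrow>
     (\<exists>F. finite F \<and> (\<forall>H \<in> F. \<exists>a b. a \<noteq> 0 \<and> H = {x. a \<bullet> x = b}) \<and> frontier \<Omega> \<subseteq> \<Union>F)"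

section \<open>Lebesgue and Sobolev spaces\<close>

definition linf :: "(real^'n) set \<Rightarrow> (real^'n \<Rightarrow> real) set" where
  "linf \<Omega> = {f \<in> borel_measurable (lebesgue_on \<Omega>). \<exists>C. AE x in lebesgue_on \<Omega>. \<bar>f x\<bar> \<le> C}"

definition l2 :: "(real^'n) set \<Rightarrow> (real^'n \<Rightarrow> real) set" where
  "l2 \<Omega> = {f \<in> borel_measurable (lebesgue_on \<Omega>). integrable (lebesgue_on \<Omega>) (\<lambda>x. (f x)\<^sup>2)}"

definition l2_inner :: "(real^'n) set \<Rightarrow> (real^'n \<Rightarrow> real) \<Rightarrow> (real^'n \<Rightarrow> real) \<Rightarrow> real" where
  "l2_inner \<Omega> f g = (LINT x|lebesgue_on \<Omega>. f x * g x)"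

definition l2_norm :: "(real^'n) set \<Rightarrow> (real^'n \<Rightarrow> real) \<Rightarrow> real" where
  "l2_norm \<Omega> f = sqrt (l2_inner \<Omega> f f)"

definition partial :: "'n \<Rightarrow> (real^'n \<Rightarrow> real) \<Rightarrow> real^'n \<Rightarrow> real" where
  "partial i f x = frechet_derivative f (at x) (axis i 1)"

primrec partials :: "'n list \<Rightarrow> (real^'n \<Rightarrow> real) \<Rightarrow> real^'n \<Rightarrow> real" where
  "partials [] f = f"
| "partials (i # \<alpha>) f = partial i (partials \<alpha> f)"

definition smooth :: "(real^'n \<Rightarrow> real) \<Rightarrow> bool" where
  "smooth f \<longleftrightarrow> (\<forall>\<alpha> x. partials \<alpha> f differentiable (at x))"

definition test_functions :: "(real^'n) set \<Rightarrow> (real^'n \<Rightarrow> real) set" where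
  "test_functions \<Omega> = {\<phi>. smooth \<phi> \<and> (\<exists>K. compact K \<and> K \<subseteq> \<Omega> \<and> (\<forall>x. x \<notin> K \<longrightarrow> \<phi> x = 0))}"

definition locally_integrable :: "(real^'n) set \<Rightarrow> (real^'n \<Rightarrow> real) \<Rightarrow> bool" where
  "locally_integrable \<Omega> f \<longleftrightarrow> (\<forall>K. compact K \<and> K \<subseteq> \<Omega> \<longrightarrow> f absolutely_integrable_on K)"

definition has_weak_deriv ::
  "(real^'n) set \<Rightarrow> 'n list \<Rightarrow> (real^'n \<Rightarrow> real) \<Rightarrow> (real^'n \<Rightarrow> real) \<Rightarrow> bool" where
  "has_weak_deriv \<Omega> \<alpha> f g \<longleftrightarrow>
     locally_integrable \<Omega> f \<and> locally_integrable \<Omega> g \<and>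
     (\<forall>\<phi> \<in> test_functions \<Omega>.
        l2_inner \<Omega> f (partials \<alpha> \<phi>) = (- 1) ^ length \<alpha> * l2_inner \<Omega> g \<phi>)"

text \<open>A representative; it is unique almost everywhere on \<open>\<Omega>\<close>.\<close>

definition weak_deriv :: "(real^'n) set \<Rightarrow> 'n list \<Rightarrow> (real^'n \<Rightarrow> real) \<Rightarrow> real^'n \<Rightarrow> real" where
  "weak_deriv \<Omega> \<alpha> f = (SOME g. has_weak_deriv \<Omega> \<alpha> f g)"

definition sobolev :: "(real^'n) set \<Rightarrow> nat \<Rightarrow> (real^'n \<Rightarrow> real) set" where
  "sobolev \<Omega> k = {f \<in> l2 \<Omega>. \<forall>\<alpha>. length \<alpha> \<le> k \<longrightarrow> (\<exists>g \<in> l2 \<Omega>. has_weak_deriv \<Omega> \<alpha> f g)}"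

definition sobolev_seminorm :: "(real^'n) set \<Rightarrow> nat \<Rightarrow> (real^'n \<Rightarrow> real) \<Rightarrow> real" where
  "sobolev_seminorm \<Omega> k f = sqrt (\<Sum>\<alpha> | length \<alpha> = k. (l2_norm \<Omega> (weak_deriv \<Omega> \<alpha> f))\<^sup>2)"

definition sobolev_norm :: "(real^'n) set \<Rightarrow> nat \<Rightarrow> (real^'n \<Rightarrow> real) \<Rightarrow> real" where
  "sobolev_norm \<Omega> k f = sqrt (\<Sum>\<alpha> | length \<alpha> \<le> k. (l2_norm \<Omega> (weak_deriv \<Omega> \<alpha> f))\<^sup>2)"

text \<open>The space \<open>H\<^bsup>m+s\<^esup>(\<Omega>)\<close> for \<open>0 < s \<le> 1\<close>: the Sobolev--Slobodeckij space for \<open>s < 1\<close>, and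
  \<open>H\<^bsup>m+1\<^esup>(\<Omega>)\<close> for \<open>s = 1\<close>.\<close>

definition slobodeckij :: "real \<Rightarrow> (real^'n \<Rightarrow> real) \<Rightarrow> (real^'n) \<times> (real^'n) \<Rightarrow> real" where
  "slobodeckij s g = (\<lambda>(x, y). (g x - g y)\<^sup>2 / norm (x - y) powr (real CARD('n) + 2 * s))"

definition frac_sobolev :: "(real^'n) set \<Rightarrow> nat \<Rightarrow> real \<Rightarrow> (real^'n \<Rightarrow> real) set" where
  "frac_sobolev \<Omega> m s =
     (if s = 1 then sobolev \<Omega> (m + 1)
      else {f \<in> sobolev \<Omega> m. \<forall>\<alpha>. length \<alpha> = m \<longrightarrow>
              integrable (lebesgue_on \<Omega> \<Otimes>\<^sub>M lebesgue_on \<Omega>) (slobodeckij s (weak_deriv \<Omega> \<alpha> f))})"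

definition frac_seminorm :: "(real^'n) set \<Rightarrow> nat \<Rightarrow> real \<Rightarrow> (real^'n \<Rightarrow> real) \<Rightarrow> real" where
  "frac_seminorm \<Omega> m s f =
     (if s = 1 then sobolev_seminorm \<Omega> (m + 1) f
      else sqrt (\<Sum>\<alpha> | length \<alpha> = m.
             LINT p|(lebesgue_on \<Omega> \<Otimes>\<^sub>M lebesgue_on \<Omega>). slobodeckij s (weak_deriv \<Omega> \<alpha> f) p))"

definition frac_norm :: "(real^'n) set \<Rightarrow> nat \<Rightarrow> real \<Rightarrow> (real^'n \<Rightarrow> real) \<Rightarrow> real" where
  "frac_norm \<Omega> m s f = sqrt ((sobolev_norm \<Omega> m f)\<^sup>2 + (frac_seminorm \<Omega> m s f)\<^sup>2)"

section \<open>Function spaces up to null sets\<close>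

definition fun_subspace :: "(real^'n \<Rightarrow> real) set \<Rightarrow> bool" where
  "fun_subspace S \<longleftrightarrow> (\<lambda>x. 0) \<in> S \<and>
     (\<forall>f \<in> S. \<forall>g \<in> S. (\<lambda>x. f x + g x) \<in> S) \<and> (\<forall>c. \<forall>f \<in> S. (\<lambda>x. c * f x) \<in> S)"

definition fun_sum :: "(real^'n \<Rightarrow> real) set \<Rightarrow> (real^'n \<Rightarrow> real) set \<Rightarrow> (real^'n \<Rightarrow> real) set" where
  "fun_sum S T = {\<lambda>x. f x + g x | f g. f \<in> S \<and> g \<in> T}"

definition ae_zero :: "(real^'n) set \<Rightarrow> (real^'n \<Rightarrow> real) \<Rightarrow> bool" where
  "ae_zero \<Omega> f \<longleftrightarrow> (AE x in lebesgue_on \<Omega>. f x = 0)"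

definition is_norm_on ::
  "(real^'n) set \<Rightarrow> (real^'n \<Rightarrow> real) set \<Rightarrow> ((real^'n \<Rightarrow> real) \<Rightarrow> real) \<Rightarrow> bool" where
  "is_norm_on \<Omega> S \<nu> \<longleftrightarrow>
     (\<forall>f \<in> S. 0 \<le> \<nu> f \<and> (\<nu> f = 0 \<longleftrightarrow> ae_zero \<Omega> f)) \<and>
     (\<forall>c. \<forall>f \<in> S. \<nu> (\<lambda>x. c * f x) = \<bar>c\<bar> * \<nu> f) \<and>
     (\<forall>f \<in> S. \<forall>g \<in> S. \<nu> (\<lambda>x. f x + g x) \<le> \<nu> f + \<nu> g)"

text \<open>\<open>S\<close>, modulo functions vanishing almost everywhere on \<open>\<Omega>\<close>, has dimension \<open>N\<close>.\<close>

definition has_dim :: "(real^'n) set \<Rightarrow> (real^'n \<Rightarrow> real) set \<Rightarrow> nat \<Rightarrow> bool" where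
  "has_dim \<Omega> S N \<longleftrightarrow>
     (\<exists>b. (\<forall>j \<in> {1..N}. b j \<in> S) \<and>
          (\<forall>c. ae_zero \<Omega> (\<lambda>x. \<Sum>j=1..N. c j * b j x) \<longrightarrow> (\<forall>j \<in> {1..N}. c j = 0)) \<and>
          (\<forall>f \<in> S. \<exists>c. ae_zero \<Omega> (\<lambda>x. f x - (\<Sum>j=1..N. c j * b j x))))"

text \<open>The spaces \<open>V\<close> of the variational formulation: closed subspaces of \<open>H\<^sup>m(\<Omega>)\<close> containing
  the test functions (and hence \<open>H\<^sub>0\<^sup>m(\<Omega>)\<close>), with a norm equivalent to that of \<open>H\<^sup>m(\<Omega>)\<close>.\<close>

definition standard_sobolev_space ::
  "(real^'n) set \<Rightarrow> nat \<Rightarrow> (real^'n \<Rightarrow> real) set \<Rightarrow> ((real^'n \<Rightarrow> real) \<Rightarrow> real) \<Rightarrow> bool" where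
  "standard_sobolev_space \<Omega> m V normV \<longleftrightarrow>
     V \<subseteq> sobolev \<Omega> m \<and> fun_subspace V \<and> test_functions \<Omega> \<subseteq> V \<and>
     (\<forall>f \<in> sobolev \<Omega> m. \<forall>F. (\<forall>k::nat. F k \<in> V) \<and>
        (\<lambda>k. sobolev_norm \<Omega> m (\<lambda>x. F k x - f x)) \<longlonglongrightarrow> 0 \<longrightarrow> f \<in> V) \<and>
     is_norm_on \<Omega> V normV \<and>
     (\<exists>c C. 0 < c \<and> (\<forall>v \<in> V. c * sobolev_norm \<Omega> m v \<le> normV v \<and>
                                normV v \<le> C * sobolev_norm \<Omega> m v))"

section \<open>The bilinear forms\<close>

text \<open>The form \<open>\<Sum>\<^sub>\<alpha>\<^sub>,\<^sub>\<beta> \<integral> \<kappa>\<^sub>\<alpha>\<^sub>\<beta> \<partial>\<^sup>\<alpha>u \<partial>\<^sup>\<beta>v\<close> of a differential operator of order \<open>2m\<close>, its piecewise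
  counterpart, and the ellipticity of the operator.\<close>

definition form_on :: "nat \<Rightarrow> ('n list \<Rightarrow> 'n list \<Rightarrow> real^'n \<Rightarrow> real) \<Rightarrow> (real^'n) set \<Rightarrow>
    (real^'n \<Rightarrow> real) \<Rightarrow> (real^'n \<Rightarrow> real) \<Rightarrow> real" where
  "form_on m \<kappa> D u v =
     (\<Sum>\<alpha> | length \<alpha> \<le> m. \<Sum>\<beta> | length \<beta> \<le> m.
        LINT x|lebesgue_on D. \<kappa> \<alpha> \<beta> x * weak_deriv D \<alpha> u x * weak_deriv D \<beta> v x)"

definition piecewise_form ::
  "nat \<Rightarrow> ('n list \<Rightarrow> 'n list \<Rightarrow> real^'n \<Rightarrow> real) \<Rightarrow> (real^'n) set set \<Rightarrow>
    (real^'n \<Rightarrow> real) \<Rightarrow> (real^'n \<Rightarrow> real) \<Rightarrow> real" where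
  "piecewise_form m \<kappa> \<T> u v = (\<Sum>K\<in>\<T>. form_on m \<kappa> (interior K) u v)"

definition elliptic ::
  "(real^'n) set \<Rightarrow> nat \<Rightarrow> ('n list \<Rightarrow> 'n list \<Rightarrow> real^'n \<Rightarrow> real) \<Rightarrow> bool" where
  "elliptic \<Omega> m \<kappa> \<longleftrightarrow>
     (\<forall>\<alpha> \<beta>. length \<alpha> \<le> m \<and> length \<beta> \<le> m \<longrightarrow> \<kappa> \<alpha> \<beta> \<in> linf \<Omega>) \<and>
     (\<exists>\<theta>>0. AE x in lebesgue_on \<Omega>. \<forall>\<xi> :: real^'n.
        (\<Sum>\<alpha> | length \<alpha> = m. \<Sum>\<beta> | length \<beta> = m.
           \<kappa> \<alpha> \<beta> x * (\<Prod>i\<leftarrow>\<alpha>. \<xi> $ i) * (\<Prod>i\<leftarrow>\<beta>. \<xi> $ i)) \<ge> \<theta> * norm \<xi> ^ (2 * m))"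

definition symmetric_on ::
  "(real^'n \<Rightarrow> real) set \<Rightarrow> ((real^'n \<Rightarrow> real) \<Rightarrow> (real^'n \<Rightarrow> real) \<Rightarrow> real) \<Rightarrow> bool" where
  "symmetric_on S b \<longleftrightarrow> (\<forall>u \<in> S. \<forall>v \<in> S. b u v = b v u)"

definition bounded_coercive_on :: "(real^'n \<Rightarrow> real) set \<Rightarrow> ((real^'n \<Rightarrow> real) \<Rightarrow> real) \<Rightarrow>
    ((real^'n \<Rightarrow> real) \<Rightarrow> (real^'n \<Rightarrow> real) \<Rightarrow> real) \<Rightarrow> bool" where
  "bounded_coercive_on V normV b \<longleftrightarrow>
     (\<exists>C>0. \<forall>u \<in> V. \<forall>v \<in> V. \<bar>b u v\<bar> \<le> C * normV u * normV v) \<and>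
     (\<exists>C>0. \<forall>v \<in> V. (normV v)\<^sup>2 \<le> C * b v v)"

definition energy_norm ::
  "((real^'n \<Rightarrow> real) \<Rightarrow> (real^'n \<Rightarrow> real) \<Rightarrow> real) \<Rightarrow> (real^'n \<Rightarrow> real) \<Rightarrow> real" where
  "energy_norm b v = sqrt (b v v)"

section \<open>Eigenvalue problems\<close>

text \<open>Used both for \<open>(V, a)\<close> and for \<open>(V\<^sub>h, a\<^sub>h)\<close>.\<close>

definition eigenpair :: "(real^'n) set \<Rightarrow> (real^'n \<Rightarrow> real) \<Rightarrow>
    ((real^'n \<Rightarrow> real) \<Rightarrow> (real^'n \<Rightarrow> real) \<Rightarrow> real) \<Rightarrow> (real^'n \<Rightarrow> real) set \<Rightarrow>
    real \<Rightarrow> (real^'n \<Rightarrow> real) \<Rightarrow> bool" where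
  "eigenpair \<Omega> \<rho> b S \<mu> w \<longleftrightarrow>
     w \<in> S \<and> (\<forall>v \<in> S. b w v = \<mu> * l2_inner \<Omega> (\<lambda>x. \<rho> x * w x) v) \<and>
     l2_norm \<Omega> (\<lambda>x. sqrt (\<rho> x) * w x) = 1"

text \<open>All eigenvalues, numbered from 1 and repeated according to multiplicity: the eigenfunctions
  for an eigenvalue \<open>\<mu>\<close> are combinations of the \<open>u i\<close> with \<open>lam i = \<mu>\<close>.\<close>

definition eigen_system :: "(real^'n) set \<Rightarrow> (real^'n \<Rightarrow> real) \<Rightarrow>
    ((real^'n \<Rightarrow> real) \<Rightarrow> (real^'n \<Rightarrow> real) \<Rightarrow> real) \<Rightarrow> (real^'n \<Rightarrow> real) set \<Rightarrow>
    (nat \<Rightarrow> real) \<Rightarrow> (nat \<Rightarrow> real^'n \<Rightarrow> real) \<Rightarrow> bool" where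
  "eigen_system \<Omega> \<rho> b V lam u \<longleftrightarrow>
     (\<forall>i\<ge>1. eigenpair \<Omega> \<rho> b V (lam i) (u i)) \<and>
     0 < lam 1 \<and> (\<forall>i\<ge>1. lam i \<le> lam (Suc i)) \<and> filterlim lam at_top sequentially \<and>
     (\<forall>i\<ge>1. \<forall>j\<ge>1. l2_inner \<Omega> (\<lambda>x. \<rho> x * u i x) (u j) = (if i = j then 1 else 0)) \<and>
     (\<forall>\<mu> w. eigenpair \<Omega> \<rho> b V \<mu> w \<longrightarrow>
        (\<exists>c. ae_zero \<Omega> (\<lambda>x. w x - (\<Sum>i | 1 \<le> i \<and> lam i = \<mu>. c i * u i x))))"

definition discrete_eigen_system :: "(real^'n) set \<Rightarrow> (real^'n \<Rightarrow> real) \<Rightarrow>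
    ((real^'n \<Rightarrow> real) \<Rightarrow> (real^'n \<Rightarrow> real) \<Rightarrow> real) \<Rightarrow> (real^'n \<Rightarrow> real) set \<Rightarrow> nat \<Rightarrow>
    (nat \<Rightarrow> real) \<Rightarrow> (nat \<Rightarrow> real^'n \<Rightarrow> real) \<Rightarrow> bool" where
  "discrete_eigen_system \<Omega> \<rho> b S N lam u \<longleftrightarrow>
     has_dim \<Omega> S N \<and>
     (\<forall>i \<in> {1..N}. eigenpair \<Omega> \<rho> b S (lam i) (u i) \<and> 0 < lam i) \<and>
     (\<forall>i \<in> {1..N}. \<forall>j \<in> {1..N}. i \<le> j \<longrightarrow> lam i \<le> lam j) \<and>
     (\<forall>i \<in> {1..N}. \<forall>j \<in> {1..N}.
        l2_inner \<Omega> (\<lambda>x. \<rho> x * u i x) (u j) = (if i = j then 1 else 0))"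

text \<open>\<open>g = A v \<in> L\<^sup>2(\<Omega>)\<close>, where \<open>a(v,w) = (Av,w)\<close> for all \<open>w \<in> V\<close>. As \<open>V\<close> is dense in
  \<open>L\<^sup>2(\<Omega>)\<close>, \<open>g\<close> is determined by \<open>v\<close> almost everywhere.\<close>

definition represents_A :: "(real^'n) set \<Rightarrow> ((real^'n \<Rightarrow> real) \<Rightarrow> (real^'n \<Rightarrow> real) \<Rightarrow> real) \<Rightarrow>
    (real^'n \<Rightarrow> real) set \<Rightarrow> (real^'n \<Rightarrow> real) \<Rightarrow> (real^'n \<Rightarrow> real) \<Rightarrow> bool" where
  "represents_A \<Omega> a V v g \<longleftrightarrow> g \<in> l2 \<Omega> \<and> (\<forall>w \<in> V. a v w = l2_inner \<Omega> g w)"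

definition elliptic_regularity :: "(real^'n) set \<Rightarrow> nat \<Rightarrow> (real^'n \<Rightarrow> real) \<Rightarrow>
    ((real^'n \<Rightarrow> real) \<Rightarrow> (real^'n \<Rightarrow> real) \<Rightarrow> real) \<Rightarrow> (real^'n \<Rightarrow> real) set \<Rightarrow> real \<Rightarrow> bool" where
  "elliptic_regularity \<Omega> m \<rho> a V s \<longleftrightarrow>
     (\<exists>C>0. \<forall>f \<in> l2 \<Omega>. \<exists>w \<in> V \<inter> frac_sobolev \<Omega> m s.
        (\<forall>v \<in> V. a w v = l2_inner \<Omega> (\<lambda>x. \<rho> x * f x) v) \<and>
        frac_norm \<Omega> m s w \<le> C * l2_norm \<Omega> (\<lambda>x. sqrt (\<rho> x) * f x))"

section \<open>Triangulations and finite element spaces\<close>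

definition n_simplex :: "(real^'n) set \<Rightarrow> bool" where
  "n_simplex K \<longleftrightarrow> int CARD('n) simplex K"

definition n_rectangle :: "(real^'n) set \<Rightarrow> bool" where
  "n_rectangle K \<longleftrightarrow> (\<exists>a b. (\<forall>i. a $ i < b $ i) \<and> K = cbox a b)"

definition fe_triangulation :: "(real^'n) set \<Rightarrow> (real^'n) set set \<Rightarrow> bool" where
  "fe_triangulation \<Omega> \<T> \<longleftrightarrow>
     finite \<T> \<and> ((\<forall>K \<in> \<T>. n_simplex K) \<or> (\<forall>K \<in> \<T>. n_rectangle K)) \<and> \<Union>\<T> = closure \<Omega> \<and>
     (\<forall>K \<in> \<T>. \<forall>K' \<in> \<T>. (K \<inter> K') face_of K \<and> (K \<inter> K') face_of K')"

definition mesh_size :: "(real^'n) set set \<Rightarrow> real" where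
  "mesh_size \<T> = Max (diameter ` \<T>)"

definition shape_regular :: "('i \<Rightarrow> (real^'n) set set) \<Rightarrow> bool" where
  "shape_regular \<T> \<longleftrightarrow>
     (\<exists>\<sigma>>0. \<forall>h. \<forall>K \<in> \<T> h. \<exists>z r. 0 < r \<and> cball z r \<subseteq> K \<and> diameter K \<le> \<sigma> * r)"

text \<open>The restrictions to the elements need only lie in \<open>H\<^sup>m\<close>, so that piecewise polynomials are
  included and no continuity across element boundaries is imposed.\<close>

definition fe_space ::
  "(real^'n) set \<Rightarrow> nat \<Rightarrow> (real^'n) set set \<Rightarrow> (real^'n \<Rightarrow> real) set \<Rightarrow> bool" where
  "fe_space \<Omega> m \<T> S \<longleftrightarrow>
     fun_subspace S \<and> (\<exists>N. has_dim \<Omega> S N) \<and> (\<forall>v \<in> S. \<forall>K \<in> \<T>. v \<in> sobolev (interior K) m)"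

section \<open>Conditions on the discretisation\<close>

text \<open>A family of discretisations is indexed by an arbitrary type \<open>'i\<close>; \<open>\<T>\<close>, \<open>Vh\<close> and \<open>ah\<close> assign to
  an index the triangulation, the finite element space and the piecewise form. In the first
  condition, \<open>a\<^sub>h\<close> is symmetric and nonnegative on \<open>V + V\<^sub>h\<close>, so that \<open>a\<^sub>h(\<cdot>,\<cdot>)\<^bsup>1/2\<^esup>\<close> makes
  sense there.\<close>

definition cond_H1 :: "(real^'n) set \<Rightarrow> (real^'n \<Rightarrow> real) set \<Rightarrow> ('i \<Rightarrow> (real^'n \<Rightarrow> real) set) \<Rightarrow>
    ('i \<Rightarrow> (real^'n \<Rightarrow> real) \<Rightarrow> (real^'n \<Rightarrow> real) \<Rightarrow> real) \<Rightarrow> bool" where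
  "cond_H1 \<Omega> V Vh ah \<longleftrightarrow>
     (\<forall>h. is_norm_on \<Omega> (Vh h) (energy_norm (ah h)) \<and>
          symmetric_on (fun_sum V (Vh h)) (ah h) \<and> (\<forall>w \<in> fun_sum V (Vh h). 0 \<le> ah h w w))"

definition cond_H2 :: "(real^'n) set \<Rightarrow> nat \<Rightarrow> (real^'n \<Rightarrow> real) set \<Rightarrow> ('i \<Rightarrow> (real^'n) set set) \<Rightarrow>
    ('i \<Rightarrow> (real^'n \<Rightarrow> real) set) \<Rightarrow> ('i \<Rightarrow> (real^'n \<Rightarrow> real) \<Rightarrow> (real^'n \<Rightarrow> real) \<Rightarrow> real) \<Rightarrow>
    real \<Rightarrow> bool" where
  "cond_H2 \<Omega> m V \<T> Vh ah s \<longleftrightarrow>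
     (\<exists>C>0. \<forall>h. \<forall>v \<in> V \<inter> frac_sobolev \<Omega> m s.
        (INF vh \<in> Vh h. energy_norm (ah h) (\<lambda>x. v x - vh x))
          \<le> C * mesh_size (\<T> h) powr s * frac_seminorm \<Omega> m s v)"

text \<open>The supremum is taken in the extended reals, where no boundedness is presupposed.\<close>

definition cond_H3 :: "(real^'n) set \<Rightarrow> nat \<Rightarrow> ((real^'n \<Rightarrow> real) \<Rightarrow> (real^'n \<Rightarrow> real) \<Rightarrow> real) \<Rightarrow>
    (real^'n \<Rightarrow> real) set \<Rightarrow> ('i \<Rightarrow> (real^'n) set set) \<Rightarrow>
    ('i \<Rightarrow> (real^'n \<Rightarrow> real) set) \<Rightarrow> ('i \<Rightarrow> (real^'n \<Rightarrow> real) \<Rightarrow> (real^'n \<Rightarrow> real) \<Rightarrow> real) \<Rightarrow>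
    real \<Rightarrow> bool" where
  "cond_H3 \<Omega> m a V \<T> Vh ah s \<longleftrightarrow>
     (\<exists>C>0. \<forall>h. \<forall>v \<in> V \<inter> frac_sobolev \<Omega> m s. \<forall>Av. represents_A \<Omega> a V v Av \<longrightarrow>
        (SUP vh \<in> {vh \<in> Vh h. \<not> ae_zero \<Omega> vh}.
           ereal ((ah h v vh - l2_inner \<Omega> Av vh) / energy_norm (ah h) vh))
          \<le> ereal (C * mesh_size (\<T> h) powr s * frac_seminorm \<Omega> m s v))"

end

theory Submission
  imports Defs "HOL-Library.Function_Algebras" "HOL-Library.Diagonal_Subsequence"
begin

text \<open>Let \<open>b\<close> be the mass form \<open>(\<rho> f, g)\<close> on \<open>L\<^sup>2(\<Omega>)\<close>, let \<open>T\<close> be the solution operator of the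
continuous source problem, \<open>a(T f, v) = b(f, v)\<close> on \<open>V\<close>, and let \<open>S\<close> be its discrete counterpart
on \<open>V\<^sub>h\<close>. The exact and the discrete eigenfunctions are the eigenvectors of \<open>T\<close> and of \<open>S\<close> for the
inverse eigenvalues, so the theorem is a perturbation result for \<open>T\<close>.

By elliptic regularity, (H2) and (H3) bound the best approximation error and the consistency error
of \<open>T f\<close> by \<open>h\<^sup>s\<close> times the mass norm of \<open>f\<close>. The second Strang lemma (\<open>Strang\<close>) turns this into
an energy estimate for \<open>T f - S f\<close>, and testing the error with the solution of the dual problem
(\<open>duality\<close>) gives an estimate in the mass norm: \<open>S\<close> converges to \<open>T\<close> in operator norm.

Next, the discrete eigenvalue number \<open>l\<close> has to be separated from the others. Upper bounds for
the discrete eigenvalues follow from the min-max principle (\<open>discrete_eigenvalue_upper\<close>). For the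
lower bound on number \<open>l + 1\<close>, discrete eigenfunctions for bounded discrete eigenvalues converge,
along a sequence of meshes, to orthonormal exact eigenfunctions (\<open>limit_eigenfunctions\<close>); since
there are only \<open>l\<close> of these below \<open>\<lambda>\<^bsub>l+1\<^esub>\<close>, the discrete eigenvalue number \<open>l + 1\<close> cannot stay
below \<open>\<lambda>\<^bsub>l+1\<^esub>\<close>. The compactness behind this comes from the discretisation itself: \<open>T\<close> is the norm
limit of the operators \<open>S\<close>, which have finite rank.

Finally, put \<open>P = S(\<lambda>\<^sub>l u\<^sub>l)\<close>. The Strang lemma, now with the seminorm of \<open>u\<^sub>l\<close> itself, bounds
\<open>u\<^sub>l - P\<close>. In the basis of discrete eigenfunctions, the coefficients of \<open>P\<close> other than number \<open>l\<close>
are those of \<open>u\<^sub>l - P\<close> times \<open>\<lambda>\<^sub>l / (\<lambda>\<^bsub>j,h\<^esub> - \<lambda>\<^sub>l)\<close>, hence small by the separation of the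
eigenvalues; normalisation and the choice of sign control coefficient number \<open>l\<close>
(\<open>eigenfunction_error\<close>).

All this is carried out for semidefinite forms on subspaces of a real vector space
(\<open>semi_inner\<close>, \<open>galerkin\<close>). That \<open>a\<^sub>h\<close> is such a form on \<open>V + V\<^sub>h\<close>, and that it extends \<open>a\<close>, rests
on the almost everywhere uniqueness of weak derivatives, that is, on the fundamental lemma of the
calculus of variations (\<open>fundamental_lemma\<close>).\<close>

section \<open>Finite-dimensional tools and extraction of subsequences\<close>

text \<open>Pointwise scaling turns the function spaces of the problem into subspaces of a real vector
space, so that the Hilbert space arguments can be stated for arbitrary real vector spaces.\<close>

instantiation "fun" :: (type, real_vector) real_vector
begin

definition scaleR_fun :: "real \<Rightarrow> ('a \<Rightarrow> 'b) \<Rightarrow> 'a \<Rightarrow> 'b" where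
  "scaleR_fun c f = (\<lambda>x. c *\<^sub>R f x)"

instance
  by standard (auto simp: scaleR_fun_def fun_eq_iff algebra_simps)

end

lemma scaleR_fun_apply [simp]: "(c *\<^sub>R f) x = c *\<^sub>R f x"
  by (simp add: scaleR_fun_def)

lemma minus_fun_apply [simp]: "(f - g) x = f x - (g x :: 'a :: ab_group_add)"
  by (simp add: fun_diff_def)

lemma sum_fun_apply: "(\<Sum>j\<in>J. f j) x = (\<Sum>j\<in>J. f j x :: 'a :: comm_monoid_add)"
  by (induction J rule: infinite_finite_induct) auto

text \<open>Gaussian elimination, by induction on the equations. It is the dimension count behind every
comparison of two families of vectors below.\<close>

lemma underdetermined_system:
  fixes M :: "'p \<Rightarrow> 'q \<Rightarrow> real"
  assumes "finite Q" "finite P" "card Q < card P"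
  shows "\<exists>x. (\<exists>p\<in>P. x p \<noteq> 0) \<and> (\<forall>q\<in>Q. (\<Sum>p\<in>P. x p * M p q) = 0)"
  using assms
proof (induction Q arbitrary: P M rule: finite_induct)
  case empty
  then obtain p where "p \<in> P" by fastforce
  then show ?case by (intro exI[of _ "\<lambda>_. 1"]) auto
next
  case (insert q0 Q)
  show ?case
  proof (cases "\<forall>p\<in>P. M p q0 = 0")
    case True
    have "card Q < card P" using insert by simp
    then obtain x where "\<exists>p\<in>P. x p \<noteq> 0" "\<forall>q\<in>Q. (\<Sum>p\<in>P. x p * M p q) = 0"
      using insert.IH[OF insert.prems(1)] by blast
    with True show ?thesis by (intro exI[of _ x]) auto
  next
    case False
    then obtain p0 where p0: "p0 \<in> P" "M p0 q0 \<noteq> 0" by blast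
    let ?P = "P - {p0}"
    let ?M = "\<lambda>p q. M p q - M p q0 / M p0 q0 * M p0 q"
    \<comment> \<open>Eliminate \<open>p0\<close> with the equation \<open>q0\<close> and solve the remaining equations.\<close>
    have "card Q < card ?P" using insert p0 by simp
    then obtain x where x: "\<exists>p\<in>?P. x p \<noteq> 0" "\<forall>q\<in>Q. (\<Sum>p\<in>?P. x p * ?M p q) = 0"
      using insert.IH[of ?P ?M] insert.prems(1) by blast
    define s where "s = (\<Sum>p\<in>?P. x p * M p q0)"
    define y where "y = x(p0 := - s / M p0 q0)"
    have eq: "(\<Sum>p\<in>P. y p * M p q) = (\<Sum>p\<in>?P. x p * M p q) - s / M p0 q0 * M p0 q" for q
    proof -
      have "(\<Sum>p\<in>P. y p * M p q) = y p0 * M p0 q + (\<Sum>p\<in>?P. y p * M p q)"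
        using p0 insert.prems by (simp add: sum.remove)
      also have "(\<Sum>p\<in>?P. y p * M p q) = (\<Sum>p\<in>?P. x p * M p q)"
        by (rule sum.cong) (auto simp: y_def)
      finally show ?thesis by (simp add: y_def)
    qed
    have "(\<Sum>p\<in>P. y p * M p q) = 0" if "q \<in> Q" for q
    proof -
      have "0 = (\<Sum>p\<in>?P. x p * ?M p q)" using x that by simp
      also have "\<dots> = (\<Sum>p\<in>?P. x p * M p q) - s / M p0 q0 * M p0 q"
        by (simp add: s_def right_diff_distrib sum_subtractf sum_divide_distrib sum_distrib_right
            mult.assoc)
      finally show ?thesis by (simp add: eq)
    qed
    moreover have "(\<Sum>p\<in>P. y p * M p q0) = 0"
      using p0 by (simp add: eq flip: s_def)
    moreover have "\<exists>p\<in>P. y p \<noteq> 0" using x(1) by (auto simp: y_def)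
    ultimately show ?thesis by (intro exI[of _ y]) auto
  qed
qed

text \<open>Bolzano--Weierstrass for one coordinate after the other: the diagonal sequence is eventually a
subsequence of each sequence extracted on the way.\<close>

lemma diagonal_convergent_subsequence:
  fixes c :: "nat \<Rightarrow> 'p::countable \<Rightarrow> real"
  assumes "\<And>p. Bseq (\<lambda>k. c k p)"
  shows "\<exists>r. strict_mono r \<and> (\<forall>p. convergent (\<lambda>k. c (r k) p))"
proof -
  let ?P = "\<lambda>n s. \<forall>p. to_nat p = n \<longrightarrow> convergent (\<lambda>k. c (s k) p)"
  interpret subseqs ?P
  proof
    fix n and s :: "nat \<Rightarrow> nat"
    show "\<exists>r'. strict_mono r' \<and> ?P n (s \<circ> r')"
    proof (cases "\<exists>p::'p. to_nat p = n")
      case True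
      then obtain p :: 'p where p: "to_nat p = n" by blast
      obtain B where "\<And>k. \<bar>c k p\<bar> \<le> B"
        using assms[of p] unfolding Bseq_def by auto
      then have "bounded (range (\<lambda>k. c (s k) p))"
        by (auto simp: bounded_iff)
      then obtain l r where "strict_mono r" "((\<lambda>k. c (s k) p) \<circ> r) \<longlonglongrightarrow> l"
        using bounded_imp_convergent_subsequence by blast
      with p show ?thesis
        by (intro exI[of _ r]) (auto simp: o_def convergent_def dest!: injD[OF inj_to_nat])
    next
      case False
      then show ?thesis by (intro exI[of _ id]) (auto simp: strict_mono_id)
    qed
  qed
  have "convergent (\<lambda>k. c (diagseq k) p)" for p
  proof -
    have "?P (to_nat p) (diagseq \<circ> ((+) (Suc (to_nat p))))"
    proof (rule diagseq_holds)
      fix r s :: "nat \<Rightarrow> nat" and n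
      assume r: "strict_mono r" and s: "?P n s"
      show "?P n (s \<circ> r)"
      proof (intro allI impI)
        fix p :: 'p assume "to_nat p = n"
        then have "convergent (\<lambda>k. c (s k) p)" using s by blast
        from convergent_subseq_convergent[OF this r]
        show "convergent (\<lambda>k. c ((s \<circ> r) k) p)" by (simp add: o_def)
      qed
    qed
    then have "convergent (\<lambda>k. c (diagseq (k + Suc (to_nat p))) p)"
      by (simp add: o_def add.commute)
    then show ?thesis
      by (subst (asm) convergent_ignore_initial_segment[where f="\<lambda>k. c (diagseq k) p"])
  qed
  then show ?thesis using subseq_diagseq by blast
qed

lemma le_if_square_le_mult:
  fixes x c :: real
  assumes "0 \<le> x" "0 \<le> c" "x * x \<le> c * x"
  shows "x \<le> c"
  using assms by (cases "x = 0") auto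

section \<open>Positive semidefinite forms\<close>

definition form_norm :: "('v \<Rightarrow> 'v \<Rightarrow> real) \<Rightarrow> 'v \<Rightarrow> real" where
  "form_norm b x = sqrt (b x x)"

definition form_Cauchy :: "('v::minus \<Rightarrow> 'v \<Rightarrow> real) \<Rightarrow> (nat \<Rightarrow> 'v) \<Rightarrow> bool" where
  "form_Cauchy b f \<longleftrightarrow> (\<forall>e>0. \<exists>K. \<forall>m\<ge>K. \<forall>n\<ge>K. form_norm b (f m - f n) < e)"

text \<open>The form may vanish on non-zero vectors. Functions that are zero almost everywhere are thus
handled by null vectors of the form, without passing to a quotient space.\<close>

locale semi_inner =
  fixes X :: "'v::real_vector set" and b :: "'v \<Rightarrow> 'v \<Rightarrow> real"
  assumes X_subspace: "subspace X"
    and add_left: "\<lbrakk>x \<in> X; y \<in> X; z \<in> X\<rbrakk> \<Longrightarrow> b (x + y) z = b x z + b y z"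
    and scale_left: "\<lbrakk>x \<in> X; z \<in> X\<rbrakk> \<Longrightarrow> b (c *\<^sub>R x) z = c * b x z"
    and sym: "\<lbrakk>x \<in> X; y \<in> X\<rbrakk> \<Longrightarrow> b x y = b y x"
    and nonneg: "x \<in> X \<Longrightarrow> 0 \<le> b x x"
begin

lemma X_simps [simp]: "0 \<in> X" "\<lbrakk>x \<in> X; y \<in> X\<rbrakk> \<Longrightarrow> x + y \<in> X" "\<lbrakk>x \<in> X; y \<in> X\<rbrakk> \<Longrightarrow> x - y \<in> X"
  "x \<in> X \<Longrightarrow> - x \<in> X" "x \<in> X \<Longrightarrow> c *\<^sub>R x \<in> X" "(\<And>j. j \<in> J \<Longrightarrow> f j \<in> X) \<Longrightarrow> sum f J \<in> X"
  using X_subspace by (auto intro: subspace_0 subspace_add subspace_diff subspace_neg subspace_scale subspace_sum)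

lemma add_right: "\<lbrakk>x \<in> X; y \<in> X; z \<in> X\<rbrakk> \<Longrightarrow> b z (x + y) = b z x + b z y"
  using add_left[of x y z] sym by simp

lemma scale_right: "\<lbrakk>x \<in> X; z \<in> X\<rbrakk> \<Longrightarrow> b z (c *\<^sub>R x) = c * b z x"
  using scale_left[of x z c] sym[of z x] sym[of z "c *\<^sub>R x"] by simp

lemma diff_left: "\<lbrakk>x \<in> X; y \<in> X; z \<in> X\<rbrakk> \<Longrightarrow> b (x - y) z = b x z - b y z"
  using add_left[of x "(-1) *\<^sub>R y" z] scale_left[of y z "-1"] by simp

lemma diff_right: "\<lbrakk>x \<in> X; y \<in> X; z \<in> X\<rbrakk> \<Longrightarrow> b z (x - y) = b z x - b z y"
  using diff_left[of x y z] sym by simp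

lemma zero_left: "z \<in> X \<Longrightarrow> b 0 z = 0"
  using scale_left[of 0 z 0] by simp

lemma sum_left: "\<lbrakk>\<And>j. j \<in> J \<Longrightarrow> f j \<in> X; z \<in> X\<rbrakk> \<Longrightarrow> b (sum f J) z = (\<Sum>j\<in>J. b (f j) z)"
  by (induction J rule: infinite_finite_induct) (auto simp: zero_left add_left)

lemma sum_right: "\<lbrakk>\<And>j. j \<in> J \<Longrightarrow> f j \<in> X; z \<in> X\<rbrakk> \<Longrightarrow> b z (sum f J) = (\<Sum>j\<in>J. b z (f j))"
  using sum_left[of J f z] by (simp add: sym)

lemma norm_nonneg [simp]: "x \<in> X \<Longrightarrow> 0 \<le> form_norm b x"
  by (simp add: form_norm_def nonneg)

lemma norm_square: "x \<in> X \<Longrightarrow> (form_norm b x)\<^sup>2 = b x x"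
  by (simp add: form_norm_def nonneg)

lemma norm_scale: "x \<in> X \<Longrightarrow> form_norm b (c *\<^sub>R x) = \<bar>c\<bar> * form_norm b x"
  by (simp add: form_norm_def scale_left scale_right real_sqrt_mult flip: mult.assoc power2_eq_square)

lemma norm_zero [simp]: "form_norm b 0 = 0"
  by (simp add: form_norm_def zero_left)

lemma Cauchy_Schwarz:
  assumes x: "x \<in> X" and y: "y \<in> X"
  shows "\<bar>b x y\<bar> \<le> form_norm b x * form_norm b y"
proof -
  have q: "0 \<le> b x x - 2 * t * b x y + t\<^sup>2 * b y y" for t
    using nonneg[of "x - t *\<^sub>R y"] x y sym[OF x y]
    by (simp add: diff_left diff_right scale_left scale_right power2_eq_square algebra_simps)
  have "(b x y)\<^sup>2 \<le> b x x * b y y"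
  proof (cases "b y y = 0")
    case True
    have "b x y = 0"
    proof (rule ccontr)
      assume "b x y \<noteq> 0"
      then show False
        \<comment> \<open>For \<open>b y y = 0\<close> the polynomial is affine in \<open>t\<close>; here it takes the value \<open>-1\<close>.\<close>
        using q[of "(b x x + 1) / (2 * b x y)"] True by (simp add: field_simps)
    qed
    then show ?thesis using True by simp
  next
    case False
    then have "0 < b y y" using nonneg[OF y] by simp
    then show ?thesis
      using q[of "b x y / b y y"] by (simp add: field_simps power2_eq_square)
  qed
  then have "sqrt ((b x y)\<^sup>2) \<le> sqrt (b x x * b y y)" by (rule real_sqrt_le_mono)
  then show ?thesis by (simp add: form_norm_def real_sqrt_mult)
qed

lemma norm_triangle:
  assumes x: "x \<in> X" and y: "y \<in> X"
  shows "form_norm b (x + y) \<le> form_norm b x + form_norm b y"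
proof (rule power2_le_imp_le)
  have "(form_norm b (x + y))\<^sup>2 = b x x + 2 * b x y + b y y"
    using x y sym[OF x y] by (simp add: norm_square add_left add_right)
  also have "\<dots> \<le> (form_norm b x + form_norm b y)\<^sup>2"
    using Cauchy_Schwarz[OF x y] norm_square[OF x] norm_square[OF y] by (simp add: power2_sum)
  finally show "(form_norm b (x + y))\<^sup>2 \<le> (form_norm b x + form_norm b y)\<^sup>2" .
qed (use x y in simp)

lemma norm_uminus: "x \<in> X \<Longrightarrow> form_norm b (- x) = form_norm b x"
  using norm_scale[of x "-1"] by simp

lemma norm_minus_commute: "\<lbrakk>x \<in> X; y \<in> X\<rbrakk> \<Longrightarrow> form_norm b (x - y) = form_norm b (y - x)"
  using norm_uminus[of "x - y"] by simp

lemma norm_triangle_via: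
  "\<lbrakk>x \<in> X; y \<in> X; z \<in> X\<rbrakk> \<Longrightarrow> form_norm b (x - z) \<le> form_norm b (x - y) + form_norm b (y - z)"
  using norm_triangle[of "x - y" "y - z"] by simp

lemma norm_triangle_reverse:
  assumes x: "x \<in> X" and y: "y \<in> X"
  shows "\<bar>form_norm b x - form_norm b y\<bar> \<le> form_norm b (x - y)"
  using norm_triangle[of "x - y" y] norm_triangle[of "y - x" x] norm_minus_commute[OF x y] x y
  by simp

lemma norm_sum:
  "(\<And>j. j \<in> J \<Longrightarrow> f j \<in> X) \<Longrightarrow> form_norm b (sum f J) \<le> (\<Sum>j\<in>J. form_norm b (f j))"
proof (induction J rule: infinite_finite_induct)
  case (insert j J)
  have "form_norm b (f j + sum f J) \<le> form_norm b (f j) + form_norm b (sum f J)"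
    using insert by (intro norm_triangle) auto
  then show ?case using insert by force
qed auto

lemma null_left: "\<lbrakk>x \<in> X; y \<in> X; form_norm b x = 0\<rbrakk> \<Longrightarrow> b x y = 0"
  using Cauchy_Schwarz[of x y] by simp

text \<open>The squared lengths \<open>d\<close> are arbitrary because the discrete eigenfunctions are orthogonal for
two forms: with lengths \<open>1\<close> for the mass form and with the eigenvalues for the energy form.\<close>

lemma orthonormal_expansion:
  assumes "finite J" "\<And>j. j \<in> J \<Longrightarrow> e j \<in> X"
    and "\<And>i j. \<lbrakk>i \<in> J; j \<in> J\<rbrakk> \<Longrightarrow> b (e i) (e j) = (if i = j then d i else 0)"
  shows "i \<in> J \<Longrightarrow> b (\<Sum>j\<in>J. c j *\<^sub>R e j) (e i) = c i * d i"
    and "b (\<Sum>j\<in>J. c j *\<^sub>R e j) (\<Sum>j\<in>J. c j *\<^sub>R e j) = (\<Sum>j\<in>J. (c j)\<^sup>2 * d j)"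
proof -
  show *: "b (\<Sum>j\<in>J. c j *\<^sub>R e j) (e i) = c i * d i" if "i \<in> J" for i
  proof -
    have "b (\<Sum>j\<in>J. c j *\<^sub>R e j) (e i) = (\<Sum>j\<in>J. c j * b (e j) (e i))"
      using assms that by (subst sum_left) (auto simp: scale_left)
    also have "\<dots> = (\<Sum>j\<in>J. if j = i then c i * d i else 0)"
      by (rule sum.cong) (auto simp: assms that)
    finally show ?thesis using assms(1) that by simp
  qed
  have "b (\<Sum>j\<in>J. c j *\<^sub>R e j) (\<Sum>j\<in>J. c j *\<^sub>R e j)
      = (\<Sum>i\<in>J. c i * b (\<Sum>j\<in>J. c j *\<^sub>R e j) (e i))"
    using assms by (subst sum_right) (auto simp: scale_right)
  then show "b (\<Sum>j\<in>J. c j *\<^sub>R e j) (\<Sum>j\<in>J. c j *\<^sub>R e j) = (\<Sum>j\<in>J. (c j)\<^sup>2 * d j)"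
    by (simp add: * power2_eq_square mult.assoc)
qed

lemma Bessel:
  assumes J: "finite J" and e: "\<And>j. j \<in> J \<Longrightarrow> e j \<in> X"
    and on: "\<And>i j. \<lbrakk>i \<in> J; j \<in> J\<rbrakk> \<Longrightarrow> b (e i) (e j) = (if i = j then 1 else 0)" and x: "x \<in> X"
  shows "(\<Sum>j\<in>J. (b x (e j))\<^sup>2) \<le> b x x"
proof -
  define p where "p = (\<Sum>j\<in>J. b x (e j) *\<^sub>R e j)"
  have p: "p \<in> X" using e by (simp add: p_def)
  have pp: "b p p = (\<Sum>j\<in>J. (b x (e j))\<^sup>2)"
    using orthonormal_expansion(2)[OF J e on, where c="\<lambda>j. b x (e j)"] by (simp add: p_def)
  have "b x p = (\<Sum>j\<in>J. (b x (e j))\<^sup>2)"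
    unfolding p_def using e x by (subst sum_right) (auto simp: scale_right power2_eq_square)
  then show ?thesis
    using nonneg[of "x - p"] x p pp sym[OF x p] by (simp add: diff_left diff_right)
qed

lemma tendsto_form:
  assumes f: "\<And>k. f k \<in> X" and g: "\<And>k. g k \<in> X" and y: "y \<in> X" and z: "z \<in> X"
    and fy: "(\<lambda>k. form_norm b (f k - y)) \<longlonglongrightarrow> 0" and gz: "(\<lambda>k. form_norm b (g k - z)) \<longlonglongrightarrow> 0"
  shows "(\<lambda>k. b (f k) (g k)) \<longlonglongrightarrow> b y z"
proof -
  have "\<bar>b (f k) (g k) - b y z\<bar> \<le> form_norm b (f k - y) * (form_norm b (g k - z) + form_norm b z)
      + form_norm b y * form_norm b (g k - z)" for k
  proof -
    have "b (f k) (g k) - b y z = b (f k - y) (g k) + b y (g k - z)"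
      using f g y z by (simp add: diff_left diff_right)
    moreover have "\<bar>b (f k - y) (g k)\<bar> \<le> form_norm b (f k - y) * (form_norm b (g k - z) + form_norm b z)"
      using Cauchy_Schwarz[of "f k - y" "g k"] norm_triangle[of "g k - z" z] f g y z
      by (smt (verit) X_simps diff_add_cancel mult_left_mono norm_nonneg)
    moreover have "\<bar>b y (g k - z)\<bar> \<le> form_norm b y * form_norm b (g k - z)"
      using Cauchy_Schwarz[of y "g k - z"] g y z by simp
    ultimately show ?thesis by linarith
  qed
  moreover have "(\<lambda>k. form_norm b (f k - y) * (form_norm b (g k - z) + form_norm b z)
      + form_norm b y * form_norm b (g k - z)) \<longlonglongrightarrow> 0 * (0 + form_norm b z) + form_norm b y * 0"
    by (intro tendsto_intros fy gz)
  ultimately have "(\<lambda>k. b (f k) (g k) - b y z) \<longlonglongrightarrow> 0"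
    by (intro Lim_null_comparison[where f="\<lambda>k. b (f k) (g k) - b y z"]) auto
  then show ?thesis using Lim_null by blast
qed

end

text \<open>With more vectors \<open>\<psi>\<close> than \<open>e\<close>, some non-trivial combination of the \<open>\<psi>\<close> has vanishing
coordinates with respect to the \<open>e\<close> and is therefore null, whereas orthogonality makes its
squared length positive.\<close>

lemma (in semi_inner) orthogonal_card_le:
  assumes P: "finite P" and Q: "finite Q" and \<psi>: "\<And>p. p \<in> P \<Longrightarrow> \<psi> p \<in> X"
    and e: "\<And>q. q \<in> Q \<Longrightarrow> e q \<in> X"
    and orth: "\<And>i j. \<lbrakk>i \<in> P; j \<in> P\<rbrakk> \<Longrightarrow> b (\<psi> i) (\<psi> j) = (if i = j then d i else 0)"
    and d: "\<And>p. p \<in> P \<Longrightarrow> 0 < d p"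
    and span: "\<And>p. p \<in> P \<Longrightarrow> \<exists>c. form_norm b (\<psi> p - (\<Sum>q\<in>Q. c q *\<^sub>R e q)) = 0"
  shows "card P \<le> card Q"
proof (rule ccontr)
  assume "\<not> card P \<le> card Q"
  obtain c where c: "\<And>p. p \<in> P \<Longrightarrow> form_norm b (\<psi> p - (\<Sum>q\<in>Q. c p q *\<^sub>R e q)) = 0"
    using span by metis
  obtain x where x: "\<exists>p\<in>P. x p \<noteq> 0" "\<forall>q\<in>Q. (\<Sum>p\<in>P. x p * c p q) = 0"
    using underdetermined_system[OF Q P, of c] \<open>\<not> card P \<le> card Q\<close> by auto
  define v where "v = (\<Sum>p\<in>P. x p *\<^sub>R \<psi> p)"
  have eX: "(\<Sum>q\<in>Q. c p q *\<^sub>R e q) \<in> X" for p using e by (intro X_simps) auto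
  have "(\<Sum>p\<in>P. x p *\<^sub>R (\<Sum>q\<in>Q. c p q *\<^sub>R e q)) = (\<Sum>q\<in>Q. (\<Sum>p\<in>P. x p * c p q) *\<^sub>R e q)"
    unfolding scaleR_sum_right scaleR_sum_left scaleR_scaleR by (rule sum.swap)
  also have "\<dots> = 0" using x by (intro sum.neutral) auto
  finally have "v = (\<Sum>p\<in>P. x p *\<^sub>R (\<psi> p - (\<Sum>q\<in>Q. c p q *\<^sub>R e q)))"
    by (simp add: v_def scaleR_diff_right sum_subtractf)
  also have "form_norm b \<dots> \<le> (\<Sum>p\<in>P. form_norm b (x p *\<^sub>R (\<psi> p - (\<Sum>q\<in>Q. c p q *\<^sub>R e q))))"
    using \<psi> eX by (intro norm_sum X_simps(3,5)) auto
  also have "\<dots> = 0" using \<psi> eX c by (intro sum.neutral) (simp add: norm_scale)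
  finally have "form_norm b v \<le> 0" .
  moreover have v: "v \<in> X" unfolding v_def using \<psi> by (intro X_simps) auto
  ultimately have "b v v = 0" using norm_square[OF v] norm_nonneg[OF v] by simp
  then have "(\<Sum>p\<in>P. (x p)\<^sup>2 * d p) = 0"
    using orthonormal_expansion(2)[OF P \<psi> orth, where c=x] by (simp add: v_def)
  then have "\<forall>p\<in>P. (x p)\<^sup>2 * d p = 0"
    using d P by (subst (asm) sum_nonneg_eq_0_iff) (auto simp: less_imp_le)
  with x(1) d show False by force
qed

text \<open>A non-null residual would be orthogonal to all \<open>\<phi>\<close> and so yield \<open>N + 1\<close> orthogonal vectors
in the span of \<open>N\<close> vectors.\<close>

lemma (in semi_inner) orthonormal_complete:
  assumes W: "subspace W" "W \<subseteq> X" and \<phi>: "\<And>j. j \<in> {1..N::nat} \<Longrightarrow> \<phi> j \<in> W"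
    and on: "\<And>i j. \<lbrakk>i \<in> {1..N}; j \<in> {1..N}\<rbrakk> \<Longrightarrow> b (\<phi> i) (\<phi> j) = (if i = j then 1 else 0)"
    and e: "\<And>j. j \<in> {1..N} \<Longrightarrow> e j \<in> W"
    and span: "\<And>f. f \<in> W \<Longrightarrow> \<exists>c. form_norm b (f - (\<Sum>j=1..N. c j *\<^sub>R e j)) = 0"
    and w: "w \<in> W"
  shows "form_norm b (w - (\<Sum>j=1..N. b w (\<phi> j) *\<^sub>R \<phi> j)) = 0"
proof (rule ccontr)
  assume neg: "\<not> ?thesis"
  define r where "r = w - (\<Sum>j=1..N. b w (\<phi> j) *\<^sub>R \<phi> j)"
  have rW: "r \<in> W" unfolding r_def using W(1) \<phi> w by (intro subspace_diff subspace_sum subspace_scale)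
  then have rX: "r \<in> X" using W by blast
  have \<phi>X: "\<phi> j \<in> X" if "j \<in> {1..N}" for j using \<phi>[OF that] W by blast
  have eX: "e j \<in> X" if "j \<in> {1..N}" for j using e[OF that] W by blast
  have wX: "w \<in> X" using w W by blast
  have r\<phi>: "b r (\<phi> j) = 0" if "j \<in> {1..N}" for j
  proof -
    have "b (\<Sum>j=1..N. b w (\<phi> j) *\<^sub>R \<phi> j) (\<phi> j) = b w (\<phi> j)"
      using orthonormal_expansion(1)[of "{1..N}" \<phi> "\<lambda>_. 1" j "\<lambda>j. b w (\<phi> j)"] \<phi>X on that by simp
    moreover have "(\<Sum>j=1..N. b w (\<phi> j) *\<^sub>R \<phi> j) \<in> X" using \<phi>X by (intro X_simps) auto
    ultimately show ?thesis unfolding r_def using wX \<phi>X[OF that] by (simp add: diff_left)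
  qed
  have "0 < form_norm b r" using neg norm_nonneg[OF rX] unfolding r_def by linarith
  then have rr: "0 < b r r" by (simp add: form_norm_def)
  define \<psi> where "\<psi> j = (if j = 0 then r else \<phi> j)" for j
  have \<psi>W: "\<psi> j \<in> W" if "j \<in> {0..N}" for j using rW \<phi> that by (auto simp: \<psi>_def)
  have "card {0..N} \<le> card {1..N}"
  proof (rule orthogonal_card_le[where \<psi>=\<psi> and e=e and d="\<lambda>j. if j = 0 then b r r else 1"])
    show "b (\<psi> i) (\<psi> j) = (if i = j then if i = 0 then b r r else 1 else 0)"
      if "i \<in> {0..N}" "j \<in> {0..N}" for i j
      using that r\<phi>[of i] r\<phi>[of j] on[of i j] sym[OF rX \<phi>X[of i]] by (auto simp: \<psi>_def Suc_le_eq)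
    show "\<exists>c. form_norm b (\<psi> p - (\<Sum>q=1..N. c q *\<^sub>R e q)) = 0" if "p \<in> {0..N}" for p
      using span[OF \<psi>W[OF that]] .
  qed (use rr \<psi>W W eX in auto)
  then show False by simp
qed

text \<open>The three-epsilon argument by which a norm limit of finite-rank operators inherits their
compactness.\<close>

lemma (in semi_inner) Cauchy_approximable:
  assumes x: "\<And>k. x k \<in> X" and y: "\<And>q k. y q k \<in> X"
    and close: "\<And>q k. form_norm b (x k - y q k) \<le> d q" and d: "d \<longlonglongrightarrow> 0"
    and y_Cauchy: "\<And>q. form_Cauchy b (y q)"
  shows "form_Cauchy b x"
  unfolding form_Cauchy_def
proof (intro allI impI)
  fix e :: real assume e: "0 < e"
  obtain q where q: "d q < e / 3"
    using order_tendstoD(2)[OF d, of "e / 3"] e by (auto simp: eventually_sequentially)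
  obtain K where K: "\<And>m n. \<lbrakk>K \<le> m; K \<le> n\<rbrakk> \<Longrightarrow> form_norm b (y q m - y q n) < e / 3"
    using y_Cauchy[of q] e unfolding form_Cauchy_def by (metis divide_pos_pos zero_less_numeral)
  have "form_norm b (x m - x n) < e" if "K \<le> m" "K \<le> n" for m n
  proof -
    have "form_norm b (x m - x n) \<le> form_norm b (x m - y q m) + form_norm b (y q m - x n)"
      using x y by (intro norm_triangle_via)
    also have "form_norm b (y q m - x n) \<le> form_norm b (y q m - y q n) + form_norm b (y q n - x n)"
      using x y by (intro norm_triangle_via)
    also have "form_norm b (y q n - x n) = form_norm b (x n - y q n)"
      using x y by (intro norm_minus_commute)
    finally show ?thesis using close[of m q] close[of n q] K[OF that] q by linarith
  qed
  then show "\<exists>K. \<forall>m\<ge>K. \<forall>n\<ge>K. form_norm b (x m - x n) < e" by blast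
qed

lemma (in semi_inner) Cauchy_asymptotic:
  assumes x: "\<And>k. x k \<in> X" and y: "\<And>k. y k \<in> X"
    and close: "(\<lambda>k. form_norm b (x k - y k)) \<longlonglongrightarrow> 0" and y_Cauchy: "form_Cauchy b y"
  shows "form_Cauchy b x"
  unfolding form_Cauchy_def
proof (intro allI impI)
  fix e :: real assume e: "0 < e"
  obtain K1 where K1: "\<And>n. K1 \<le> n \<Longrightarrow> form_norm b (x n - y n) < e / 3"
    using order_tendstoD(2)[OF close, of "e / 3"] e by (auto simp: eventually_sequentially)
  obtain K where K: "\<And>m n. \<lbrakk>K \<le> m; K \<le> n\<rbrakk> \<Longrightarrow> form_norm b (y m - y n) < e / 3"
    using y_Cauchy e unfolding form_Cauchy_def by (metis divide_pos_pos zero_less_numeral)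
  have "form_norm b (x m - x n) < e" if "max K K1 \<le> m" "max K K1 \<le> n" for m n
  proof -
    have "form_norm b (x m - x n) \<le> form_norm b (x m - y m) + form_norm b (y m - x n)"
      using x y by (intro norm_triangle_via)
    also have "form_norm b (y m - x n) \<le> form_norm b (y m - y n) + form_norm b (y n - x n)"
      using x y by (intro norm_triangle_via)
    also have "form_norm b (y n - x n) = form_norm b (x n - y n)"
      using x y by (intro norm_minus_commute)
    finally show ?thesis using K1[of m] K1[of n] K[of m n] that by linarith
  qed
  then show "\<exists>K. \<forall>m\<ge>K. \<forall>n\<ge>K. form_norm b (x m - x n) < e" by blast
qed

lemma (in semi_inner) Cauchy_scale:
  assumes y: "\<And>k. y k \<in> X" and c: "convergent c" and B: "\<And>k. form_norm b (y k) \<le> B"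
    and y_Cauchy: "form_Cauchy b y"
  shows "form_Cauchy b (\<lambda>k. c k *\<^sub>R y k)"
  unfolding form_Cauchy_def
proof (intro allI impI)
  fix e :: real assume e: "0 < e"
  obtain M where M: "0 < M" "\<And>k. \<bar>c k\<bar> \<le> M"
    using convergent_imp_Bseq[OF c] unfolding Bseq_def by auto
  have B0: "0 \<le> B" using B[of 0] norm_nonneg[OF y[of 0]] by linarith
  have "0 < e / (2 * (B + 1))" using e B0 by simp
  then obtain K1 where K1: "\<And>m n. \<lbrakk>K1 \<le> m; K1 \<le> n\<rbrakk> \<Longrightarrow> \<bar>c m - c n\<bar> < e / (2 * (B + 1))"
    using convergent_Cauchy[OF c] unfolding Cauchy_def dist_real_def by blast
  have "0 < e / (2 * M)" using e M by simp
  then obtain K where K: "\<And>m n. \<lbrakk>K \<le> m; K \<le> n\<rbrakk> \<Longrightarrow> form_norm b (y m - y n) < e / (2 * M)"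
    using y_Cauchy unfolding form_Cauchy_def by blast
  have "form_norm b (c m *\<^sub>R y m - c n *\<^sub>R y n) < e" if "max K K1 \<le> m" "max K K1 \<le> n" for m n
  proof -
    have "c m *\<^sub>R y m - c n *\<^sub>R y n = c m *\<^sub>R (y m - y n) + (c m - c n) *\<^sub>R y n"
      by (simp add: algebra_simps)
    then have "form_norm b (c m *\<^sub>R y m - c n *\<^sub>R y n)
        \<le> \<bar>c m\<bar> * form_norm b (y m - y n) + \<bar>c m - c n\<bar> * form_norm b (y n)"
      using norm_triangle[of "c m *\<^sub>R (y m - y n)" "(c m - c n) *\<^sub>R y n"] y
      by (simp add: norm_scale)
    also have "\<bar>c m\<bar> * form_norm b (y m - y n) \<le> M * form_norm b (y m - y n)"
      using M y by (intro mult_right_mono) auto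
    also have "M * form_norm b (y m - y n) < e / 2"
      using K[of m n] that M by (simp add: field_simps)
    also have "\<bar>c m - c n\<bar> * form_norm b (y n) \<le> \<bar>c m - c n\<bar> * (B + 1)"
      using B[of n] by (intro mult_left_mono) auto
    also have "\<bar>c m - c n\<bar> * (B + 1) \<le> e / 2"
      using K1[of m n] that B0 by (simp add: field_simps)
    finally show ?thesis by simp
  qed
  then show "\<exists>K. \<forall>m\<ge>K. \<forall>n\<ge>K. form_norm b (c m *\<^sub>R y m - c n *\<^sub>R y n) < e" by blast
qed

section \<open>Galerkin approximation of a solution operator\<close>

text \<open>One fixed mesh. The mass form \<open>b\<close> lives on \<open>L\<close> and the energy form \<open>A\<close> on \<open>X\<close>, which contains
the continuous space \<open>V\<close> and the discrete space \<open>W\<close>. The number \<open>\<eta>\<close>, later a multiple of \<open>h\<^sup>s\<close>,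
bounds both the best approximation error and the consistency error of solutions \<open>T f\<close>. The \<open>\<phi>\<close>
are the discrete eigenfunctions, which span \<open>W\<close> up to null vectors of \<open>b\<close>.\<close>

locale galerkin = mass: semi_inner L b + energy: semi_inner X A
  for L :: "'v::real_vector set" and b :: "'v \<Rightarrow> 'v \<Rightarrow> real"
    and X :: "'v set" and A :: "'v \<Rightarrow> 'v \<Rightarrow> real" +
  fixes V W :: "'v set" and T :: "'v \<Rightarrow> 'v" and \<gamma> \<eta> :: real
    and N :: nat and ev :: "nat \<Rightarrow> real" and \<phi> :: "nat \<Rightarrow> 'v"
  assumes XL: "X \<subseteq> L" and VX: "V \<subseteq> X" and WX: "W \<subseteq> X"
    and V_subspace: "subspace V" and W_subspace: "subspace W"
    and T_V: "f \<in> L \<Longrightarrow> T f \<in> V"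
    and T_weak: "\<lbrakk>f \<in> L; v \<in> V\<rbrakk> \<Longrightarrow> A (T f) v = b f v"
    and approximation: "\<lbrakk>f \<in> L; 0 < e\<rbrakk> \<Longrightarrow>
      \<exists>w\<in>W. form_norm A (T f - w) \<le> \<eta> * form_norm b f + e"
    and consistency: "\<lbrakk>f \<in> L; w \<in> W\<rbrakk> \<Longrightarrow>
      \<bar>A (T f) w - b f w\<bar> \<le> \<eta> * form_norm b f * form_norm A w"
    and Poincare: "v \<in> V \<Longrightarrow> form_norm b v \<le> \<gamma> * form_norm A v"
    and \<gamma>: "0 \<le> \<gamma>" and \<eta>: "0 \<le> \<eta>"
    and \<phi>_W: "j \<in> {1..N} \<Longrightarrow> \<phi> j \<in> W"
    and ev_pos: "j \<in> {1..N} \<Longrightarrow> 0 < ev j"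
    and ev_mono: "\<lbrakk>i \<in> {1..N}; j \<in> {1..N}; i \<le> j\<rbrakk> \<Longrightarrow> ev i \<le> ev j"
    and \<phi>_eigen: "\<lbrakk>j \<in> {1..N}; w \<in> W\<rbrakk> \<Longrightarrow> A (\<phi> j) w = ev j * b (\<phi> j) w"
    and \<phi>_orthonormal: "\<lbrakk>i \<in> {1..N}; j \<in> {1..N}\<rbrakk> \<Longrightarrow> b (\<phi> i) (\<phi> j) = (if i = j then 1 else 0)"
    and \<phi>_complete: "w \<in> W \<Longrightarrow> form_norm b (w - (\<Sum>j=1..N. b w (\<phi> j) *\<^sub>R \<phi> j)) = 0"
begin

lemma member [simp]: "v \<in> V \<Longrightarrow> v \<in> X" "w \<in> W \<Longrightarrow> w \<in> X" "x \<in> X \<Longrightarrow> x \<in> L"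
  "v \<in> V \<Longrightarrow> v \<in> L" "w \<in> W \<Longrightarrow> w \<in> L" "f \<in> L \<Longrightarrow> T f \<in> X" "f \<in> L \<Longrightarrow> T f \<in> L"
  "j \<in> {1..N} \<Longrightarrow> \<phi> j \<in> X" "j \<in> {1..N} \<Longrightarrow> \<phi> j \<in> L"
  using XL VX WX T_V \<phi>_W by blast+

text \<open>The discrete solution operator in terms of the discrete eigenfunctions; \<open>S_weak\<close> is its
variational characterisation.\<close>

definition S :: "'v \<Rightarrow> 'v" where
  "S f = (\<Sum>j=1..N. (b f (\<phi> j) / ev j) *\<^sub>R \<phi> j)"

lemma S_W: "S f \<in> W"
  unfolding S_def using W_subspace \<phi>_W by (intro subspace_sum subspace_scale) auto

lemma S_member [simp]: "S f \<in> X" "S f \<in> L"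
  using S_W by auto

lemma S_weak:
  assumes f: "f \<in> L" and w: "w \<in> W"
  shows "A (S f) w = b f w"
proof -
  define p where "p = (\<Sum>j=1..N. b w (\<phi> j) *\<^sub>R \<phi> j)"
  have p: "p \<in> L" unfolding p_def by (intro mass.X_simps) auto
  have "A (S f) w = (\<Sum>j=1..N. b f (\<phi> j) / ev j * A (\<phi> j) w)"
    unfolding S_def using w by (subst energy.sum_left) (auto simp: energy.scale_left)
  also have "\<dots> = (\<Sum>j=1..N. b f (\<phi> j) * b w (\<phi> j))"
    using ev_pos w by (intro sum.cong) (auto simp: \<phi>_eigen mass.sym less_imp_neq[symmetric])
  also have "\<dots> = b f p"
    unfolding p_def using f
    by (subst mass.sum_right) (auto simp: mass.scale_right mult.commute)
  also have "b f p = b f w"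
    using \<phi>_complete[OF w, folded p_def] mass.null_left[of "w - p" f] f w p
    by (simp add: mass.sym mass.diff_right)
  finally show ?thesis .
qed

text \<open>The second Strang lemma. For a nearly optimal \<open>w\<close>, the energy of \<open>d = S f - w\<close> is a
consistency error tested with \<open>d\<close> plus the approximation error \<open>v - w\<close> tested with \<open>d\<close>.
The bound \<open>\<kappa>\<close> is kept separate from \<open>\<eta>\<close>: the lemma is applied to \<open>v = T f\<close> for all \<open>f\<close>, where
\<open>\<kappa> = \<eta> \<parallel>f\<parallel>\<close>, but also to the exact eigenfunction, where \<open>\<kappa>\<close> involves its own seminorm.\<close>

lemma Strang:
  assumes v: "v \<in> V" and f: "f \<in> L"
    and appr: "\<And>e. 0 < e \<Longrightarrow> \<exists>w\<in>W. form_norm A (v - w) \<le> \<kappa> + e"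
    and cons: "\<And>w. w \<in> W \<Longrightarrow> \<bar>A v w - b f w\<bar> \<le> \<kappa> * form_norm A w"
  shows "form_norm A (v - S f) \<le> 3 * \<kappa>"
proof (rule field_le_epsilon)
  fix e :: real assume e: "0 < e"
  then obtain w where w: "w \<in> W" "form_norm A (v - w) \<le> \<kappa> + e / 2" using appr[of "e / 2"] by auto
  define d where "d = S f - w"
  have d: "d \<in> W" using W_subspace S_W w by (simp add: d_def subspace_diff)
  have "form_norm A d * form_norm A d = A (S f) d - A w d"
    using d w energy.norm_square[of d] by (simp add: d_def energy.diff_left power2_eq_square)
  also have "\<dots> = (b f d - A v d) + A (v - w) d"
    using v f w d by (simp add: S_weak energy.diff_left)
  also have "\<dots> \<le> \<kappa> * form_norm A d + form_norm A (v - w) * form_norm A d"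
    using cons[OF d] energy.Cauchy_Schwarz[of "v - w" d] v w d by simp
  also have "\<dots> \<le> (2 * \<kappa> + e / 2) * form_norm A d"
    using mult_right_mono[OF w(2), of "form_norm A d"] d by (simp add: algebra_simps)
  finally have *: "form_norm A d * form_norm A d \<le> (2 * \<kappa> + e / 2) * form_norm A d" .
  have "0 \<le> \<kappa> + x" if x: "0 < x" for x
  proof -
    obtain w' where "w' \<in> W" "form_norm A (v - w') \<le> \<kappa> + x" using appr[OF x] by blast
    moreover have "0 \<le> form_norm A (v - w')" using \<open>w' \<in> W\<close> v by simp
    ultimately show ?thesis by linarith
  qed
  then have "0 \<le> \<kappa>" by (rule field_le_epsilon)
  then have "form_norm A d \<le> 2 * \<kappa> + e / 2"
    using * e d by - (rule le_if_square_le_mult, auto)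
  moreover have "form_norm A (v - S f) \<le> form_norm A (v - w) + form_norm A d"
    using energy.norm_triangle_via[of v w "S f"] energy.norm_minus_commute[of w "S f"] v w
    by (simp add: d_def)
  ultimately show "form_norm A (v - S f) \<le> 3 * \<kappa> + e" using w by simp
qed

lemma energy_T_le: "f \<in> L \<Longrightarrow> form_norm A (T f) \<le> \<gamma> * form_norm b f"
proof -
  assume f: "f \<in> L"
  have "form_norm A (T f) * form_norm A (T f) = b f (T f)"
    using f T_weak[OF f T_V[OF f]] energy.norm_square[of "T f"] by (simp add: power2_eq_square)
  also have "\<dots> \<le> form_norm b f * (\<gamma> * form_norm A (T f))"
    using mass.Cauchy_Schwarz[of f "T f"] Poincare[OF T_V[OF f]] f
    by (smt (verit) mass.norm_nonneg member(7) mult_left_mono)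
  finally have "form_norm A (T f) * form_norm A (T f) \<le> (\<gamma> * form_norm b f) * form_norm A (T f)"
    by (simp add: mult_ac)
  then show ?thesis using f \<gamma> by - (rule le_if_square_le_mult, auto)
qed

lemma energy_T_diff:
  assumes f: "f \<in> L" and g: "g \<in> L"
  shows "form_norm A (T f - T g) \<le> \<gamma> * form_norm b (f - g)"
proof -
  define d where "d = T f - T g"
  have d: "d \<in> V" using V_subspace T_V f g by (simp add: d_def subspace_diff)
  have "form_norm A d * form_norm A d = A (T f) d - A (T g) d"
    using d f g energy.norm_square[of d] by (simp add: d_def energy.diff_left power2_eq_square)
  also have "\<dots> = b (f - g) d" using d f g by (simp add: T_weak mass.diff_left)
  also have "\<dots> \<le> form_norm b (f - g) * (\<gamma> * form_norm A d)"
    using mass.Cauchy_Schwarz[of "f - g" d] Poincare[OF d] f g d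
    by (smt (verit) mass.norm_nonneg mass.X_simps(3) member(4) mult_left_mono)
  finally have "form_norm A d * form_norm A d \<le> (\<gamma> * form_norm b (f - g)) * form_norm A d"
    by (simp add: mult_ac)
  then show ?thesis using f g d \<gamma> unfolding d_def[symmetric]
    by - (rule le_if_square_le_mult, auto)
qed

lemma mass_T_diff:
  assumes f: "f \<in> L" and g: "g \<in> L"
  shows "form_norm b (T f - T g) \<le> \<gamma>\<^sup>2 * form_norm b (f - g)"
proof -
  have "T f - T g \<in> V" using V_subspace T_V f g by (simp add: subspace_diff)
  from Poincare[OF this] have "form_norm b (T f - T g) \<le> \<gamma> * form_norm A (T f - T g)" .
  also have "\<dots> \<le> \<gamma> * (\<gamma> * form_norm b (f - g))"
    using energy_T_diff[OF f g] \<gamma> by (rule mult_left_mono)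
  finally show ?thesis by (simp add: power2_eq_square)
qed

text \<open>The Aubin--Nitsche argument: the error \<open>e = v - w\<close> is tested with the dual solution \<open>T e\<close>. As
\<open>w\<close> need not lie in \<open>V\<close>, the dual solution contributes its consistency error, which is the
second term.\<close>

lemma duality:
  assumes v: "v \<in> V" and w: "w \<in> W"
  shows "form_norm b (v - w) \<le> \<gamma> * form_norm A (v - w) + \<eta> * form_norm A w"
proof -
  define e where "e = v - w"
  have e: "e \<in> X" "e \<in> L" using v w by (simp_all add: e_def)
  have "form_norm b e * form_norm b e = b e v - b e w"
    using v w e mass.norm_square[of e] by (simp add: e_def mass.diff_right power2_eq_square)
  also have "b e v = A (T e) v" using T_weak e v by simp
  also have "A (T e) v - b e w = A (T e) e + (A (T e) w - b e w)"
    using v w e by (simp add: e_def energy.diff_right)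
  also have "\<dots> \<le> form_norm A (T e) * form_norm A e + \<eta> * form_norm b e * form_norm A w"
    using energy.Cauchy_Schwarz[of "T e" e] consistency[of e w] w e by simp
  also have "\<dots> \<le> \<gamma> * form_norm b e * form_norm A e + \<eta> * form_norm b e * form_norm A w"
    using energy_T_le[of e] e by (simp add: mult_right_mono)
  finally have "form_norm b e * form_norm b e
      \<le> (\<gamma> * form_norm A e + \<eta> * form_norm A w) * form_norm b e"
    by (simp add: algebra_simps)
  moreover have "0 \<le> \<gamma> * form_norm A e + \<eta> * form_norm A w" using e w \<gamma> \<eta> by simp
  ultimately show ?thesis using e unfolding e_def[symmetric]
    by - (rule le_if_square_le_mult, auto)
qed

text \<open>The bound for \<open>T - S\<close> in operator norm that results from \<open>Strang\<close> and \<open>duality\<close>.\<close>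

definition \<delta> :: real where "\<delta> = \<eta> * (4 * \<gamma> + 3 * \<eta>)"

lemma energy_S_le:
  assumes f: "f \<in> L"
  shows "form_norm A (S f) \<le> (\<gamma> + 3 * \<eta>) * form_norm b f"
    and "form_norm b (T f - S f) \<le> \<delta> * form_norm b f"
proof -
  have 1: "form_norm A (T f - S f) \<le> 3 * (\<eta> * form_norm b f)"
    using f approximation consistency by (intro Strang T_V) auto
  have "form_norm A (S f) \<le> form_norm A (T f) + form_norm A (T f - S f)"
    using energy.norm_triangle_reverse[of "T f" "S f"] f by simp
  then show 2: "form_norm A (S f) \<le> (\<gamma> + 3 * \<eta>) * form_norm b f"
    using 1 energy_T_le[OF f] by (simp add: algebra_simps)
  have "form_norm b (T f - S f) \<le> \<gamma> * form_norm A (T f - S f) + \<eta> * form_norm A (S f)"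
    using f by (intro duality T_V S_W)
  also have "\<dots> \<le> \<gamma> * (3 * (\<eta> * form_norm b f)) + \<eta> * ((\<gamma> + 3 * \<eta>) * form_norm b f)"
    using 1 2 \<gamma> \<eta> by (intro add_mono mult_left_mono)
  finally show "form_norm b (T f - S f) \<le> \<delta> * form_norm b f"
    by (simp add: \<delta>_def algebra_simps)
qed

lemma \<delta>_nonneg: "0 \<le> \<delta>"
  using \<gamma> \<eta> by (simp add: \<delta>_def)

text \<open>The min-max principle for \<open>T\<close> and \<open>S\<close>. Among the combinations of \<open>u 1, \<dots>, u k\<close> there is a
non-trivial \<open>v\<close> orthogonal to the first \<open>k - 1\<close> discrete eigenfunctions. The Rayleigh quotient of
\<open>T\<close> at \<open>v\<close> is at least \<open>1 / lam k\<close>, that of \<open>S\<close> is at most \<open>1 / ev k\<close>, and the two differ by at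
most \<open>\<delta>\<close>. If there were fewer than \<open>k\<close> discrete eigenfunctions, then the Rayleigh quotient of \<open>S\<close>
would vanish.\<close>

lemma discrete_eigenvalue_upper:
  assumes u: "\<And>i. i \<in> {1..k} \<Longrightarrow> u i \<in> L"
    and on: "\<And>i j. \<lbrakk>i \<in> {1..k}; j \<in> {1..k}\<rbrakk> \<Longrightarrow> b (u i) (u j) = (if i = j then 1 else 0)"
    and Tu: "\<And>v i. \<lbrakk>v \<in> L; i \<in> {1..k}\<rbrakk> \<Longrightarrow> b (T v) (u i) = b v (u i) / lam i"
    and lam: "\<And>i. i \<in> {1..k} \<Longrightarrow> 0 < lam i \<and> lam i \<le> lam k" and k: "1 \<le> k"
    and small: "\<delta> < 1 / lam k"
  shows "k \<le> N" and "1 / lam k - \<delta> \<le> 1 / ev k"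
proof -
  let ?Q = "{j. 1 \<le> j \<and> j \<le> N \<and> j < k}"
  have "?Q \<subseteq> {1..<k}" by auto
  then have "finite ?Q" "card ?Q < card {1..k}"
    using k card_mono[of "{1..<k}" ?Q] finite_subset by auto
  then obtain x where x: "\<exists>i\<in>{1..k}. x i \<noteq> 0" "\<forall>j\<in>?Q. (\<Sum>i=1..k. x i * b (u i) (\<phi> j)) = 0"
    using underdetermined_system[of ?Q "{1..k}" "\<lambda>i j. b (u i) (\<phi> j)"] by auto
  define v where "v = (\<Sum>i=1..k. x i *\<^sub>R u i)"
  have v: "v \<in> L" unfolding v_def using u by (intro mass.X_simps) auto
  have v\<phi>: "b v (\<phi> j) = 0" if "j \<in> ?Q" for j
    using x(2) that u unfolding v_def
    by (subst mass.sum_left) (auto simp: mass.scale_left)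
  have vv: "b v v = (\<Sum>i=1..k. (x i)\<^sup>2)"
    using mass.orthonormal_expansion(2)[of "{1..k}" u "\<lambda>_. 1" x] u on by (simp add: v_def)
  obtain i0 where "i0 \<in> {1..k}" "x i0 \<noteq> 0" using x(1) by blast
  then have pos: "0 < b v v" unfolding vv by (intro sum_pos2[of _ i0]) auto
  have vu: "b v (u i) = x i" if "i \<in> {1..k}" for i
    using mass.orthonormal_expansion(1)[of "{1..k}" u "\<lambda>_. 1" i x] u on that by (simp add: v_def)
  have "b v v / lam k \<le> (\<Sum>i=1..k. x i * (b v (u i) / lam i))"
    unfolding vv sum_divide_distrib using lam
    by (intro sum_mono) (auto simp: vu power2_eq_square intro!: divide_left_mono mult_pos_pos)
  also have "\<dots> = (\<Sum>i=1..k. b (T v) (x i *\<^sub>R u i))"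
    using u v Tu[OF v] by (intro sum.cong) (auto simp: mass.scale_right)
  also have "\<dots> = b (T v) v"
    using u v mass.sum_right[of "{1..k}" "\<lambda>i. x i *\<^sub>R u i" "T v"] by (simp add: v_def)
  finally have lower: "b v v / lam k \<le> b (T v) v" .
  have "b (T v) v - b (S v) v \<le> \<delta> * b v v"
    using mass.Cauchy_Schwarz[of "T v - S v" v] v mass.norm_square[OF v]
      mult_right_mono[OF energy_S_le(2)[OF v], of "form_norm b v"]
    by (simp add: mass.diff_left power2_eq_square mult.assoc)
  with lower have low: "(1 / lam k - \<delta>) * b v v \<le> b (S v) v" by (simp add: algebra_simps)
  have "b (S v) v = (\<Sum>j=1..N. b v (\<phi> j) / ev j * b (\<phi> j) v)"
    unfolding S_def using v by (subst mass.sum_left) (auto simp: mass.scale_left)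
  also have "\<dots> = (\<Sum>j=1..N. (b v (\<phi> j))\<^sup>2 / ev j)"
    using v by (intro sum.cong) (auto simp: mass.sym power2_eq_square)
  finally have Sv: "b (S v) v = (\<Sum>j=1..N. (b v (\<phi> j))\<^sup>2 / ev j)" .
  show kN: "k \<le> N"
  proof (rule ccontr)
    assume "\<not> k \<le> N"
    then have "b (S v) v = 0" unfolding Sv using v\<phi> by (intro sum.neutral) auto
    with low have "(1 / lam k - \<delta>) * b v v \<le> 0" by simp
    then show False using pos small by (simp add: mult_le_0_iff)
  qed
  have "b (S v) v \<le> (\<Sum>j=1..N. (b v (\<phi> j))\<^sup>2 / ev k)"
    unfolding Sv
  proof (rule sum_mono)
    fix j assume j: "j \<in> {1..N}"
    show "(b v (\<phi> j))\<^sup>2 / ev j \<le> (b v (\<phi> j))\<^sup>2 / ev k"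
    proof (cases "j < k")
      case True then show ?thesis using v\<phi> j by simp
    next
      case False
      then show ?thesis using ev_mono[of k j] ev_pos[of k] ev_pos[of j] j k kN
        by (intro divide_left_mono) auto
    qed
  qed
  also have "\<dots> \<le> b v v / ev k"
    using mass.Bessel[of "{1..N}" \<phi> v] v \<phi>_orthonormal ev_pos[of k] k kN
    by (simp add: sum_divide_distrib[symmetric] divide_right_mono)
  finally have "(1 / lam k - \<delta>) * b v v \<le> (1 / ev k) * b v v" using low by simp
  then show "1 / lam k - \<delta> \<le> 1 / ev k" using pos mult_le_cancel_right_pos by blast
qed

text \<open>With \<open>P = S (lam u)\<close> and its coefficients \<open>\<beta>\<close> in the discrete eigenbasis,
\<open>(ev j - lam) \<beta>\<^sub>j = lam b(u - P, \<phi>\<^sub>j)\<close>. Since the eigenvalues other than \<open>ev k\<close> keep a distance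
\<open>g\<close> from \<open>lam\<close>, the part \<open>R\<close> of \<open>P\<close> orthogonal to \<open>\<phi> k\<close> is controlled by the mass norm of
\<open>u - P\<close>, in the mass norm and, because \<open>ev / (ev - lam)\<^sup>2\<close> is bounded, also in the energy norm.
The coefficient of \<open>\<phi> k\<close> is non-negative and \<open>u\<close> and \<open>\<phi> k\<close> have mass norm \<open>1\<close>, so it is close
to \<open>1\<close>.\<close>

lemma eigenfunction_error:
  assumes u: "u \<in> V" "form_norm b u = 1" and lam: "0 < lam" and k: "k \<in> {1..N}"
    and e1: "form_norm A (u - S (lam *\<^sub>R u)) \<le> \<kappa>\<^sub>1"
    and e2: "form_norm b (u - S (lam *\<^sub>R u)) \<le> \<kappa>\<^sub>2"
    and gap: "\<And>j. \<lbrakk>j \<in> {1..N}; j \<noteq> k\<rbrakk> \<Longrightarrow> g \<le> \<bar>ev j - lam\<bar>" and g: "0 < g"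
    and M: "ev k \<le> M" and sgn: "0 \<le> b (S (lam *\<^sub>R u)) (\<phi> k)"
  shows "form_norm A (u - \<phi> k)
    \<le> \<kappa>\<^sub>1 + (lam * sqrt (1 / g + lam / g\<^sup>2) + (1 + lam / g) * sqrt M) * \<kappa>\<^sub>2"
proof -
  define P where "P = S (lam *\<^sub>R u)"
  define e where "e = u - P"
  define \<beta> where "\<beta> j = b P (\<phi> j)" for j
  have P: "P \<in> X" "P \<in> L" by (simp_all add: P_def)
  have e: "e \<in> L" "e \<in> X" using u P by (simp_all add: e_def)
  have k\<^sub>2: "0 \<le> \<kappa>\<^sub>2" using e2 mass.norm_nonneg[OF e(1)] by (simp add: e_def P_def)
  have \<beta>: "\<beta> j = b (lam *\<^sub>R u) (\<phi> j) / ev j" if "j \<in> {1..N}" for j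
    using mass.orthonormal_expansion(1)[of "{1..N}" \<phi> "\<lambda>_. 1" j "\<lambda>j. b (lam *\<^sub>R u) (\<phi> j) / ev j"]
      \<phi>_orthonormal that by (simp add: \<beta>_def P_def S_def)
  have P_eq: "P = (\<Sum>j=1..N. \<beta> j *\<^sub>R \<phi> j)"
    unfolding P_def S_def by (intro sum.cong refl) (simp add: \<beta>)
  define R where "R = (\<Sum>j\<in>{1..N}-{k}. \<beta> j *\<^sub>R \<phi> j)"
  have P_split: "P = \<beta> k *\<^sub>R \<phi> k + R"
    unfolding P_eq R_def using k by (simp add: sum.remove)
  have R: "R \<in> X" "R \<in> L" unfolding R_def by (intro energy.X_simps mass.X_simps; auto)+
  have rel: "(ev j - lam) * \<beta> j = lam * b e (\<phi> j)" if j: "j \<in> {1..N}" for j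
  proof -
    have 1: "ev j * \<beta> j = lam * b u (\<phi> j)"
      using \<beta>[OF j] ev_pos[OF j] u j by (simp add: mass.scale_left)
    have 2: "b e (\<phi> j) = b u (\<phi> j) - \<beta> j"
      using u P j by (simp add: e_def \<beta>_def mass.diff_left)
    show ?thesis by (simp only: 1 2 left_diff_distrib right_diff_distrib)
  qed
  have \<beta>_le: "(\<beta> j)\<^sup>2 \<le> (lam / \<bar>ev j - lam\<bar>)\<^sup>2 * (b e (\<phi> j))\<^sup>2" if j: "j \<in> {1..N} - {k}" for j
  proof -
    have "ev j - lam \<noteq> 0" using gap[of j] g j by force
    then have "\<beta> j = lam / (ev j - lam) * b e (\<phi> j)" using rel[of j] j by (simp add: field_simps)
    then show ?thesis by (simp add: power_mult_distrib power_divide)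
  qed
  have Bes: "(\<Sum>j\<in>{1..N}-{k}. (b e (\<phi> j))\<^sup>2) \<le> \<kappa>\<^sub>2\<^sup>2"
  proof -
    have "(\<Sum>j\<in>{1..N}-{k}. (b e (\<phi> j))\<^sup>2) \<le> b e e"
      using e \<phi>_orthonormal by (intro mass.Bessel) auto
    also have "\<dots> = (form_norm b e)\<^sup>2" using e by (simp add: mass.norm_square)
    also have "\<dots> \<le> \<kappa>\<^sub>2\<^sup>2" using e2 e by (intro power_mono) (auto simp: e_def P_def)
    finally show ?thesis .
  qed
  have "(form_norm b R)\<^sup>2 = (\<Sum>j\<in>{1..N}-{k}. (\<beta> j)\<^sup>2)"
    using mass.orthonormal_expansion(2)[of "{1..N}-{k}" \<phi> "\<lambda>_. 1" \<beta>] \<phi>_orthonormal R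
    by (simp add: mass.norm_square) (simp add: R_def)
  also have "\<dots> \<le> (\<Sum>j\<in>{1..N}-{k}. (lam / g)\<^sup>2 * (b e (\<phi> j))\<^sup>2)"
  proof (rule sum_mono)
    fix j assume j: "j \<in> {1..N} - {k}"
    have "(lam / \<bar>ev j - lam\<bar>)\<^sup>2 \<le> (lam / g)\<^sup>2"
      using gap[of j] g lam j by (intro power_mono divide_left_mono mult_pos_pos) auto
    then show "(\<beta> j)\<^sup>2 \<le> (lam / g)\<^sup>2 * (b e (\<phi> j))\<^sup>2"
      using \<beta>_le[OF j] mult_right_mono[of _ _ "(b e (\<phi> j))\<^sup>2"] by fastforce
  qed
  also have "\<dots> \<le> (lam / g * \<kappa>\<^sub>2)\<^sup>2"
    using mult_left_mono[OF Bes, of "(lam / g)\<^sup>2"] by (simp add: sum_distrib_left power_mult_distrib power_divide)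
  finally have bR: "form_norm b R \<le> lam / g * \<kappa>\<^sub>2"
    using k\<^sub>2 lam g by - (rule power2_le_imp_le, auto)
  have A\<phi>: "A (\<phi> i) (\<phi> j) = (if i = j then ev i else 0)" if "i \<in> {1..N}" "j \<in> {1..N}" for i j
    using that \<phi>_eigen[of i "\<phi> j"] \<phi>_W[of j] \<phi>_orthonormal[of i j] by simp
  have "(form_norm A R)\<^sup>2 = (\<Sum>j\<in>{1..N}-{k}. (\<beta> j)\<^sup>2 * ev j)"
    using energy.orthonormal_expansion(2)[of "{1..N}-{k}" \<phi> ev \<beta>] A\<phi> R
    by (simp add: energy.norm_square) (simp add: R_def)
  also have "\<dots> \<le> (\<Sum>j\<in>{1..N}-{k}. lam\<^sup>2 * (1 / g + lam / g\<^sup>2) * (b e (\<phi> j))\<^sup>2)"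
  proof (rule sum_mono)
    fix j assume j: "j \<in> {1..N} - {k}"
    define t where "t = \<bar>ev j - lam\<bar>"
    have t: "g \<le> t" using gap[of j] j by (simp add: t_def)
    have "ev j / t\<^sup>2 \<le> (t + lam) / t\<^sup>2" by (intro divide_right_mono) (auto simp: t_def)
    also have "\<dots> = 1 / t + lam / t\<^sup>2" using t g by (simp add: field_simps power2_eq_square)
    also have "\<dots> \<le> 1 / g + lam / g\<^sup>2"
      using t g lam by (intro add_mono divide_left_mono power_mono mult_pos_pos) auto
    finally have le: "ev j / t\<^sup>2 \<le> 1 / g + lam / g\<^sup>2" .
    have "(\<beta> j)\<^sup>2 * ev j \<le> (lam / t)\<^sup>2 * (b e (\<phi> j))\<^sup>2 * ev j"
      using \<beta>_le[OF j] ev_pos[of j] j unfolding t_def by (intro mult_right_mono) auto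
    also have "\<dots> = lam\<^sup>2 * (ev j / t\<^sup>2) * (b e (\<phi> j))\<^sup>2" by (simp add: power_divide)
    also have "\<dots> \<le> lam\<^sup>2 * (1 / g + lam / g\<^sup>2) * (b e (\<phi> j))\<^sup>2"
      using le by (intro mult_right_mono mult_left_mono) auto
    finally show "(\<beta> j)\<^sup>2 * ev j \<le> lam\<^sup>2 * (1 / g + lam / g\<^sup>2) * (b e (\<phi> j))\<^sup>2" .
  qed
  also have "\<dots> \<le> lam\<^sup>2 * (1 / g + lam / g\<^sup>2) * \<kappa>\<^sub>2\<^sup>2"
    unfolding sum_distrib_left[symmetric] using Bes g lam by (intro mult_left_mono) auto
  also have "\<dots> = (lam * sqrt (1 / g + lam / g\<^sup>2) * \<kappa>\<^sub>2)\<^sup>2"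
    using g lam by (simp add: power_mult_distrib)
  finally have AR: "form_norm A R \<le> lam * sqrt (1 / g + lam / g\<^sup>2) * \<kappa>\<^sub>2"
    using k\<^sub>2 lam g by - (rule power2_le_imp_le, auto)
  have n\<phi>: "form_norm b (\<phi> k) = 1" "form_norm A (\<phi> k) \<le> sqrt M"
    using \<phi>_orthonormal[of k k] A\<phi>[of k k] k M by (auto simp: form_norm_def)
  have \<beta>k: "0 \<le> \<beta> k" using sgn by (simp add: \<beta>_def P_def)
  have "\<bar>\<beta> k - 1\<bar> \<le> (1 + lam / g) * \<kappa>\<^sub>2"
  proof -
    have "\<bar>form_norm b u - form_norm b (\<beta> k *\<^sub>R \<phi> k)\<bar> \<le> form_norm b (u - \<beta> k *\<^sub>R \<phi> k)"
      using u k by (intro mass.norm_triangle_reverse) auto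
    also have "u - \<beta> k *\<^sub>R \<phi> k = e + R" by (simp add: e_def P_split)
    also have "form_norm b (e + R) \<le> form_norm b e + form_norm b R"
      using e R by (intro mass.norm_triangle)
    also have "\<dots> \<le> \<kappa>\<^sub>2 + lam / g * \<kappa>\<^sub>2"
      using e2 bR by (simp add: e_def P_def)
    finally show ?thesis using u k n\<phi> \<beta>k by (simp add: mass.norm_scale algebra_simps)
  qed
  moreover have "0 \<le> sqrt M" using M ev_pos[OF k] by simp
  ultimately have last: "form_norm A ((\<beta> k - 1) *\<^sub>R \<phi> k) \<le> (1 + lam / g) * \<kappa>\<^sub>2 * sqrt M"
    using n\<phi> k g lam k\<^sub>2 by (auto simp: energy.norm_scale intro!: mult_mono)
  have "u - \<phi> k = e + (R + (\<beta> k - 1) *\<^sub>R \<phi> k)"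
    by (simp add: e_def P_split algebra_simps)
  then have "form_norm A (u - \<phi> k) \<le> form_norm A e + (form_norm A R + form_norm A ((\<beta> k - 1) *\<^sub>R \<phi> k))"
    using energy.norm_triangle[of e "R + (\<beta> k - 1) *\<^sub>R \<phi> k"]
      energy.norm_triangle[of R "(\<beta> k - 1) *\<^sub>R \<phi> k"] e R k by simp
  also have "\<dots> \<le> \<kappa>\<^sub>1 + (lam * sqrt (1 / g + lam / g\<^sup>2) * \<kappa>\<^sub>2 + (1 + lam / g) * \<kappa>\<^sub>2 * sqrt M)"
    using e1 AR last by (simp add: e_def P_def)
  finally show ?thesis by (simp add: algebra_simps)
qed

end

section \<open>Limits of discrete eigenfunctions\<close>

context galerkin
begin

lemma S_\<phi>: "j \<in> {1..N} \<Longrightarrow> S (\<phi> j) = (1 / ev j) *\<^sub>R \<phi> j"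
proof -
  assume j: "j \<in> {1..N}"
  have "S (\<phi> j) = (\<Sum>i=1..N. if i = j then (1 / ev j) *\<^sub>R \<phi> j else 0)"
    unfolding S_def using \<phi>_orthonormal j by (intro sum.cong) auto
  then show ?thesis using j by simp
qed

text \<open>\<open>S f\<close> depends on finitely many numbers only; their convergence implies that of \<open>S f\<close>.\<close>

lemma mass_S_diff:
  assumes f: "f \<in> L" and g: "g \<in> L"
  shows "form_norm b (S f - S g) \<le> (\<Sum>j=1..N. \<bar>b f (\<phi> j) - b g (\<phi> j)\<bar> / ev j)"
proof -
  have "S f - S g = (\<Sum>j=1..N. ((b f (\<phi> j) - b g (\<phi> j)) / ev j) *\<^sub>R \<phi> j)"
    unfolding S_def by (simp add: sum_subtractf diff_divide_distrib scaleR_diff_left)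
  also have "form_norm b \<dots> \<le> (\<Sum>j=1..N. form_norm b (((b f (\<phi> j) - b g (\<phi> j)) / ev j) *\<^sub>R \<phi> j))"
    by (intro mass.norm_sum) auto
  also have "\<dots> = (\<Sum>j=1..N. \<bar>b f (\<phi> j) - b g (\<phi> j)\<bar> / ev j)"
  proof (rule sum.cong)
    fix j assume j: "j \<in> {1..N}"
    then show "form_norm b (((b f (\<phi> j) - b g (\<phi> j)) / ev j) *\<^sub>R \<phi> j)
        = \<bar>b f (\<phi> j) - b g (\<phi> j)\<bar> / ev j"
      using \<phi>_orthonormal[of j j] ev_pos[OF j]
      by (subst mass.norm_scale) (auto simp: form_norm_def)
  qed simp
  finally show ?thesis .
qed

lemma norm_\<phi>: "j \<in> {1..N} \<Longrightarrow> form_norm b (\<phi> j) = 1"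
  using \<phi>_orthonormal[of j j] by (simp add: form_norm_def)

lemma mass_T_le: "f \<in> L \<Longrightarrow> form_norm b (T f) \<le> \<gamma>\<^sup>2 * form_norm b f"
  using Poincare[OF T_V, of f] mult_left_mono[OF energy_T_le, of f \<gamma>] \<gamma>
  by (simp add: power2_eq_square mult.assoc)

lemma eigenfunction_near_T:
  assumes j: "j \<in> {1..N}"
  shows "form_norm b (\<phi> j - ev j *\<^sub>R T (\<phi> j)) \<le> ev j * \<delta>"
proof -
  have "\<phi> j - ev j *\<^sub>R T (\<phi> j) = ev j *\<^sub>R (S (\<phi> j) - T (\<phi> j))"
    using S_\<phi>[OF j] ev_pos[OF j] by (simp add: scaleR_diff_right)
  then have "form_norm b (\<phi> j - ev j *\<^sub>R T (\<phi> j)) = ev j * form_norm b (T (\<phi> j) - S (\<phi> j))"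
    using j ev_pos[OF j] mass.norm_minus_commute[of "S (\<phi> j)" "T (\<phi> j)"]
    by (simp add: mass.norm_scale)
  then show ?thesis
    using energy_S_le(2)[of "\<phi> j"] norm_\<phi>[OF j] j ev_pos[OF j] by simp
qed

end

text \<open>Along a subsequence, the eigenvalues and all the coefficients \<open>b(\<phi>\<^bsub>k,j\<^esub>, \<phi>\<^bsub>q,j'\<^esub>)\<close> of the \<open>j\<close>-th
eigenfunction at level \<open>k\<close> with respect to those at level \<open>q\<close> converge. For fixed \<open>q\<close> this makes
the images under the finite-rank operator at level \<open>q\<close> a Cauchy sequence; as these operators
converge to \<open>T\<close> in norm, the images under \<open>T\<close> form a Cauchy sequence as well. Each discrete
eigenfunction is close to its eigenvalue times its image under \<open>T\<close>, so the eigenfunctions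
themselves converge, and their limits solve the continuous eigenvalue problem.\<close>

lemma limit_eigenfunctions:
  fixes N :: "nat \<Rightarrow> nat" and ev :: "nat \<Rightarrow> nat \<Rightarrow> real" and \<phi> :: "nat \<Rightarrow> nat \<Rightarrow> 'v::real_vector"
  assumes G: "\<And>k. galerkin L b (X k) (A k) V (W k) T \<gamma> (\<eta> k) (N k) (ev k) (\<phi> k)"
    and \<eta>: "\<eta> \<longlonglongrightarrow> 0" and i: "\<And>k. i \<le> N k" and M: "\<And>k j. j \<in> {1..i} \<Longrightarrow> ev k j \<le> M"
    and complete: "\<And>f. \<lbrakk>\<And>k. f k \<in> L; form_Cauchy b f\<rbrakk>
      \<Longrightarrow> \<exists>z\<in>L. (\<lambda>k::nat. form_norm b (T (f k) - z)) \<longlonglongrightarrow> 0"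
  shows "\<exists>w \<mu>. (\<forall>j\<in>{1..i}. w j \<in> V \<and> \<mu> j \<le> M \<and> (\<forall>k. \<forall>v\<in>V. A k (w j) v = \<mu> j * b (w j) v)) \<and>
    (\<forall>j\<in>{1..i}. \<forall>j'\<in>{1..i}. b (w j) (w j') = (if j = j' then 1 else 0))"
proof -
  interpret G: galerkin L b "X k" "A k" V "W k" T \<gamma> "\<eta> k" "N k" "ev k" "\<phi> k" for k
    by (rule G)
  have jN: "j \<in> {1..N k}" if "j \<in> {1..i}" for j k using that i[of k] by simp
  \<comment> \<open>All the sequences that have to converge, as the coordinates of a single sequence.\<close>
  define c :: "nat \<Rightarrow> nat + nat \<times> nat \<times> nat \<Rightarrow> real" where
    "c k p = (case p of Inl j \<Rightarrow> if j \<in> {1..i} then ev k j else 0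
       | Inr (j, q, j') \<Rightarrow> if j \<in> {1..i} \<and> j' \<in> {1..N q} then b (\<phi> k j) (\<phi> q j') else 0)" for k p
  have "Bseq (\<lambda>k. c k p)" for p
  proof (cases p)
    case (Inl j)
    have "\<bar>c k p\<bar> \<le> \<bar>M\<bar>" for k
      using M[of j k] G.ev_pos[of j k] jN[of j k] Inl by (auto simp: c_def abs_le_iff)
    then show ?thesis by (intro BseqI'[of _ "\<bar>M\<bar>"]) simp
  next
    case (Inr t)
    obtain j q j' where t: "t = (j, q, j')" by (cases t)
    have "\<bar>c k p\<bar> \<le> 1" for k
      using G.mass.Cauchy_Schwarz[of "\<phi> k j" "\<phi> q j'"] G.norm_\<phi>[of j k] G.norm_\<phi>[of j' q] jN[of j k]
      by (auto simp: c_def Inr t)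
    then show ?thesis by (intro BseqI'[of _ 1]) simp
  qed
  then obtain r where r: "strict_mono r" and conv: "\<And>p. convergent (\<lambda>k. c (r k) p)"
    using diagonal_convergent_subsequence[of c] by blast
  have \<delta>: "(\<lambda>k. G.\<delta> k) \<longlonglongrightarrow> 0"
  proof -
    have "(\<lambda>k. \<eta> k * (4 * \<gamma> + 3 * \<eta> k)) \<longlonglongrightarrow> 0 * (4 * \<gamma> + 3 * 0)"
      by (intro tendsto_intros \<eta>)
    then show ?thesis by (simp add: G.\<delta>_def)
  qed
  have ev_conv: "convergent (\<lambda>k. ev (r k) j)" if "j \<in> {1..i}" for j
    using conv[of "Inl j"] that by (simp add: c_def)
  define \<mu> where "\<mu> j = lim (\<lambda>k. ev (r k) j)" for j
  have ev_lim: "(\<lambda>k. ev (r k) j) \<longlonglongrightarrow> \<mu> j" if "j \<in> {1..i}" for j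
    using ev_conv[OF that] by (simp add: \<mu>_def convergent_LIMSEQ_iff)
  have "\<exists>y\<in>L. (\<lambda>k. form_norm b (\<phi> (r k) j - y)) \<longlonglongrightarrow> 0 \<and> form_norm b (\<mu> j *\<^sub>R T y - y) = 0"
    if j: "j \<in> {1..i}" for j
  proof -
    define f where "f k = \<phi> (r k) j" for k
    have f: "f k \<in> L" "form_norm b (f k) = 1" for k
      using jN[OF j] G.norm_\<phi> by (simp_all add: f_def)
    have S_Cauchy: "form_Cauchy b (\<lambda>k. G.S q (f k))" for q
      unfolding form_Cauchy_def
    proof (intro allI impI)
      fix e :: real assume e: "0 < e"
      define t where "t k j' = b (f k) (\<phi> q j') / ev q j'" for k j'
      have "Cauchy (\<lambda>k. t k j')" if "j' \<in> {1..N q}" for j'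
        using conv[of "Inr (j, q, j')"] j that unfolding t_def
        by (intro convergent_Cauchy) (auto simp: c_def f_def divide_inverse convergent_mult_const_right_iff
            intro!: convergent_mult convergent_const)
      then have "\<exists>K. \<forall>m\<ge>K. \<forall>n\<ge>K. \<bar>t m j' - t n j'\<bar> < e / (N q + 1)" if "j' \<in> {1..N q}" for j'
        using that e unfolding Cauchy_def dist_real_def
        by (metis divide_pos_pos of_nat_0_less_iff add_gr_0 zero_less_one of_nat_1 of_nat_add)
      then obtain K where K: "\<And>j' m n. \<lbrakk>j' \<in> {1..N q}; K j' \<le> m; K j' \<le> n\<rbrakk>
          \<Longrightarrow> \<bar>t m j' - t n j'\<bar> < e / (N q + 1)" by metis
      have "form_norm b (G.S q (f m) - G.S q (f n)) < e"
        if mn: "(\<Sum>j'=1..N q. K j') \<le> m" "(\<Sum>j'=1..N q. K j') \<le> n" for m n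
      proof -
        have "form_norm b (G.S q (f m) - G.S q (f n)) \<le> (\<Sum>j'=1..N q. \<bar>t m j' - t n j'\<bar>)"
        proof -
          have "(\<Sum>j'=1..N q. \<bar>b (f m) (\<phi> q j') - b (f n) (\<phi> q j')\<bar> / ev q j')
              = (\<Sum>j'=1..N q. \<bar>t m j' - t n j'\<bar>)"
            using G.ev_pos[of _ q]
            by (intro sum.cong) (auto simp: t_def abs_of_pos simp flip: diff_divide_distrib)
          then show ?thesis using G.mass_S_diff[of "f m" "f n" q] f by simp
        qed
        also have "\<dots> \<le> (\<Sum>j'=1..N q. e / (N q + 1))"
        proof (rule sum_mono)
          fix j' assume j': "j' \<in> {1..N q}"
          then have "K j' \<le> (\<Sum>j'=1..N q. K j')" by (intro member_le_sum) auto
          then have "K j' \<le> m" "K j' \<le> n" using mn by linarith+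
          then show "\<bar>t m j' - t n j'\<bar> \<le> e / (N q + 1)" by (rule less_imp_le[OF K[OF j']])
        qed
        also have "\<dots> < e" using e by (simp add: field_simps)
        finally show ?thesis .
      qed
      then show "\<exists>K. \<forall>m\<ge>K. \<forall>n\<ge>K. form_norm b (G.S q (f m) - G.S q (f n)) < e" by blast
    qed
    have T_Cauchy: "form_Cauchy b (\<lambda>k. T (f k))"
    proof (rule G.mass.Cauchy_approximable[where y="\<lambda>q k. G.S q (f k)" and d=G.\<delta>])
      show "form_norm b (T (f k) - G.S q (f k)) \<le> G.\<delta> q" for q k
        using G.energy_S_le(2)[of "f k" q] f by simp
    qed (use f \<delta> S_Cauchy in auto)
    have near: "(\<lambda>k. form_norm b (f k - ev (r k) j *\<^sub>R T (f k))) \<longlonglongrightarrow> 0"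
    proof (rule Lim_null_comparison)
      have "form_norm b (f k - ev (r k) j *\<^sub>R T (f k)) \<le> M * G.\<delta> (r k)" for k
        unfolding f_def
        by (rule order_trans[OF G.eigenfunction_near_T[OF jN[OF j]]
              mult_right_mono[OF M[OF j] G.\<delta>_nonneg]])
      then show "\<forall>\<^sub>F k in sequentially. norm (form_norm b (f k - ev (r k) j *\<^sub>R T (f k))) \<le> M * G.\<delta> (r k)"
        using f by (intro always_eventually) simp
      show "(\<lambda>k. M * G.\<delta> (r k)) \<longlonglongrightarrow> 0"
        using tendsto_mult_left[OF LIMSEQ_subseq_LIMSEQ[OF \<delta> r], of M]
        by (simp add: o_def)
    qed
    have f_Cauchy: "form_Cauchy b f"
    proof (rule G.mass.Cauchy_asymptotic[OF _ _ near])
      show "form_Cauchy b (\<lambda>k. ev (r k) j *\<^sub>R T (f k))"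
        using f T_Cauchy G.mass_T_le[of "f _"]
        by (intro G.mass.Cauchy_scale[where B="\<gamma>\<^sup>2"] ev_conv[OF j]) auto
    qed (use f in auto)
    obtain z where z: "z \<in> L" "(\<lambda>k. form_norm b (T (f k) - z)) \<longlonglongrightarrow> 0"
      using complete[OF f(1) f_Cauchy] by blast
    define y where "y = \<mu> j *\<^sub>R z"
    have y: "y \<in> L" using z by (simp add: y_def)
    have lim_y: "(\<lambda>k. form_norm b (f k - y)) \<longlonglongrightarrow> 0"
    proof (rule Lim_null_comparison)
      have "form_norm b (f k - y) \<le> form_norm b (f k - ev (r k) j *\<^sub>R T (f k))
          + (\<bar>ev (r k) j\<bar> * form_norm b (T (f k) - z) + \<bar>ev (r k) j - \<mu> j\<bar> * form_norm b z)" for k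
      proof -
        let ?p = "ev (r k) j *\<^sub>R (T (f k) - z)" and ?q = "(ev (r k) j - \<mu> j) *\<^sub>R z"
        have *: "f k - y = (f k - ev (r k) j *\<^sub>R T (f k)) + (?p + ?q)"
          by (simp add: y_def algebra_simps)
        have "form_norm b ((f k - ev (r k) j *\<^sub>R T (f k)) + (?p + ?q))
            \<le> form_norm b (f k - ev (r k) j *\<^sub>R T (f k)) + form_norm b (?p + ?q)"
          using f z by (intro G.mass.norm_triangle) auto
        moreover have "form_norm b (?p + ?q) \<le> form_norm b ?p + form_norm b ?q"
          using f z by (intro G.mass.norm_triangle) auto
        moreover have "form_norm b ?p = \<bar>ev (r k) j\<bar> * form_norm b (T (f k) - z)"
          "form_norm b ?q = \<bar>ev (r k) j - \<mu> j\<bar> * form_norm b z"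
          using f z by (simp_all add: G.mass.norm_scale)
        ultimately show ?thesis unfolding * by linarith
      qed
      then show "\<forall>\<^sub>F k in sequentially. norm (form_norm b (f k - y))
          \<le> form_norm b (f k - ev (r k) j *\<^sub>R T (f k))
          + (\<bar>ev (r k) j\<bar> * form_norm b (T (f k) - z) + \<bar>ev (r k) j - \<mu> j\<bar> * form_norm b z)"
        using f y by (intro always_eventually) simp
      have "(\<lambda>k. form_norm b (f k - ev (r k) j *\<^sub>R T (f k))
          + (\<bar>ev (r k) j\<bar> * form_norm b (T (f k) - z) + \<bar>ev (r k) j - \<mu> j\<bar> * form_norm b z))
          \<longlonglongrightarrow> 0 + (\<bar>\<mu> j\<bar> * 0 + \<bar>\<mu> j - \<mu> j\<bar> * form_norm b z)"
        by (intro tendsto_intros near z ev_lim j)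
      then show "(\<lambda>k. form_norm b (f k - ev (r k) j *\<^sub>R T (f k))
          + (\<bar>ev (r k) j\<bar> * form_norm b (T (f k) - z) + \<bar>ev (r k) j - \<mu> j\<bar> * form_norm b z)) \<longlonglongrightarrow> 0"
        by simp
    qed
    have "form_norm b (T y - z) = 0"
    proof -
      have "form_norm b (T y - z) \<le> \<gamma>\<^sup>2 * form_norm b (f k - y) + form_norm b (T (f k) - z)" for k
        using G.mass.norm_triangle_via[of "T y" "T (f k)" z] G.mass_T_diff[of y "f k"]
          G.mass.norm_minus_commute[of y "f k"] f y z by simp
      moreover have "(\<lambda>k. \<gamma>\<^sup>2 * form_norm b (f k - y) + form_norm b (T (f k) - z)) \<longlonglongrightarrow> \<gamma>\<^sup>2 * 0 + 0"
        by (intro tendsto_intros lim_y z)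
      ultimately have "form_norm b (T y - z) \<le> \<gamma>\<^sup>2 * 0 + 0"
        by (intro LIMSEQ_le_const[where x="\<gamma>\<^sup>2 * 0 + 0"]) auto
      then show ?thesis using y z by (intro antisym G.mass.norm_nonneg) auto
    qed
    then have "form_norm b (\<mu> j *\<^sub>R T y - y) = 0"
      using y z by (simp add: y_def G.mass.norm_scale flip: scaleR_diff_right)
    then show ?thesis using lim_y y unfolding f_def by blast
  qed
  then obtain y where y: "\<And>j. j \<in> {1..i} \<Longrightarrow> y j \<in> L"
    and y_lim: "\<And>j. j \<in> {1..i} \<Longrightarrow> (\<lambda>k. form_norm b (\<phi> (r k) j - y j)) \<longlonglongrightarrow> 0"
    and y_eq: "\<And>j. j \<in> {1..i} \<Longrightarrow> form_norm b (\<mu> j *\<^sub>R T (y j) - y j) = 0"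
    by metis
  define w where "w j = \<mu> j *\<^sub>R T (y j)" for j
  have w: "w j \<in> V" if "j \<in> {1..i}" for j
    using G.T_V[OF y[OF that]] G.V_subspace by (simp add: w_def subspace_scale)
  have b_wy: "b (w j) v = b (y j) v" if "j \<in> {1..i}" "v \<in> L" for j v
    using G.mass.null_left[of "w j - y j" v] y_eq[of j] y[of j] w[of j] that
    by (simp add: w_def G.mass.diff_left)
  have "b (w j) (w j') = (if j = j' then 1 else 0)" if j: "j \<in> {1..i}" and j': "j' \<in> {1..i}" for j j'
  proof -
    have "(\<lambda>k. b (\<phi> (r k) j) (\<phi> (r k) j')) \<longlonglongrightarrow> b (y j) (y j')"
      using jN[OF j] jN[OF j'] y j j' y_lim by (intro G.mass.tendsto_form) auto
    moreover have "(\<lambda>k. b (\<phi> (r k) j) (\<phi> (r k) j')) = (\<lambda>k. if j = j' then 1 else 0)"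
      using jN[OF j] jN[OF j'] G.\<phi>_orthonormal by (intro ext) blast
    ultimately have "b (y j) (y j') = (if j = j' then 1 else 0)"
      by (metis LIMSEQ_unique tendsto_const)
    moreover have "b (w j) (w j') = b (y j) (y j')"
      using b_wy[of j "w j'"] b_wy[of j' "y j"] w[OF j'] w[OF j] y j j' by (simp add: G.mass.sym)
    ultimately show ?thesis by simp
  qed
  moreover have "\<mu> j \<le> M" if "j \<in> {1..i}" for j
    using ev_lim[OF that] M[OF that] by (intro LIMSEQ_le_const2[OF ev_lim[OF that]]) auto
  moreover have "A k (w j) v = \<mu> j * b (w j) v" if "j \<in> {1..i}" "v \<in> V" for j k v
    using G.T_weak[of "y j" v k] G.T_V[of "y j"] y[of j] b_wy[of j v] that
    by (simp add: w_def G.energy.scale_left)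
  ultimately show ?thesis using w by blast
qed

section \<open>Smooth functions of compact support\<close>

text \<open>The smooth function \<open>exp(-1/t)\<close>, continued by zero, together with all its derivatives: the
family is closed under differentiation.\<close>

definition exp_flat :: "real poly \<Rightarrow> real \<Rightarrow> real" where
  "exp_flat p t = (if 0 < t then poly p (inverse t) * exp (- inverse t) else 0)"

lemma poly_exp_at_top: "((\<lambda>x. poly p x * exp (- x)) \<longlongrightarrow> 0) at_top" for p :: "real poly"
proof -
  have "((\<lambda>x. \<Sum>i\<le>degree p. coeff p i * (x ^ i / exp x)) \<longlongrightarrow> (\<Sum>i\<le>degree p. coeff p i * 0)) at_top"
    by (intro tendsto_sum tendsto_mult tendsto_const tendsto_power_div_exp_0)
  then show ?thesis
    by (simp add: poly_altdef sum_distrib_right exp_minus divide_inverse mult.assoc)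
qed

lemma exp_flat_quotient: "((\<lambda>t. exp_flat p t / t) \<longlongrightarrow> 0) (at 0)"
proof (rule filterlim_split_at)
  show "((\<lambda>t. exp_flat p t / t) \<longlongrightarrow> 0) (at_left 0)"
    by (rule tendsto_eventually) (auto simp: eventually_at_filter exp_flat_def)
  have "((\<lambda>t. poly (pCons 0 p) (inverse t) * exp (- inverse t)) \<longlongrightarrow> 0) (at_right (0::real))"
    by (rule filterlim_compose[OF poly_exp_at_top filterlim_inverse_at_top_right])
  moreover have "\<forall>\<^sub>F t in at_right (0::real).
      poly (pCons 0 p) (inverse t) * exp (- inverse t) = exp_flat p t / t"
    by (auto simp: eventually_at_filter exp_flat_def divide_inverse)
  ultimately show "((\<lambda>t. exp_flat p t / t) \<longlongrightarrow> 0) (at_right 0)"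
    by (rule Lim_transform_eventually)
qed

lemma exp_flat_deriv:
  "(exp_flat p has_real_derivative exp_flat ([:0, 0, 1:] * (p - pderiv p)) t) (at t)"
proof -
  consider "0 < t" | "t < 0" | "t = 0" by linarith
  then show ?thesis
  proof cases
    case 1
    have "((\<lambda>t. poly p (inverse t) * exp (- inverse t)) has_real_derivative
        exp_flat ([:0, 0, 1:] * (p - pderiv p)) t) (at t)"
      using 1 by (auto intro!: derivative_eq_intros DERIV_chain2[OF poly_DERIV]
          simp: exp_flat_def algebra_simps power2_eq_square)
    then show ?thesis
      by (rule has_field_derivative_transform_within_open[of _ _ _ "{0<..}"])
        (use 1 in \<open>auto simp: exp_flat_def\<close>)
  next
    case 2
    have "((\<lambda>t. 0) has_real_derivative exp_flat ([:0, 0, 1:] * (p - pderiv p)) t) (at t)"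
      using 2 by (simp add: exp_flat_def)
    then show ?thesis
      by (rule has_field_derivative_transform_within_open[of _ _ _ "{..<0}"])
        (use 2 in \<open>auto simp: exp_flat_def\<close>)
  next
    case 3
    have "((\<lambda>h. (exp_flat p (0 + h) - exp_flat p 0) / h) \<longlongrightarrow> 0) (at 0)"
      using exp_flat_quotient[of p] by (simp add: exp_flat_def[of p 0])
    then show ?thesis using 3 by (simp add: DERIV_def exp_flat_def[of _ 0])
  qed
qed

lemma smooth_partials_continuous: "smooth f \<Longrightarrow> continuous_on UNIV (partials \<alpha> f)"
  unfolding smooth_def
  by (intro continuous_at_imp_continuous_on ballI differentiable_imp_continuous_within) blast

text \<open>A class that contains the bump functions needed and that is closed under partial derivatives.
The closedness alone implies that its members are smooth.\<close>

inductive_set smooth_algebra :: "(real^'n \<Rightarrow> real) set" where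
  const: "(\<lambda>x. c) \<in> smooth_algebra"
| coord: "(\<lambda>x. x $ i) \<in> smooth_algebra"
| add: "\<lbrakk>f \<in> smooth_algebra; g \<in> smooth_algebra\<rbrakk> \<Longrightarrow> (\<lambda>x. f x + g x) \<in> smooth_algebra"
| mult: "\<lbrakk>f \<in> smooth_algebra; g \<in> smooth_algebra\<rbrakk> \<Longrightarrow> (\<lambda>x. f x * g x) \<in> smooth_algebra"
| flat: "f \<in> smooth_algebra \<Longrightarrow> (\<lambda>x. exp_flat p (f x)) \<in> smooth_algebra"

lemma partial_eqI:
  assumes "\<And>x. (f has_derivative D x) (at x)"
  shows "partial i f = (\<lambda>x. D x (axis i 1))"
proof
  fix x
  have "D x = frechet_derivative f (at x)" using assms by (rule frechet_derivative_at)
  then show "partial i f x = D x (axis i 1)" by (simp add: partial_def)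
qed

lemma smooth_algebra_closed:
  assumes "f \<in> smooth_algebra"
  shows "(\<forall>x. f differentiable (at x)) \<and> (\<forall>i. partial i f \<in> smooth_algebra)"
  using assms
proof (induction rule: smooth_algebra.induct)
  case (const c)
  have "partial i (\<lambda>x. c) = (\<lambda>x. 0)" for i :: 'a
    by (rule partial_eqI) (rule has_derivative_const)
  then show ?case using smooth_algebra.const by simp
next
  case (coord j)
  have d: "((\<lambda>x. x $ j) has_derivative (\<lambda>v. v $ j)) (at x)" for x :: "real^'a"
    by (rule bounded_linear_imp_has_derivative) (rule bounded_linear_vec_nth)
  have "partial i (\<lambda>x. x $ j) = (\<lambda>x. axis i 1 $ j)" for i
    by (rule partial_eqI) (rule d)
  then show ?case using smooth_algebra.const d by (auto simp: differentiable_def)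
next
  case (add f g)
  have f: "(f has_derivative frechet_derivative f (at x)) (at x)"
    and g: "(g has_derivative frechet_derivative g (at x)) (at x)" for x
    using add by (auto simp: frechet_derivative_works)
  have d: "((\<lambda>x. f x + g x) has_derivative
      (\<lambda>v. frechet_derivative f (at x) v + frechet_derivative g (at x) v)) (at x)" for x
    by (intro has_derivative_add f g)
  have "partial i (\<lambda>x. f x + g x) = (\<lambda>x. partial i f x + partial i g x)" for i
    unfolding partial_eqI[OF d] by (simp add: partial_def)
  then show ?case using add d by (auto simp: differentiable_def intro!: smooth_algebra.add)
next
  case (mult f g)
  have f: "(f has_derivative frechet_derivative f (at x)) (at x)"
    and g: "(g has_derivative frechet_derivative g (at x)) (at x)" for x
    using mult by (auto simp: frechet_derivative_works)
  have d: "((\<lambda>x. f x * g x) has_derivative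
      (\<lambda>v. f x * frechet_derivative g (at x) v + frechet_derivative f (at x) v * g x)) (at x)" for x
    by (intro has_derivative_mult f g)
  have "partial i (\<lambda>x. f x * g x) = (\<lambda>x. f x * partial i g x + partial i f x * g x)" for i
    unfolding partial_eqI[OF d] by (simp add: partial_def)
  then show ?case using mult d
    by (auto simp: differentiable_def intro!: smooth_algebra.add smooth_algebra.mult)
next
  case (flat f p)
  let ?p = "[:0, 0, 1:] * (p - pderiv p)"
  have f: "(f has_derivative frechet_derivative f (at x)) (at x)" for x
    using flat by (auto simp: frechet_derivative_works)
  have d: "((\<lambda>x. exp_flat p (f x)) has_derivative
      (\<lambda>v. exp_flat ?p (f x) * frechet_derivative f (at x) v)) (at x)" for x
    using has_derivative_compose[OF f exp_flat_deriv[unfolded has_field_derivative_def]] by simp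
  have "partial i (\<lambda>x. exp_flat p (f x)) = (\<lambda>x. exp_flat ?p (f x) * partial i f x)" for i
    unfolding partial_eqI[OF d] by (simp add: partial_def)
  then show ?case using flat d
    by (auto simp: differentiable_def intro!: smooth_algebra.mult smooth_algebra.flat)
qed

lemma smooth_algebra_smooth: "f \<in> smooth_algebra \<Longrightarrow> smooth f"
proof -
  assume "f \<in> smooth_algebra"
  then have "partials \<alpha> f \<in> smooth_algebra" for \<alpha>
    by (induction \<alpha>) (auto simp: smooth_algebra_closed)
  then show ?thesis by (auto simp: smooth_def smooth_algebra_closed)
qed

lemma smooth_algebra_prod:
  "(\<And>i. i \<in> I \<Longrightarrow> f i \<in> smooth_algebra) \<Longrightarrow> (\<lambda>x. \<Prod>i\<in>I. f i x) \<in> smooth_algebra"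
  by (induction I rule: infinite_finite_induct) (auto intro: smooth_algebra.intros)

text \<open>\<open>exp_flat 1\<close> vanishes on the negative axis and increases to \<open>1\<close> at infinity. Under the
scaling by \<open>k\<close>, the product therefore tends to the indicator function of the open box.\<close>

definition box_bump :: "real^'n \<Rightarrow> real^'n \<Rightarrow> nat \<Rightarrow> real^'n \<Rightarrow> real" where
  "box_bump a b k x = (\<Prod>i\<in>UNIV. exp_flat 1 (real k * (x $ i - a $ i)) * exp_flat 1 (real k * (b $ i - x $ i)))"

lemma exp_flat_1_bounds: "0 \<le> exp_flat 1 t" "exp_flat 1 t \<le> 1"
  by (auto simp: exp_flat_def)

lemma box_bump_smooth: "smooth (box_bump a b k)"
proof -
  have c: "(\<lambda>x. real k * (x $ i - a $ i)) \<in> smooth_algebra"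
      "(\<lambda>x. real k * (b $ i - x $ i)) \<in> smooth_algebra" for i
    using smooth_algebra.mult[OF smooth_algebra.const[of k]
        smooth_algebra.add[OF smooth_algebra.coord[of i] smooth_algebra.const[of "- a $ i"]]]
      smooth_algebra.mult[OF smooth_algebra.const[of k]
        smooth_algebra.add[OF smooth_algebra.const[of "b $ i"]
          smooth_algebra.mult[OF smooth_algebra.const[of "-1"] smooth_algebra.coord[of i]]]]
    by simp_all
  have "(\<lambda>x. box_bump a b k x) \<in> smooth_algebra"
    unfolding box_bump_def
    by (intro smooth_algebra_prod smooth_algebra.mult smooth_algebra.flat c)
  then show ?thesis by (simp add: smooth_algebra_smooth)
qed

lemma box_bump_bounds: "0 \<le> box_bump a b k x" "box_bump a b k x \<le> 1"
  unfolding box_bump_def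
  by (auto intro!: prod_nonneg prod_le_1 mult_nonneg_nonneg mult_le_one simp: exp_flat_1_bounds)

lemma box_bump_outside: "x \<notin> box a b \<Longrightarrow> box_bump a b k x = 0"
proof -
  assume "x \<notin> box a b"
  then obtain i where "x $ i \<le> a $ i \<or> b $ i \<le> x $ i" by (auto simp: mem_box_cart not_less)
  then have "exp_flat 1 (real k * (x $ i - a $ i)) * exp_flat 1 (real k * (b $ i - x $ i)) = 0"
    by (auto simp: exp_flat_def zero_less_mult_iff)
  then show ?thesis unfolding box_bump_def by (intro prod_zero) auto
qed

lemma box_bump_tendsto: "(\<lambda>k. box_bump a b k x) \<longlonglongrightarrow> indicator (box a b) x"
proof (cases "x \<in> box a b")
  case True
  have lim: "(\<lambda>k. exp_flat 1 (real k * c)) \<longlonglongrightarrow> 1" if "0 < c" for c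
  proof -
    have "(\<lambda>k. exp (- (inverse c * inverse (real k)))) \<longlonglongrightarrow> exp (- (inverse c * 0))"
      by (intro tendsto_intros lim_inverse_n)
    then have "(\<lambda>k. exp (- inverse (real k * c))) \<longlonglongrightarrow> 1" by (simp add: mult.commute)
    moreover have "\<forall>\<^sub>F k in sequentially. exp (- inverse (real k * c)) = exp_flat 1 (real k * c)"
      using that by (intro eventually_mono[OF eventually_gt_at_top[of 0]]) (auto simp: exp_flat_def)
    ultimately show ?thesis by (rule Lim_transform_eventually)
  qed
  have "(\<lambda>k. box_bump a b k x) \<longlonglongrightarrow> (\<Prod>i\<in>(UNIV::'a set). 1 * 1)"
    unfolding box_bump_def using True by (intro tendsto_prod tendsto_mult lim) (auto simp: mem_box_cart)
  then show ?thesis using True by simp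
next
  case False
  then show ?thesis by (simp add: box_bump_outside)
qed

lemma box_bump_test_function: "cbox a b \<subseteq> D \<Longrightarrow> box_bump a b k \<in> test_functions D"
  unfolding test_functions_def
  using box_bump_smooth box_bump_outside box_subset_cbox
  by (fastforce intro!: exI[of _ "cbox a b"])

section \<open>The fundamental lemma of the calculus of variations\<close>

text \<open>The Borel sets over which \<open>g\<close> has integral zero form a Dynkin system that contains the
intersection-stable generator of open boxes, hence they are all Borel sets. The sets where
\<open>g\<close> is positive or negative are among them.\<close>

lemma AE_zero_if_box_integrals_zero:
  fixes g :: "'a::euclidean_space \<Rightarrow> real"
  assumes g: "integrable lebesgue g" and total: "(LINT x|lebesgue. g x) = 0"
    and box: "\<And>c d. (LINT x|lebesgue. indicator (box c d) x * g x) = 0"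
  shows "AE x in lebesgue. g x = 0"
proof -
  obtain g' where g': "g' \<in> borel_measurable lborel" "AE x in lborel. g x = g' x"
    using completion_ex_borel_measurable_real[of g lborel] g by auto
  have eqc: "AE x in lebesgue. g x = g' x" using g'(2) by (rule AE_completion)
  have g'l: "integrable lebesgue g'"
    using g eqc g'(1) by (subst integrable_cong_AE[of _ _ g]) (auto simp: measurable_completion)
  then have int: "integrable lborel g'" using g' by (simp add: integrable_completion)
  have int_ind: "integrable lborel (\<lambda>x. indicator A x * g' x)" if "A \<in> sets borel" for A
    using integrable_mult_indicator[of A lborel g'] int that by simp
  have eq: "(LINT x|lborel. indicator A x * g' x) = (LINT x|lebesgue. indicator A x * g x)"
    if "A \<in> sets borel" for A
  proof -
    have "(LINT x|lborel. indicator A x * g' x) = (LINT x|lebesgue. indicator A x * g' x)"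
      using that g' by (subst integral_completion) auto
    also have "\<dots> = (LINT x|lebesgue. indicator A x * g x)"
    proof (rule integral_cong_AE)
      have "A \<in> sets lebesgue" using that by (intro sets_completionI_sets) simp
      then show "(\<lambda>x. indicator A x * g' x) \<in> borel_measurable lebesgue"
        "(\<lambda>x. indicator A x * g x) \<in> borel_measurable lebesgue"
        using g g'l by (auto intro!: borel_measurable_times borel_measurable_indicator)
      show "AE x in lebesgue. indicator A x * g' x = indicator A x * g x"
        using eqc by (auto elim!: eventually_mono)
    qed
    finally show ?thesis .
  qed
  have zero: "(LINT x|lborel. indicator A x * g' x) = 0" if "A \<in> sets borel" for A
  proof -
    have "Int_stable (range (\<lambda>(a, b). box a b :: 'a set))"
      by (auto simp: Int_stable_def box_Int_box)
    moreover have "range (\<lambda>(a, b). box a b :: 'a set) \<subseteq> Pow UNIV" by simp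
    moreover have "A \<in> sigma_sets UNIV (range (\<lambda>(a, b). box a b :: 'a set))"
      using that by (simp add: borel_eq_box)
    ultimately show ?thesis
    proof (induction rule: sigma_sets_induct_disjoint)
      case (basic A)
      then obtain c d where "A = box c d" by auto
      then show ?case using box by (simp add: eq)
    next
      case empty
      then show ?case by simp
    next
      case (compl A)
      then have A: "A \<in> sets borel" by (simp add: borel_eq_box)
      have "(LINT x|lborel. indicator (UNIV - A) x * g' x)
          = (LINT x|lborel. indicator UNIV x * g' x - indicator A x * g' x)"
        by (rule Bochner_Integration.integral_cong) (auto simp: indicator_def)
      also have "\<dots> = (LINT x|lborel. indicator UNIV x * g' x) - (LINT x|lborel. indicator A x * g' x)"
        using A by (intro Bochner_Integration.integral_diff int_ind) auto
      also have "(LINT x|lborel. indicator UNIV x * g' x) = 0"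
        using total by (subst eq) auto
      finally show ?case using compl by simp
    next
      case (union A)
      then have A: "A i \<in> sets borel" for i by (auto simp: borel_eq_box)
      have "(LINT x:(\<Union>i. A i)|lborel. g' x) = (\<Sum>i. (LINT x:(A i)|lborel. g' x))"
      proof (rule lebesgue_integral_countable_add)
        show "set_integrable lborel (\<Union>i. A i) g'"
          unfolding set_integrable_def using int_ind[of "\<Union>i. A i"] A by simp
      qed (use A union in \<open>auto simp: disjoint_family_on_def\<close>)
      then show ?case using union by (simp add: set_lebesgue_integral_def)
    qed
  qed
  have nonpos: "AE x in lborel. h x \<le> 0"
    if h: "integrable lborel h" "\<And>A. A \<in> sets borel \<Longrightarrow> (LINT x|lborel. indicator A x * h x) = 0"
    for h :: "'a \<Rightarrow> real"
  proof -
    let ?A = "{x. 0 < h x}"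
    have A: "?A \<in> sets borel" using borel_measurable_integrable[OF h(1)] by simp
    have "AE x in lborel. indicator ?A x * h x = 0"
    proof (subst integral_nonneg_eq_0_iff_AE[symmetric])
      show "integrable lborel (\<lambda>x. indicator ?A x * h x)"
        using integrable_mult_indicator[of ?A lborel h] h A by simp
      show "(LINT x|lborel. indicator ?A x * h x) = 0" using h(2) A by blast
    qed (auto simp: indicator_def)
    then show ?thesis by (auto elim!: eventually_mono simp: indicator_def split: if_splits)
  qed
  have "AE x in lborel. g' x \<le> 0" using nonpos[of g'] int zero by blast
  moreover have "AE x in lborel. - g' x \<le> 0" using nonpos[of "\<lambda>x. - g' x"] int zero by simp
  ultimately have "AE x in lborel. g x = 0" using g'(2) by eventually_elim simp
  then show ?thesis by (rule AE_completion)
qed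

text \<open>Testing with \<open>box_bump\<close> and passing to the limit shows that \<open>f\<close> has integral zero over every
open box whose closure lies in \<open>D\<close>. Countably many such boxes cover \<open>D\<close> up to their boundaries.\<close>

lemma fundamental_lemma:
  assumes D: "open D" and f: "locally_integrable D f"
    and zero: "\<And>\<phi>. \<phi> \<in> test_functions D \<Longrightarrow> l2_inner D f \<phi> = 0"
  shows "AE x in lebesgue_on D. f x = 0"
proof -
  have Dm: "D \<in> sets lebesgue" using D by (intro sets_completionI_sets) simp
  have box0: "integrable lebesgue (\<lambda>x. indicator (box a b) x * f x)"
    "(LINT x|lebesgue. indicator (box a b) x * f x) = 0" if ab: "cbox a b \<subseteq> D" for a b
  proof -
    define F where "F x = indicator (cbox a b) x * f x" for x
    have "f absolutely_integrable_on cbox a b"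
      using f ab unfolding locally_integrable_def by auto
    then have F: "integrable lebesgue F"
      by (simp add: F_def[abs_def] set_integrable_def)
    have Ff: "(\<lambda>x. indicator (box a b) x * F x) = (\<lambda>x. indicator (box a b) x * f x)"
      using box_subset_cbox[of a b] by (auto simp: fun_eq_iff F_def indicator_def)
    show "integrable lebesgue (\<lambda>x. indicator (box a b) x * f x)"
      using integrable_mult_indicator[of "box a b" lebesgue F] F Ff by simp
    have "(\<lambda>k. LINT x|lebesgue. box_bump a b k x * F x) \<longlonglongrightarrow> (LINT x|lebesgue. indicator (box a b) x * F x)"
    proof (rule integral_dominated_convergence[where w="\<lambda>x. \<bar>F x\<bar>"])
      have "continuous_on UNIV (box_bump a b k)" for k
        using smooth_partials_continuous[OF box_bump_smooth, of "[]" a b k] by simp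
      then have [measurable]: "box_bump a b k \<in> borel_measurable lebesgue" for k
        by (intro measurable_completion) (simp add: borel_measurable_continuous_onI)
      show "(\<lambda>x. box_bump a b k x * F x) \<in> borel_measurable lebesgue" for k
        using borel_measurable_integrable[OF F] by measurable
      show "(\<lambda>x. indicator (box a b) x * F x) \<in> borel_measurable lebesgue"
        using borel_measurable_integrable[OF F]
        by (intro borel_measurable_times borel_measurable_indicator) auto
      show "integrable lebesgue (\<lambda>x. \<bar>F x\<bar>)" using F by simp
      show "AE x in lebesgue. (\<lambda>k. box_bump a b k x * F x) \<longlonglongrightarrow> indicator (box a b) x * F x"
        by (intro AE_I2 tendsto_mult tendsto_const box_bump_tendsto)
      show "AE x in lebesgue. norm (box_bump a b k x * F x) \<le> \<bar>F x\<bar>" for k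
        using box_bump_bounds[of a b k]
        by (intro AE_I2) (simp add: abs_mult mult_left_le_one_le)
    qed
    moreover have "(LINT x|lebesgue. box_bump a b k x * F x) = 0" for k
    proof -
      have "0 = l2_inner D f (box_bump a b k)"
        using zero[OF box_bump_test_function[OF ab]] by simp
      also have "\<dots> = (LINT x|lebesgue. indicator D x *\<^sub>R (f x * box_bump a b k x))"
        unfolding l2_inner_def using Dm by (intro integral_restrict_space) simp
      also have "\<dots> = (LINT x|lebesgue. box_bump a b k x * F x)"
      proof (intro Bochner_Integration.integral_cong refl)
        fix x
        show "indicator D x *\<^sub>R (f x * box_bump a b k x) = box_bump a b k x * F x"
          using box_bump_outside[of x a b k] box_subset_cbox[of a b] ab
          by (cases "x \<in> box a b") (auto simp: F_def indicator_def)
      qed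
      finally show ?thesis by simp
    qed
    ultimately have "(\<lambda>k::nat. 0) \<longlonglongrightarrow> (LINT x|lebesgue. indicator (box a b) x * F x)" by simp
    then have "(LINT x|lebesgue. indicator (box a b) x * F x) = 0"
      by (simp add: LIMSEQ_const_iff)
    then show "(LINT x|lebesgue. indicator (box a b) x * f x) = 0" by (simp only: Ff)
  qed
  have box_AE: "AE x in lebesgue. x \<in> box a b \<longrightarrow> f x = 0" if ab: "cbox a b \<subseteq> D" for a b
  proof -
    have "AE x in lebesgue. indicator (box a b) x * f x = 0"
    proof (rule AE_zero_if_box_integrals_zero)
      fix c d :: "real^'a"
      \<comment> \<open>The intersection of the two boxes is a box, again with closure in \<open>D\<close>.\<close>
      define a' b' :: "real^'a" where "a' = (\<chi> i. max (a $ i) (c $ i))" "b' = (\<chi> i. min (b $ i) (d $ i))"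
      have "box a b \<inter> box c d = box a' b'" by (auto simp: mem_box_cart a'_b'_def)
      then have eq: "(\<lambda>x. indicator (box c d) x * (indicator (box a b) x * f x))
          = (\<lambda>x. indicator (box a' b') x * f x)"
        by (auto simp: indicator_def fun_eq_iff)
      have "cbox a' b' \<subseteq> D" using ab by (auto simp: mem_box_cart a'_b'_def subset_eq)
      then show "(LINT x|lebesgue. indicator (box c d) x * (indicator (box a b) x * f x)) = 0"
        unfolding eq by (rule box0(2))
    qed (use box0 ab in auto)
    then show ?thesis by (auto elim!: eventually_mono simp: indicator_def)
  qed
  obtain \<D> where \<D>: "countable \<D>" "\<D> \<subseteq> Pow D" "\<And>X. X \<in> \<D> \<Longrightarrow> \<exists>a b. X = cbox a b" "\<Union>\<D> = D"
    using open_countable_Union_open_cbox[OF D] by metis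
  have "AE x in lebesgue. x \<in> X \<longrightarrow> f x = 0" if X: "X \<in> \<D>" for X
  proof -
    obtain a b where ab: "X = cbox a b" using \<D>(3) X by blast
    then have "AE x in lebesgue. x \<in> box a b \<longrightarrow> f x = 0" using box_AE \<D>(2) X by blast
    moreover have "AE x in lebesgue. x \<notin> cbox a b - box a b"
      by (intro AE_not_in) (simp add: negligible_iff_null_sets[symmetric] negligible_frontier_interval)
    ultimately show ?thesis by eventually_elim (auto simp: ab)
  qed
  then have "AE x in lebesgue. \<forall>X\<in>\<D>. x \<in> X \<longrightarrow> f x = 0" by (subst AE_ball_countable[OF \<D>(1)]) blast
  then have "AE x in lebesgue. x \<in> D \<longrightarrow> f x = 0"
    by eventually_elim (use \<D>(4) in blast)
  then show ?thesis using Dm by (simp add: AE_restrict_space_iff)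
qed

section \<open>Square integrable functions\<close>

text \<open>The series of the \<open>\<surd>2\<^sup>k d\<^sub>k\<^sup>2\<close>, with \<open>d\<^sub>k\<close> the increments, has a finite integral because
\<open>\<surd>2 / 4 < 1\<close>, so it converges almost everywhere. There, \<open>\<bar>d\<^sub>k\<bar> \<le> \<surd>2\<^sup>-\<^sup>k + \<surd>2\<^sup>k d\<^sub>k\<^sup>2\<close> is summable.\<close>

lemma L2_subseq_AE_convergent:
  fixes g :: "nat \<Rightarrow> 'a \<Rightarrow> real"
  assumes g: "\<And>k. g k \<in> borel_measurable M" "\<And>k. integrable M (\<lambda>x. (g (Suc k) x - g k x)\<^sup>2)"
    and small: "\<And>k. (LINT x|M. (g (Suc k) x - g k x)\<^sup>2) \<le> (1 / 4) ^ k"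
  shows "AE x in M. convergent (\<lambda>k. g k x)"
proof -
  define h where "h k x = sqrt 2 ^ k * (g (Suc k) x - g k x)\<^sup>2" for k x
  have h0: "0 \<le> h k x" for k x by (simp add: h_def)
  have hm: "(\<lambda>x. ennreal (h k x)) \<in> borel_measurable M" for k
    unfolding h_def using g(1)[of k] g(1)[of "Suc k"] by measurable
  have "(\<integral>\<^sup>+x. (\<Sum>k. ennreal (h k x)) \<partial>M) = (\<Sum>k. \<integral>\<^sup>+x. ennreal (h k x) \<partial>M)"
    by (rule nn_integral_suminf) (rule hm)
  also have "\<dots> \<le> (\<Sum>k. ennreal ((sqrt 2 / 4) ^ k))"
  proof (rule suminf_le)
    fix k
    have "(\<integral>\<^sup>+x. ennreal (h k x) \<partial>M) = ennreal (LINT x|M. h k x)"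
      unfolding h_def using g(2) by (intro nn_integral_eq_integral) auto
    also have "(LINT x|M. h k x) \<le> sqrt 2 ^ k * (1 / 4) ^ k"
      unfolding h_def using small[of k] by (simp add: mult_left_mono)
    then have "ennreal (LINT x|M. h k x) \<le> ennreal ((sqrt 2 / 4) ^ k)"
      by (intro ennreal_leI) (simp add: power_divide)
    finally show "(\<integral>\<^sup>+x. ennreal (h k x) \<partial>M) \<le> ennreal ((sqrt 2 / 4) ^ k)" .
  qed auto
  also have "\<dots> = ennreal (\<Sum>k. (sqrt 2 / 4) ^ k)"
  proof (rule suminf_ennreal2)
    have "sqrt 2 < 4" using real_sqrt_less_iff[of 2 16] by simp
    then show "summable (\<lambda>k. (sqrt 2 / 4) ^ k)" by (intro summable_geometric) simp
  qed auto
  finally have "(\<integral>\<^sup>+x. (\<Sum>k. ennreal (h k x)) \<partial>M) < \<infinity>" by (simp add: le_less_trans)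
  then have "AE x in M. (\<Sum>k. ennreal (h k x)) \<noteq> \<infinity>"
    using hm by (intro nn_integral_PInf_AE) auto
  then show ?thesis
  proof eventually_elim
    case (elim x)
    then have sh: "summable (\<lambda>k. h k x)" using h0 by (intro summable_suminf_not_top) auto
    define d where "d k = g (Suc k) x - g k x" for k
    have "\<bar>d k\<bar> \<le> (1 / sqrt 2) ^ k + h k x" for k
    proof -
      define t :: real where "t = sqrt 2 ^ k"
      have t: "0 < t" by (simp add: t_def)
      \<comment> \<open>The inequality \<open>\<bar>d\<bar> \<le> 1/t + t d\<^sup>2\<close> for \<open>t > 0\<close>.\<close>
      have "0 \<le> (1 - t * \<bar>d k\<bar>)\<^sup>2" by simp
      then have "2 * (t * \<bar>d k\<bar>) \<le> 1 + t\<^sup>2 * (d k)\<^sup>2"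
        by (simp add: power2_diff power_mult_distrib)
      moreover have "0 \<le> t * \<bar>d k\<bar>" using t by simp
      ultimately have "t * \<bar>d k\<bar> \<le> 1 + t\<^sup>2 * (d k)\<^sup>2" by linarith
      then have "\<bar>d k\<bar> \<le> 1 / t + t * (d k)\<^sup>2" using t by (simp add: field_simps power2_eq_square)
      then show ?thesis by (simp add: h_def t_def d_def power_divide)
    qed
    moreover have "summable (\<lambda>k. (1 / sqrt 2) ^ k + h k x)"
      by (intro summable_add sh summable_geometric) (simp add: real_less_lsqrt)
    ultimately have "summable d" by (intro summable_comparison_test[of d]) auto
    then have "convergent (\<lambda>n. (\<Sum>k<n. d k) + g 0 x)"
      by (intro convergent_add convergent_const) (simp add: summable_iff_convergent)
    moreover have "(\<Sum>k<n. d k) + g 0 x = g n x" for n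
      unfolding d_def by (induction n) auto
    ultimately show ?case by simp
  qed
qed

text \<open>Riesz--Fischer. A rapidly converging subsequence has an almost everywhere limit, and Fatou's
lemma transfers the Cauchy property to the distance from this limit.\<close>

lemma L2_complete:
  fixes f :: "nat \<Rightarrow> 'a \<Rightarrow> real"
  assumes f: "\<And>k. f k \<in> borel_measurable M" "\<And>m n. integrable M (\<lambda>x. (f m x - f n x)\<^sup>2)"
    and Cauchy: "\<And>e. 0 < e \<Longrightarrow> \<exists>K. \<forall>m\<ge>K. \<forall>n\<ge>K. (LINT x|M. (f m x - f n x)\<^sup>2) < e"
  shows "\<exists>z\<in>borel_measurable M. (\<forall>k. integrable M (\<lambda>x. (f k x - z x)\<^sup>2)) \<and>
    (\<lambda>k. LINT x|M. (f k x - z x)\<^sup>2) \<longlonglongrightarrow> 0"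
proof -
  obtain K where K: "\<And>e m n. \<lbrakk>0 < e; K e \<le> m; K e \<le> n\<rbrakk> \<Longrightarrow> (LINT x|M. (f m x - f n x)\<^sup>2) < e"
    using Cauchy by metis
  \<comment> \<open>The summand \<open>k\<close> makes \<open>r\<close> strictly increasing.\<close>
  define r where "r k = k + (\<Sum>j\<le>k. K ((1 / 4) ^ j))" for k
  have rK: "K ((1 / 4) ^ k) \<le> r k" for k
    using member_le_sum[of k "{..k}" "\<lambda>j. K ((1 / 4) ^ j)"] by (simp add: r_def)
  have r_mono: "strict_mono r" by (simp add: strict_mono_Suc_iff r_def)
  have "AE x in M. convergent (\<lambda>k. f (r k) x)"
  proof (rule L2_subseq_AE_convergent)
    show "(LINT x|M. (f (r (Suc k)) x - f (r k) x)\<^sup>2) \<le> (1 / 4) ^ k" for k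
    proof (rule less_imp_le, rule K)
      have "r k \<le> r (Suc k)" using r_mono by (simp add: strict_mono_less_eq)
      then show "K ((1 / 4) ^ k) \<le> r (Suc k)" using rK[of k] by linarith
    qed (use rK in auto)
  qed (use f in auto)
  define z where "z x = lim (\<lambda>k. f (r k) x)" for x
  have z: "z \<in> borel_measurable M"
    unfolding z_def[abs_def] by (rule borel_measurable_lim_metric) (rule f)
  have lim: "AE x in M. (\<lambda>k. f (r k) x) \<longlonglongrightarrow> z x"
    using \<open>AE x in M. convergent (\<lambda>k. f (r k) x)\<close>
    by eventually_elim (simp add: z_def convergent_LIMSEQ_iff)
  have bound: "integrable M (\<lambda>x. (f n x - z x)\<^sup>2)" "(LINT x|M. (f n x - z x)\<^sup>2) \<le> e"
    if e: "0 < e" and n: "K e \<le> n" for e n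
  proof -
    have m: "(\<lambda>x. ennreal ((f n x - f (r k) x)\<^sup>2)) \<in> borel_measurable M" for k
      using f(1)[of n] f(1)[of "r k"] by measurable
    have "(\<integral>\<^sup>+x. ennreal ((f n x - z x)\<^sup>2) \<partial>M)
        = (\<integral>\<^sup>+x. liminf (\<lambda>k. ennreal ((f n x - f (r k) x)\<^sup>2)) \<partial>M)"
    proof (rule nn_integral_cong_AE)
      show "AE x in M. ennreal ((f n x - z x)\<^sup>2) = liminf (\<lambda>k. ennreal ((f n x - f (r k) x)\<^sup>2))"
        using lim
      proof eventually_elim
        case (elim x)
        have "(\<lambda>k. ennreal ((f n x - f (r k) x)\<^sup>2)) \<longlonglongrightarrow> ennreal ((f n x - z x)\<^sup>2)"
          by (intro tendsto_ennrealI tendsto_intros elim)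
        then show ?case by (intro lim_imp_Liminf[symmetric] sequentially_bot)
      qed
    qed
    also have "\<dots> \<le> liminf (\<lambda>k. \<integral>\<^sup>+x. ennreal ((f n x - f (r k) x)\<^sup>2) \<partial>M)"
      by (rule nn_integral_liminf) (rule m)
    also have "\<dots> \<le> limsup (\<lambda>k. \<integral>\<^sup>+x. ennreal ((f n x - f (r k) x)\<^sup>2) \<partial>M)"
      by (rule Liminf_le_Limsup) simp
    also have "\<dots> \<le> ennreal e"
    proof (rule Limsup_bounded)
      have "(\<integral>\<^sup>+x. ennreal ((f n x - f (r k) x)\<^sup>2) \<partial>M) \<le> ennreal e" if k: "K e \<le> k" for k
      proof -
        have "K e \<le> r k" using k seq_suble[OF r_mono, of k] by linarith
        then have "(LINT x|M. (f n x - f (r k) x)\<^sup>2) \<le> e" using K[OF e n] by fastforce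
        moreover have "(\<integral>\<^sup>+x. ennreal ((f n x - f (r k) x)\<^sup>2) \<partial>M)
            = ennreal (LINT x|M. (f n x - f (r k) x)\<^sup>2)"
          using f by (intro nn_integral_eq_integral) auto
        ultimately show ?thesis by (simp add: ennreal_leI)
      qed
      then show "\<forall>\<^sub>F k in sequentially. (\<integral>\<^sup>+x. ennreal ((f n x - f (r k) x)\<^sup>2) \<partial>M) \<le> ennreal e"
        by (auto simp: eventually_sequentially)
    qed
    finally have le: "(\<integral>\<^sup>+x. ennreal ((f n x - z x)\<^sup>2) \<partial>M) \<le> ennreal e" .
    have mz: "(\<lambda>x. (f n x - z x)\<^sup>2) \<in> borel_measurable M" using f(1)[of n] z by measurable
    show int: "integrable M (\<lambda>x. (f n x - z x)\<^sup>2)"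
      using le mz by (intro integrableI_bounded) (auto simp: le_less_trans)
    have "ennreal (LINT x|M. (f n x - z x)\<^sup>2) \<le> ennreal e"
      using le int by (subst (asm) nn_integral_eq_integral) auto
    then show "(LINT x|M. (f n x - z x)\<^sup>2) \<le> e" using e by simp
  qed
  have "integrable M (\<lambda>x. (f k x - z x)\<^sup>2)" for k
  proof (rule Bochner_Integration.integrable_bound)
    show "integrable M (\<lambda>x. 2 * (f k x - f (K 1) x)\<^sup>2 + 2 * (f (K 1) x - z x)\<^sup>2)"
      using f bound(1)[of 1 "K 1"] by auto
    show "(\<lambda>x. (f k x - z x)\<^sup>2) \<in> borel_measurable M" using f(1)[of k] z by measurable
    have "(s - u)\<^sup>2 \<le> 2 * (s - t)\<^sup>2 + 2 * (t - u)\<^sup>2" for s t u :: real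
      using zero_le_power2[of "(s - t) - (t - u)"] by (simp add: power2_eq_square algebra_simps)
    then show "AE x in M. norm ((f k x - z x)\<^sup>2)
        \<le> norm (2 * (f k x - f (K 1) x)\<^sup>2 + 2 * (f (K 1) x - z x)\<^sup>2)"
      by (intro AE_I2) simp
  qed
  moreover have "(\<lambda>k. LINT x|M. (f k x - z x)\<^sup>2) \<longlonglongrightarrow> 0"
  proof (rule LIMSEQ_I)
    fix e :: real assume e: "0 < e"
    show "\<exists>k0. \<forall>k\<ge>k0. norm ((LINT x|M. (f k x - z x)\<^sup>2) - 0) < e"
    proof (intro exI[of _ "K (e / 2)"] allI impI)
      fix k assume "K (e / 2) \<le> k"
      then have "(LINT x|M. (f k x - z x)\<^sup>2) \<le> e / 2" using bound(2)[of "e / 2" k] e by simp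
      moreover have "0 \<le> (LINT x|M. (f k x - z x)\<^sup>2)" by simp
      ultimately show "norm ((LINT x|M. (f k x - z x)\<^sup>2) - 0) < e" using e by simp
    qed
  qed
  ultimately show ?thesis using z by blast
qed

lemma measurable_lebesgue_on_AE:
  fixes f g :: "'a::euclidean_space \<Rightarrow> real"
  assumes D: "D \<in> sets lebesgue" and f: "f \<in> borel_measurable (lebesgue_on D)"
    and eq: "AE x in lebesgue_on D. f x = g x"
  shows "g \<in> borel_measurable (lebesgue_on D)"
proof -
  have "(\<lambda>x. if x \<in> D then f x else 0) \<in> borel_measurable lebesgue"
    using f D by (rule borel_measurable_if_I)
  moreover have "AE x in lebesgue. (if x \<in> D then f x else 0) = (if x \<in> D then g x else 0)"
    using eq D by (simp add: AE_restrict_space_iff)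
  ultimately have "(\<lambda>x. if x \<in> D then g x else 0) \<in> borel_measurable lebesgue"
    by (rule borel_measurable_AE)
  then show ?thesis by (rule borel_measurable_if_D)
qed

lemma l2_AE:
  assumes D: "D \<in> sets lebesgue" and f: "f \<in> l2 D" and eq: "AE x in lebesgue_on D. f x = g x"
  shows "g \<in> l2 D"
proof -
  have fm: "f \<in> borel_measurable (lebesgue_on D)" and fi: "integrable (lebesgue_on D) (\<lambda>x. (f x)\<^sup>2)"
    using f by (auto simp: l2_def)
  have gm: "g \<in> borel_measurable (lebesgue_on D)"
    using measurable_lebesgue_on_AE[OF D fm eq] .
  have "integrable (lebesgue_on D) (\<lambda>x. (g x)\<^sup>2)"
    using fi gm eq
    by (subst integrable_cong_AE[of _ _ "\<lambda>x. (f x)\<^sup>2"]) (auto elim!: eventually_mono intro: borel_measurable_integrable)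
  with gm show ?thesis by (simp add: l2_def)
qed

lemma l2_mult_integrable:
  assumes "f \<in> l2 D" "g \<in> l2 D"
  shows "integrable (lebesgue_on D) (\<lambda>x. f x * g x)"
proof (rule Bochner_Integration.integrable_bound)
  show "integrable (lebesgue_on D) (\<lambda>x. (f x)\<^sup>2 + (g x)\<^sup>2)" using assms by (auto simp: l2_def)
  show "(\<lambda>x. f x * g x) \<in> borel_measurable (lebesgue_on D)" using assms by (auto simp: l2_def)
  have "\<bar>s * t\<bar> \<le> s\<^sup>2 + t\<^sup>2" for s t :: real
    using zero_le_power2[of "\<bar>s\<bar> - \<bar>t\<bar>"] abs_ge_zero[of "s * t"]
    unfolding power2_diff power2_abs abs_mult by linarith
  then show "AE x in lebesgue_on D. norm (f x * g x) \<le> norm ((f x)\<^sup>2 + (g x)\<^sup>2)"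
    by (intro AE_I2) simp
qed

lemma linf_mult_integrable:
  assumes k: "k \<in> linf D" and f: "integrable (lebesgue_on D) f"
  shows "integrable (lebesgue_on D) (\<lambda>x. k x * f x)"
proof -
  obtain C where C: "AE x in lebesgue_on D. \<bar>k x\<bar> \<le> C" and km: "k \<in> borel_measurable (lebesgue_on D)"
    using k by (auto simp: linf_def)
  show ?thesis
  proof (rule Bochner_Integration.integrable_bound)
    show "integrable (lebesgue_on D) (\<lambda>x. C * f x)" using f by simp
    show "(\<lambda>x. k x * f x) \<in> borel_measurable (lebesgue_on D)"
      using km borel_measurable_integrable[OF f] by measurable
    show "AE x in lebesgue_on D. norm (k x * f x) \<le> norm (C * f x)"
      using C by eventually_elim (auto simp: abs_mult intro!: mult_right_mono)
  qed
qed

lemma l2_linf_mult: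
  assumes k: "k \<in> linf D" and f: "f \<in> l2 D"
  shows "(\<lambda>x. k x * f x) \<in> l2 D"
proof -
  have "integrable (lebesgue_on D) (\<lambda>x. k x * (k x * (f x)\<^sup>2))"
    using k f by (intro linf_mult_integrable) (auto simp: l2_def)
  then have "integrable (lebesgue_on D) (\<lambda>x. (k x * f x)\<^sup>2)"
    by (simp add: power2_eq_square mult_ac)
  then show ?thesis using k f by (auto simp: l2_def linf_def)
qed

lemma l2_add: "\<lbrakk>f \<in> l2 D; g \<in> l2 D\<rbrakk> \<Longrightarrow> (\<lambda>x. f x + g x) \<in> l2 D"
  using l2_mult_integrable[of f D g] by (auto simp: l2_def power2_sum mult.assoc)

lemma l2_scale: "f \<in> l2 D \<Longrightarrow> (\<lambda>x. c * f x) \<in> l2 D"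
  by (auto simp: l2_def power_mult_distrib)

lemma l2_zero: "(\<lambda>x. 0) \<in> l2 D"
  by (simp add: l2_def)

lemma lebesgue_on_integrable_mono:
  fixes f :: "'a::euclidean_space \<Rightarrow> real"
  assumes D: "D' \<subseteq> D" "D' \<in> sets lebesgue" "D \<in> sets lebesgue" and f: "integrable (lebesgue_on D) f"
  shows "integrable (lebesgue_on D') f"
proof -
  have "integrable lebesgue (\<lambda>x. indicator D x *\<^sub>R f x)"
    using f D by (subst integrable_restrict_space[symmetric]) simp_all
  then have "integrable lebesgue (\<lambda>x. indicator D' x *\<^sub>R (indicator D x *\<^sub>R f x))"
    by (rule integrable_mult_indicator[OF D(2)])
  moreover have "(\<lambda>x. indicator D' x *\<^sub>R (indicator D x *\<^sub>R f x)) = (\<lambda>x. indicator D' x *\<^sub>R f x)"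
    using D(1) by (auto simp: indicator_def fun_eq_iff)
  ultimately show ?thesis using D by (simp add: integrable_restrict_space)
qed

lemma l2_mono:
  assumes D: "D' \<subseteq> D" "D' \<in> sets lebesgue" "D \<in> sets lebesgue" and f: "f \<in> l2 D"
  shows "f \<in> l2 D'"
proof -
  have fm: "f \<in> borel_measurable (lebesgue_on D)" and fi: "integrable (lebesgue_on D) (\<lambda>x. (f x)\<^sup>2)"
    using f by (auto simp: l2_def)
  have "f \<in> borel_measurable (lebesgue_on D')"
    using fm D(1) by (rule measurable_restrict_mono)
  with lebesgue_on_integrable_mono[OF D fi] show ?thesis by (simp add: l2_def)
qed

lemma AE_lebesgue_on_mono:
  assumes D: "D' \<subseteq> D" "D' \<in> sets lebesgue" "D \<in> sets lebesgue" and P: "AE x in lebesgue_on D. P x"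
  shows "AE x in lebesgue_on D'. P x"
proof -
  have "AE x in lebesgue. x \<in> D \<longrightarrow> P x" using P D(3) by (simp add: AE_restrict_space_iff)
  then have "AE x in lebesgue. x \<in> D' \<longrightarrow> P x" by eventually_elim (use D(1) in blast)
  then show ?thesis using D(2) by (simp add: AE_restrict_space_iff)
qed

lemma linf_mono:
  assumes D: "D' \<subseteq> D" "D' \<in> sets lebesgue" "D \<in> sets lebesgue" and k: "k \<in> linf D"
  shows "k \<in> linf D'"
proof -
  obtain C where C: "AE x in lebesgue_on D. \<bar>k x\<bar> \<le> C" and km: "k \<in> borel_measurable (lebesgue_on D)"
    using k by (auto simp: linf_def)
  have "AE x in lebesgue_on D'. \<bar>k x\<bar> \<le> C" using AE_lebesgue_on_mono[OF D C] .
  moreover have "k \<in> borel_measurable (lebesgue_on D')"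
    using km D(1) by (rule measurable_restrict_mono)
  ultimately show ?thesis by (auto simp: linf_def)
qed

lemma l2_inner_add: "\<lbrakk>f \<in> l2 D; g \<in> l2 D; h \<in> l2 D\<rbrakk> \<Longrightarrow>
    l2_inner D (\<lambda>x. f x + g x) h = l2_inner D f h + l2_inner D g h"
  using l2_mult_integrable[of f D h] l2_mult_integrable[of g D h]
  by (simp add: l2_inner_def distrib_right)

lemma l2_inner_scale: "l2_inner D (\<lambda>x. c * f x) h = c * l2_inner D f h"
  by (simp add: l2_inner_def mult.assoc)

lemma open_lebesgue: "open D \<Longrightarrow> D \<in> sets lebesgue"
  by (intro sets_completionI_sets) simp

lemma fun_subspace_iff: "fun_subspace S \<longleftrightarrow> subspace S"
  by (simp add: fun_subspace_def subspace_def zero_fun_def plus_fun_def scaleR_fun_def)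

lemma subspace_l2: "subspace (l2 D)"
  by (auto simp flip: fun_subspace_iff simp: fun_subspace_def l2_zero l2_add l2_scale)

section \<open>Weak derivatives\<close>

lemma partial_zero_outside:
  assumes "closed K" "\<And>x. x \<notin> K \<Longrightarrow> f x = 0" "x \<notin> K"
  shows "partial i f x = 0"
proof -
  have "((\<lambda>y. 0) has_derivative (\<lambda>v. 0)) (at x)" by simp
  then have "(f has_derivative (\<lambda>v. 0)) (at x)"
    by (rule has_derivative_transform_within_open[of _ _ _ _ "- K"]) (use assms in auto)
  then show ?thesis unfolding partial_def by (simp flip: frechet_derivative_at)
qed

lemma test_function_support:
  assumes "\<phi> \<in> test_functions D"
  shows "\<exists>K. compact K \<and> K \<subseteq> D \<and> (\<forall>\<alpha> x. x \<notin> K \<longrightarrow> partials \<alpha> \<phi> x = 0)"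
proof -
  obtain K where K: "compact K" "K \<subseteq> D" "\<And>x. x \<notin> K \<Longrightarrow> \<phi> x = 0"
    using assms by (auto simp: test_functions_def)
  have "partials \<alpha> \<phi> x = 0" if "x \<notin> K" for \<alpha> x
    using that
    by (induction \<alpha> arbitrary: x) (use K in \<open>auto intro!: partial_zero_outside[of K] compact_imp_closed\<close>)
  with K show ?thesis by blast
qed

text \<open>A derivative of a test function is continuous with compact support in \<open>D\<close>, hence bounded, and
\<open>f\<close> is integrable over the support. This is what makes the defining identity of weak derivatives
additive in both functions.\<close>

lemma locally_integrable_mult_test:
  assumes D: "D \<in> sets lebesgue" and f: "locally_integrable D f" and \<phi>: "\<phi> \<in> test_functions D"
  shows "integrable (lebesgue_on D) (\<lambda>x. f x * partials \<alpha> \<phi> x)"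
proof -
  obtain K where K: "compact K" "K \<subseteq> D" "\<And>x. x \<notin> K \<Longrightarrow> partials \<alpha> \<phi> x = 0"
    using test_function_support[OF \<phi>] by blast
  have c: "continuous_on UNIV (partials \<alpha> \<phi>)"
    using \<phi> by (simp add: test_functions_def smooth_partials_continuous)
  have "bounded (partials \<alpha> \<phi> ` K)"
    using K(1) c
    by (rule compact_imp_bounded[OF compact_continuous_image[OF continuous_on_subset[OF _ subset_UNIV]], rotated])
  then obtain B where B: "\<And>x. x \<in> K \<Longrightarrow> \<bar>partials \<alpha> \<phi> x\<bar> \<le> B" by (auto simp: bounded_iff)
  have "f absolutely_integrable_on K" using f K by (simp add: locally_integrable_def)
  then have F: "integrable lebesgue (\<lambda>x. indicator K x *\<^sub>R f x)"
    by (simp only: set_integrable_def)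
  have m: "partials \<alpha> \<phi> \<in> borel_measurable lebesgue"
    using c by (intro measurable_completion) (simp add: borel_measurable_continuous_onI)
  have "integrable lebesgue (\<lambda>x. (indicator K x *\<^sub>R f x) * partials \<alpha> \<phi> x)"
  proof (rule Bochner_Integration.integrable_bound)
    show "integrable lebesgue (\<lambda>x. B * (indicator K x *\<^sub>R f x))" using F by simp
    show "(\<lambda>x. indicator K x *\<^sub>R f x * partials \<alpha> \<phi> x) \<in> borel_measurable lebesgue"
      using borel_measurable_integrable[OF F] m by (rule borel_measurable_times)
    show "AE x in lebesgue. norm (indicator K x *\<^sub>R f x * partials \<alpha> \<phi> x)
        \<le> norm (B * (indicator K x *\<^sub>R f x))"
    proof (rule AE_I2)
      fix x
      have "\<bar>f x\<bar> * \<bar>partials \<alpha> \<phi> x\<bar> \<le> \<bar>B\<bar> * \<bar>f x\<bar>" if "x \<in> K"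
        using B[OF that] by (subst mult.commute) (intro mult_right_mono, auto)
      then show "norm (indicator K x *\<^sub>R f x * partials \<alpha> \<phi> x) \<le> norm (B * (indicator K x *\<^sub>R f x))"
        by (cases "x \<in> K") (auto simp: abs_mult)
    qed
  qed
  moreover have "(\<lambda>x. (indicator K x *\<^sub>R f x) * partials \<alpha> \<phi> x)
      = (\<lambda>x. indicator D x *\<^sub>R (f x * partials \<alpha> \<phi> x))"
    using K by (auto simp: fun_eq_iff indicator_def)
  ultimately show ?thesis using D by (simp add: integrable_restrict_space)
qed

lemma locally_integrable_add:
  "\<lbrakk>locally_integrable D f; locally_integrable D g\<rbrakk> \<Longrightarrow> locally_integrable D (\<lambda>x. f x + g x)"
  unfolding locally_integrable_def by (auto intro: set_integral_add)

lemma locally_integrable_scale: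
  "locally_integrable D f \<Longrightarrow> locally_integrable D (\<lambda>x. c * f x)"
  unfolding locally_integrable_def by (auto intro: set_integrable_mult_right)

lemma has_weak_deriv_add:
  assumes D: "open D" and f: "has_weak_deriv D \<alpha> f f'" and g: "has_weak_deriv D \<alpha> g g'"
  shows "has_weak_deriv D \<alpha> (\<lambda>x. f x + g x) (\<lambda>x. f' x + g' x)"
proof -
  have add: "l2_inner D (\<lambda>x. p x + q x) (partials \<beta> \<phi>)
      = l2_inner D p (partials \<beta> \<phi>) + l2_inner D q (partials \<beta> \<phi>)"
    if "locally_integrable D p" "locally_integrable D q" "\<phi> \<in> test_functions D" for p q \<beta> \<phi>
    using locally_integrable_mult_test[OF open_lebesgue[OF D] that(1,3), of \<beta>]
      locally_integrable_mult_test[OF open_lebesgue[OF D] that(2,3), of \<beta>]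
    by (simp add: l2_inner_def distrib_right)
  show ?thesis
    using f g add[of f g _ \<alpha>] add[of f' g' _ "[]"]
    by (auto simp: has_weak_deriv_def locally_integrable_add distrib_left)
qed

lemma has_weak_deriv_scale:
  "has_weak_deriv D \<alpha> f f' \<Longrightarrow> has_weak_deriv D \<alpha> (\<lambda>x. c * f x) (\<lambda>x. c * f' x)"
  by (auto simp: has_weak_deriv_def locally_integrable_scale l2_inner_scale)

text \<open>This is what makes \<open>weak_deriv\<close>, an arbitrary choice among the weak derivatives, linear and
compatible with restriction to subdomains up to null sets.\<close>

lemma has_weak_deriv_unique:
  assumes D: "open D" and "has_weak_deriv D \<alpha> f g" "has_weak_deriv D \<alpha> f g'"
  shows "AE x in lebesgue_on D. g x = g' x"
proof -
  have loc: "locally_integrable D g" "locally_integrable D g'"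
    and eq: "\<And>\<phi>. \<phi> \<in> test_functions D \<Longrightarrow> l2_inner D g \<phi> = l2_inner D g' \<phi>"
    using assms by (auto simp: has_weak_deriv_def)
  have "AE x in lebesgue_on D. g x + - 1 * g' x = 0"
  proof (rule fundamental_lemma[OF D])
    show "locally_integrable D (\<lambda>x. g x + - 1 * g' x)"
      using loc by (intro locally_integrable_add locally_integrable_scale)
    fix \<phi> assume \<phi>: "\<phi> \<in> test_functions D"
    show "l2_inner D (\<lambda>x. g x + - 1 * g' x) \<phi> = 0"
      using eq[OF \<phi>] locally_integrable_mult_test[OF open_lebesgue[OF D] loc(1) \<phi>, of "[]"]
        locally_integrable_mult_test[OF open_lebesgue[OF D] loc(2) \<phi>, of "[]"]
      by (simp add: l2_inner_def left_diff_distrib)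
  qed
  then show ?thesis by eventually_elim simp
qed

lemma test_functions_mono: "D' \<subseteq> D \<Longrightarrow> test_functions D' \<subseteq> test_functions D"
  by (auto simp: test_functions_def)

lemma l2_inner_test_mono:
  assumes "D' \<subseteq> D" "D' \<in> sets lebesgue" "D \<in> sets lebesgue" and \<phi>: "\<phi> \<in> test_functions D'"
  shows "l2_inner D' f (partials \<alpha> \<phi>) = l2_inner D f (partials \<alpha> \<phi>)"
proof -
  obtain K where "K \<subseteq> D'" "\<And>x. x \<notin> K \<Longrightarrow> partials \<alpha> \<phi> x = 0"
    using test_function_support[OF \<phi>] by blast
  then have "(\<lambda>x. indicator D' x *\<^sub>R (f x * partials \<alpha> \<phi> x)) = (\<lambda>x. indicator D x *\<^sub>R (f x * partials \<alpha> \<phi> x))"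
    using assms by (auto simp: fun_eq_iff indicator_def)
  then show ?thesis using assms by (simp add: l2_inner_def integral_restrict_space)
qed

lemma has_weak_deriv_mono:
  assumes D: "D' \<subseteq> D" "D' \<in> sets lebesgue" "D \<in> sets lebesgue" and f: "has_weak_deriv D \<alpha> f g"
  shows "has_weak_deriv D' \<alpha> f g"
  using f test_functions_mono[OF D(1)] l2_inner_test_mono[OF D, of _ f \<alpha>] l2_inner_test_mono[OF D, of _ g "[]"] D(1)
  unfolding has_weak_deriv_def locally_integrable_def by (auto simp: subset_eq)

lemma weak_deriv_works:
  assumes D: "open D" and f: "f \<in> sobolev D m" and \<alpha>: "length \<alpha> \<le> m"
  shows "has_weak_deriv D \<alpha> f (weak_deriv D \<alpha> f)" and "weak_deriv D \<alpha> f \<in> l2 D"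
proof -
  obtain g where g: "g \<in> l2 D" "has_weak_deriv D \<alpha> f g" using f \<alpha> by (auto simp: sobolev_def)
  show w: "has_weak_deriv D \<alpha> f (weak_deriv D \<alpha> f)"
    unfolding weak_deriv_def using g(2) by (rule someI[where P="has_weak_deriv D \<alpha> f"])
  show "weak_deriv D \<alpha> f \<in> l2 D"
    using l2_AE[OF open_lebesgue[OF D] g(1) has_weak_deriv_unique[OF D g(2) w]] .
qed

lemma weak_deriv_AE_eq:
  assumes "open D" "has_weak_deriv D \<alpha> f g"
  shows "AE x in lebesgue_on D. weak_deriv D \<alpha> f x = g x"
proof -
  have "has_weak_deriv D \<alpha> f (weak_deriv D \<alpha> f)"
    unfolding weak_deriv_def using assms(2) by (rule someI[where P="has_weak_deriv D \<alpha> f"])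
  then show ?thesis using assms has_weak_deriv_unique by blast
qed

lemma weak_deriv_Nil:
  assumes D: "open D" and f: "f \<in> sobolev D m"
  shows "AE x in lebesgue_on D. weak_deriv D [] f x = f x"
proof (rule weak_deriv_AE_eq[OF D])
  have "locally_integrable D f"
    using weak_deriv_works(1)[OF D f, of "[]"] by (simp add: has_weak_deriv_def)
  then show "has_weak_deriv D [] f f" by (simp add: has_weak_deriv_def)
qed

lemma sobolev_l2: "f \<in> sobolev D m \<Longrightarrow> f \<in> l2 D"
  by (simp add: sobolev_def)

lemma sobolev_mono:
  assumes D: "D' \<subseteq> D" "D' \<in> sets lebesgue" "D \<in> sets lebesgue" and f: "f \<in> sobolev D m"
  shows "f \<in> sobolev D' m"
  using f l2_mono[OF D] has_weak_deriv_mono[OF D] unfolding sobolev_def by blast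

lemma subspace_sobolev:
  assumes D: "open D"
  shows "subspace (sobolev D m)"
proof -
  have "has_weak_deriv D \<alpha> (\<lambda>x. 0) (\<lambda>x. 0)" for \<alpha>
    by (simp add: has_weak_deriv_def locally_integrable_def l2_inner_def set_integrable_def)
  then have "(\<lambda>x. 0) \<in> sobolev D m" using l2_zero by (auto simp: sobolev_def)
  moreover have "(\<lambda>x. f x + g x) \<in> sobolev D m" if "f \<in> sobolev D m" "g \<in> sobolev D m" for f g
    using that has_weak_deriv_add[OF D] l2_add unfolding sobolev_def by blast
  moreover have "(\<lambda>x. c * f x) \<in> sobolev D m" if "f \<in> sobolev D m" for f c
    using that has_weak_deriv_scale l2_scale unfolding sobolev_def by blast
  ultimately show ?thesis by (auto simp flip: fun_subspace_iff simp: fun_subspace_def)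
qed

section \<open>The bilinear forms\<close>

lemma finite_lists_bounded: "finite {\<alpha> :: 'n::finite list. length \<alpha> \<le> m}"
  using finite_lists_length_le[of "UNIV :: 'n set" m] by simp

definition bounded_coefficients ::
  "nat \<Rightarrow> ('n list \<Rightarrow> 'n list \<Rightarrow> real^'n \<Rightarrow> real) \<Rightarrow> (real^'n) set \<Rightarrow> bool" where
  "bounded_coefficients m \<kappa> D \<longleftrightarrow> (\<forall>\<alpha> \<beta>. length \<alpha> \<le> m \<and> length \<beta> \<le> m \<longrightarrow> \<kappa> \<alpha> \<beta> \<in> linf D)"

lemma form_integrable:
  assumes D: "open D" and k: "bounded_coefficients m \<kappa> D" and u: "u \<in> sobolev D m" and v: "v \<in> sobolev D m"
    and "length \<alpha> \<le> m" "length \<beta> \<le> m"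
  shows "integrable (lebesgue_on D) (\<lambda>x. \<kappa> \<alpha> \<beta> x * weak_deriv D \<alpha> u x * weak_deriv D \<beta> v x)"
proof -
  have "integrable (lebesgue_on D) (\<lambda>x. \<kappa> \<alpha> \<beta> x * (weak_deriv D \<alpha> u x * weak_deriv D \<beta> v x))"
    using assms weak_deriv_works(2)[OF D]
    by (intro linf_mult_integrable l2_mult_integrable) (auto simp: bounded_coefficients_def)
  then show ?thesis by (simp add: mult.assoc)
qed

text \<open>All weak derivatives are determined only almost everywhere; the integrals that make up the
bilinear forms do not depend on the representative.\<close>

lemma form_term_cong:
  assumes D: "open D" and k: "bounded_coefficients m \<kappa> D"
    and f: "f \<in> l2 D" and f': "f' \<in> l2 D" and g: "g \<in> l2 D" and g': "g' \<in> l2 D"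
    and "length \<alpha> \<le> m" "length \<beta> \<le> m"
    and ff': "AE x in lebesgue_on D. f x = f' x" and gg': "AE x in lebesgue_on D. g x = g' x"
  shows "(LINT x|lebesgue_on D. \<kappa> \<alpha> \<beta> x * f x * g x) = (LINT x|lebesgue_on D. \<kappa> \<alpha> \<beta> x * f' x * g' x)"
proof (rule integral_cong_AE)
  have "\<kappa> \<alpha> \<beta> \<in> borel_measurable (lebesgue_on D)"
    using k assms by (auto simp: bounded_coefficients_def linf_def)
  then show "(\<lambda>x. \<kappa> \<alpha> \<beta> x * f x * g x) \<in> borel_measurable (lebesgue_on D)"
    "(\<lambda>x. \<kappa> \<alpha> \<beta> x * f' x * g' x) \<in> borel_measurable (lebesgue_on D)"
    using f f' g g' by (auto simp: l2_def intro!: borel_measurable_times)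
  show "AE x in lebesgue_on D. \<kappa> \<alpha> \<beta> x * f x * g x = \<kappa> \<alpha> \<beta> x * f' x * g' x"
    using ff' gg' by eventually_elim simp
qed

lemma form_on_add:
  assumes D: "open D" and k: "bounded_coefficients m \<kappa> D"
    and f: "f \<in> sobolev D m" and g: "g \<in> sobolev D m" and v: "v \<in> sobolev D m"
  shows "form_on m \<kappa> D (\<lambda>x. f x + g x) v = form_on m \<kappa> D f v + form_on m \<kappa> D g v"
  unfolding form_on_def sum.distrib[symmetric]
proof (intro sum.cong refl)
  fix \<alpha> \<beta> :: "'a list" assume "\<alpha> \<in> {\<alpha>. length \<alpha> \<le> m}" "\<beta> \<in> {\<beta>. length \<beta> \<le> m}"
  then have l: "length \<alpha> \<le> m" "length \<beta> \<le> m" by auto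
  have fg: "(\<lambda>x. f x + g x) \<in> sobolev D m"
    using subspace_add[OF subspace_sobolev[OF D] f g] by (simp add: plus_fun_def)
  have "(LINT x|lebesgue_on D. \<kappa> \<alpha> \<beta> x * weak_deriv D \<alpha> (\<lambda>x. f x + g x) x * weak_deriv D \<beta> v x)
      = (LINT x|lebesgue_on D. \<kappa> \<alpha> \<beta> x * (weak_deriv D \<alpha> f x + weak_deriv D \<alpha> g x) * weak_deriv D \<beta> v x)"
    using weak_deriv_works[OF D f l(1)] weak_deriv_works[OF D g l(1)] weak_deriv_works[OF D fg l(1)]
      weak_deriv_works[OF D v l(2)]
    by (intro form_term_cong[OF D k _ _ _ _ l] weak_deriv_AE_eq[OF D] has_weak_deriv_add[OF D] l2_add) auto
  then show "(LINT x|lebesgue_on D. \<kappa> \<alpha> \<beta> x * weak_deriv D \<alpha> (\<lambda>x. f x + g x) x * weak_deriv D \<beta> v x)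
      = (LINT x|lebesgue_on D. \<kappa> \<alpha> \<beta> x * weak_deriv D \<alpha> f x * weak_deriv D \<beta> v x)
      + (LINT x|lebesgue_on D. \<kappa> \<alpha> \<beta> x * weak_deriv D \<alpha> g x * weak_deriv D \<beta> v x)"
    using form_integrable[OF D k f v l] form_integrable[OF D k g v l]
    by (simp add: distrib_left distrib_right)
qed

lemma form_on_scale:
  assumes D: "open D" and k: "bounded_coefficients m \<kappa> D"
    and f: "f \<in> sobolev D m" and v: "v \<in> sobolev D m"
  shows "form_on m \<kappa> D (\<lambda>x. c * f x) v = c * form_on m \<kappa> D f v"
  unfolding form_on_def sum_distrib_left
proof (intro sum.cong refl)
  fix \<alpha> \<beta> :: "'a list" assume "\<alpha> \<in> {\<alpha>. length \<alpha> \<le> m}" "\<beta> \<in> {\<beta>. length \<beta> \<le> m}"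
  then have l: "length \<alpha> \<le> m" "length \<beta> \<le> m" by auto
  have cf: "(\<lambda>x. c * f x) \<in> sobolev D m"
    using subspace_scale[OF subspace_sobolev[OF D] f, of c] by (simp add: scaleR_fun_def)
  have "(LINT x|lebesgue_on D. \<kappa> \<alpha> \<beta> x * weak_deriv D \<alpha> (\<lambda>x. c * f x) x * weak_deriv D \<beta> v x)
      = (LINT x|lebesgue_on D. \<kappa> \<alpha> \<beta> x * (c * weak_deriv D \<alpha> f x) * weak_deriv D \<beta> v x)"
    using weak_deriv_works[OF D f l(1)] weak_deriv_works[OF D cf l(1)] weak_deriv_works[OF D v l(2)]
    by (intro form_term_cong[OF D k _ _ _ _ l] weak_deriv_AE_eq[OF D] has_weak_deriv_scale l2_scale) auto
  also have "\<dots> = (LINT x|lebesgue_on D. c * (\<kappa> \<alpha> \<beta> x * weak_deriv D \<alpha> f x * weak_deriv D \<beta> v x))"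
    by (simp add: mult_ac)
  also have "\<dots> = c * (LINT x|lebesgue_on D. \<kappa> \<alpha> \<beta> x * weak_deriv D \<alpha> f x * weak_deriv D \<beta> v x)"
    by simp
  finally show "(LINT x|lebesgue_on D. \<kappa> \<alpha> \<beta> x * weak_deriv D \<alpha> (\<lambda>x. c * f x) x * weak_deriv D \<beta> v x)
      = c * (LINT x|lebesgue_on D. \<kappa> \<alpha> \<beta> x * weak_deriv D \<alpha> f x * weak_deriv D \<beta> v x)" .
qed

section \<open>Triangulations\<close>

lemma element_convex_compact:
  assumes "fe_triangulation \<Omega> \<T>" "K \<in> \<T>"
  shows "convex K" "compact K"
proof -
  consider "n_simplex K" | "n_rectangle K" using assms by (auto simp: fe_triangulation_def)
  then have "convex K \<and> compact K"
  proof cases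
    case 1
    then show ?thesis unfolding n_simplex_def using convex_simplex compact_simplex by blast
  next
    case 2
    then show ?thesis by (auto simp: n_rectangle_def convex_box compact_cbox)
  qed
  then show "convex K" "compact K" by auto
qed

text \<open>An interior point \<open>p\<close> of an element on the boundary of \<open>\<Omega>\<close> is impossible: moving \<open>p\<close> slightly
against the direction \<open>e\<close> leads below the graph, to a point with a neighbourhood outside \<open>\<Omega>\<close>,
whereas the element lies in the closure of \<open>\<Omega>\<close>.\<close>

lemma element_interior_subset:
  assumes dom: "lipschitz_domain \<Omega>" and tri: "fe_triangulation \<Omega> \<T>" and K: "K \<in> \<T>"
  shows "interior K \<subseteq> \<Omega>"
proof (rule subsetI, rule ccontr)
  fix p assume p: "p \<in> interior K" "p \<notin> \<Omega>"
  have sub: "interior K \<subseteq> closure \<Omega>"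
    using tri K interior_subset by (fastforce simp: fe_triangulation_def)
  have "open \<Omega>" using dom by (simp add: lipschitz_domain_def)
  then have "p \<in> frontier \<Omega>" using p sub by (auto simp: frontier_def interior_open)
  then obtain e r g L where e: "norm e = 1" and r: "0 < r" and g: "lipschitz_on L UNIV g"
    and graph: "\<And>x. x \<in> ball p r \<Longrightarrow> x \<in> \<Omega> \<longleftrightarrow> g (x - (x \<bullet> e) *\<^sub>R e) < x \<bullet> e"
    using dom unfolding lipschitz_domain_def by blast
  define U where "U = {x. x \<bullet> e < g (x - (x \<bullet> e) *\<^sub>R e)}"
  have cg: "continuous_on UNIV g" using g by (rule lipschitz_on_continuous_on)
  have "open U"
    unfolding U_def
    by (intro open_Collect_less continuous_intros continuous_on_compose2[OF cg]) auto
  obtain r' where r': "0 < r'" "ball p r' \<subseteq> interior K"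
    using p open_interior open_contains_ball by blast
  define t where "t = min r r' / 2"
  have t: "0 < t" "t < r" "t < r'" using r r' by (auto simp: t_def min_def)
  define q where "q = p - t *\<^sub>R e"
  have dq: "dist p q = t" using e t by (simp add: q_def dist_norm)
  have ee: "e \<bullet> e = 1" using e by (simp add: norm_eq_1)
  have q1: "q - (q \<bullet> e) *\<^sub>R e = p - (p \<bullet> e) *\<^sub>R e"
    by (simp add: q_def inner_diff_left ee algebra_simps)
  have q2: "q \<bullet> e = p \<bullet> e - t" by (simp add: q_def inner_diff_left ee)
  have "\<not> g (p - (p \<bullet> e) *\<^sub>R e) < p \<bullet> e" using graph[of p] p r by simp
  then have "q \<in> U" unfolding U_def mem_Collect_eq q1 using t by (simp add: q2)
  moreover have "q \<in> closure \<Omega>" using sub r' dq t by (auto simp: subset_eq)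
  moreover have "q \<in> ball p r" using dq t by simp
  ultimately have "(U \<inter> ball p r) \<inter> \<Omega> \<noteq> {}"
    using \<open>open U\<close> open_Int_closure_eq_empty[of "U \<inter> ball p r" \<Omega>] by (auto simp: open_Int)
  then show False using graph by (force simp: U_def)
qed

text \<open>The intersection of two elements is a face of both, and a face that contains an interior point
is the whole element.\<close>

lemma element_interiors_disjoint:
  assumes tri: "fe_triangulation \<Omega> \<T>" and K: "K \<in> \<T>" and K': "K' \<in> \<T>"
    and x: "x \<in> interior K" "x \<in> interior K'"
  shows "K = K'"
proof -
  have faces: "(K \<inter> K') face_of K" "(K \<inter> K') face_of K'" using tri K K' by (auto simp: fe_triangulation_def)
  have "x \<in> (K \<inter> K') \<inter> interior K" "x \<in> (K \<inter> K') \<inter> interior K'" using x interior_subset by blast+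
  then have "K \<inter> K' = K" "K \<inter> K' = K'"
    using face_of_disjoint_interior[OF faces(1)] face_of_disjoint_interior[OF faces(2)] by blast+
  then show ?thesis by simp
qed

text \<open>Elements are convex, so their boundaries are null sets.\<close>

lemma elements_cover_AE:
  assumes tri: "fe_triangulation \<Omega> \<T>"
  shows "AE x in lebesgue. x \<in> \<Omega> \<longrightarrow> x \<in> (\<Union>K\<in>\<T>. interior K)"
proof -
  have "negligible (\<Union>K\<in>\<T>. frontier K)"
    using tri element_convex_compact[OF tri]
    by (intro negligible_Union) (auto simp: fe_triangulation_def negligible_convex_frontier)
  then have "AE x in lebesgue. x \<notin> (\<Union>K\<in>\<T>. frontier K)"
    by (intro AE_not_in) (simp add: negligible_iff_null_sets)
  then show ?thesis
  proof eventually_elim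
    case (elim x)
    show ?case
    proof
      assume "x \<in> \<Omega>"
      then obtain K where "K \<in> \<T>" "x \<in> K"
        using tri closure_subset unfolding fe_triangulation_def by blast
      then show "x \<in> (\<Union>K\<in>\<T>. interior K)"
        using elim element_convex_compact(2)[OF tri] by (auto simp: frontier_def compact_imp_closed)
    qed
  qed
qed

lemma integral_over_elements:
  fixes F :: "real^'n \<Rightarrow> real"
  assumes dom: "lipschitz_domain \<Omega>" and tri: "fe_triangulation \<Omega> \<T>" and F: "integrable (lebesgue_on \<Omega>) F"
  shows "(LINT x|lebesgue_on \<Omega>. F x) = (\<Sum>K\<in>\<T>. LINT x|lebesgue_on (interior K). F x)"
proof -
  have \<Omega>: "\<Omega> \<in> sets lebesgue" using dom by (intro open_lebesgue) (simp add: lipschitz_domain_def)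
  have i: "interior K \<in> sets lebesgue" for K :: "(real^'n) set" by (intro open_lebesgue open_interior)
  have fin: "finite \<T>" using tri by (simp add: fe_triangulation_def)
  have F\<Omega>: "integrable lebesgue (\<lambda>x. indicator \<Omega> x *\<^sub>R F x)"
    using F \<Omega> by (subst integrable_restrict_space[symmetric]) simp_all
  have FK: "integrable lebesgue (\<lambda>x. indicator (interior K) x *\<^sub>R F x)" if "K \<in> \<T>" for K
    using lebesgue_on_integrable_mono[OF element_interior_subset[OF dom tri that] i \<Omega> F] i
    by (subst integrable_restrict_space[symmetric]) simp_all
  have "(LINT x|lebesgue_on \<Omega>. F x) = (LINT x|lebesgue. indicator \<Omega> x *\<^sub>R F x)"
    using \<Omega> by (intro integral_restrict_space) simp
  also have "\<dots> = (LINT x|lebesgue. indicator (\<Union>K\<in>\<T>. interior K) x *\<^sub>R F x)"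
  proof (rule integral_cong_AE)
    show "(\<lambda>x. indicator \<Omega> x *\<^sub>R F x) \<in> borel_measurable lebesgue"
      using F\<Omega> by (rule borel_measurable_integrable)
    have "(\<lambda>x. indicator (\<Union>K\<in>\<T>. interior K) x *\<^sub>R (indicator \<Omega> x *\<^sub>R F x)) \<in> borel_measurable lebesgue"
      using fin i
      by (intro borel_measurable_integrable integrable_mult_indicator[OF _ F\<Omega>] sets.finite_UN) auto
    moreover have "(\<lambda>x. indicator (\<Union>K\<in>\<T>. interior K) x *\<^sub>R (indicator \<Omega> x *\<^sub>R F x))
        = (\<lambda>x. indicator (\<Union>K\<in>\<T>. interior K) x *\<^sub>R F x)"
      using element_interior_subset[OF dom tri] by (auto simp: fun_eq_iff indicator_def)
    ultimately show "(\<lambda>x. indicator (\<Union>K\<in>\<T>. interior K) x *\<^sub>R F x) \<in> borel_measurable lebesgue"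
      by simp
    show "AE x in lebesgue. indicator \<Omega> x *\<^sub>R F x = indicator (\<Union>K\<in>\<T>. interior K) x *\<^sub>R F x"
      using elements_cover_AE[OF tri]
      by eventually_elim (use element_interior_subset[OF dom tri] in \<open>auto simp: indicator_def\<close>)
  qed
  also have "\<dots> = (\<Sum>K\<in>\<T>. LINT x|lebesgue. indicator (interior K) x *\<^sub>R F x)"
    unfolding set_lebesgue_integral_def[symmetric]
  proof (rule set_integral_finite_UN_AE[OF fin])
    show "AE x in lebesgue. x \<in> interior K \<and> x \<in> interior K' \<longrightarrow> K = K'" if "K \<in> \<T>" "K' \<in> \<T>" for K K'
      using element_interiors_disjoint[OF tri that] by (intro AE_I2) blast
  qed (use FK i in \<open>auto simp: set_integrable_def\<close>)
  also have "\<dots> = (\<Sum>K\<in>\<T>. LINT x|lebesgue_on (interior K). F x)"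
    using i by (intro sum.cong refl integral_restrict_space[symmetric]) simp
  finally show ?thesis .
qed

lemma l2_from_elements:
  assumes dom: "lipschitz_domain \<Omega>" and tri: "fe_triangulation \<Omega> \<T>"
    and f: "\<And>K. K \<in> \<T> \<Longrightarrow> f \<in> l2 (interior K)"
  shows "f \<in> l2 \<Omega>"
proof -
  have \<Omega>: "\<Omega> \<in> sets lebesgue" using dom by (intro open_lebesgue) (simp add: lipschitz_domain_def)
  have i: "interior K \<in> sets lebesgue" for K :: "(real^'a) set" by (intro open_lebesgue open_interior)
  have fin: "finite \<T>" using tri by (simp add: fe_triangulation_def)
  define g where "g x = (\<Sum>K\<in>\<T>. if x \<in> interior K then f x else 0)" for x
  have g_eq: "g x = f x" if x: "x \<in> (\<Union>K\<in>\<T>. interior K)" for x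
  proof -
    obtain K where K: "K \<in> \<T>" "x \<in> interior K" using x by blast
    have "g x = (\<Sum>K'\<in>\<T>. if K' = K then f x else 0)"
      unfolding g_def using K element_interiors_disjoint[OF tri _ K(1)]
      by (intro sum.cong) auto
    then show ?thesis using fin K by simp
  qed
  have fK: "(\<lambda>x. if x \<in> interior K then f x else 0) \<in> l2 \<Omega>" if K: "K \<in> \<T>" for K
  proof -
    have m: "f \<in> borel_measurable (lebesgue_on (interior K))"
      and int: "integrable (lebesgue_on (interior K)) (\<lambda>x. (f x)\<^sup>2)"
      using f[OF K] by (auto simp: l2_def)
    have "(\<lambda>x. if x \<in> interior K then f x else 0) \<in> borel_measurable (lebesgue_on \<Omega>)"
      using borel_measurable_if_I[OF m i] by (rule measurable_restrict_space1)
    moreover have "integrable lebesgue (\<lambda>x. indicator (interior K) x *\<^sub>R (f x)\<^sup>2)"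
      using int i by (subst integrable_restrict_space[symmetric]) simp_all
    then have "integrable (lebesgue_on \<Omega>) (\<lambda>x. indicator (interior K) x *\<^sub>R (f x)\<^sup>2)"
      by (intro lebesgue_on_integrable_mono[OF subset_UNIV \<Omega>]) (simp_all add: lebesgue_on_UNIV_eq)
    moreover have "(\<lambda>x. indicator (interior K) x *\<^sub>R (f x)\<^sup>2) = (\<lambda>x. (if x \<in> interior K then f x else 0)\<^sup>2)"
      by (auto simp: fun_eq_iff indicator_def)
    ultimately show ?thesis by (simp add: l2_def)
  qed
  have "g \<in> l2 \<Omega>"
  proof -
    have "(\<Sum>K\<in>\<T>. (\<lambda>x. if x \<in> interior K then f x else 0)) \<in> l2 \<Omega>"
      using fK by (intro subspace_sum subspace_l2)
    moreover have "(\<Sum>K\<in>\<T>. (\<lambda>x. if x \<in> interior K then f x else 0)) = g"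
      by (simp add: fun_eq_iff sum_fun_apply g_def)
    ultimately show ?thesis by simp
  qed
  moreover have "AE x in lebesgue_on \<Omega>. g x = f x"
    using elements_cover_AE[OF tri] \<Omega> g_eq
    by (simp add: AE_restrict_space_iff) (auto elim!: eventually_mono)
  ultimately show ?thesis by (rule l2_AE[OF \<Omega>])
qed

lemma bounded_coefficients_element:
  assumes dom: "lipschitz_domain \<Omega>" and tri: "fe_triangulation \<Omega> \<T>" and K: "K \<in> \<T>"
    and k: "bounded_coefficients m \<kappa> \<Omega>"
  shows "bounded_coefficients m \<kappa> (interior K)"
proof -
  have "\<Omega> \<in> sets lebesgue" using dom by (intro open_lebesgue) (simp add: lipschitz_domain_def)
  then show ?thesis
    using k linf_mono[OF element_interior_subset[OF dom tri K] open_lebesgue[OF open_interior]]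
    by (simp add: bounded_coefficients_def)
qed

text \<open>A weak derivative on \<open>\<Omega>\<close> restricts to a weak derivative on every element, and integrals over
\<open>\<Omega>\<close> split into integrals over the elements.\<close>

lemma form_on_elements:
  assumes dom: "lipschitz_domain \<Omega>" and tri: "fe_triangulation \<Omega> \<T>"
    and k: "bounded_coefficients m \<kappa> \<Omega>" and u: "u \<in> sobolev \<Omega> m" and v: "v \<in> sobolev \<Omega> m"
  shows "form_on m \<kappa> \<Omega> u v = piecewise_form m \<kappa> \<T> u v"
proof -
  have \<Omega>: "open \<Omega>" using dom by (simp add: lipschitz_domain_def)
  let ?I = "\<lambda>D \<alpha> \<beta>. LINT x|lebesgue_on D. \<kappa> \<alpha> \<beta> x * weak_deriv D \<alpha> u x * weak_deriv D \<beta> v x"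
  have "?I \<Omega> \<alpha> \<beta> = (\<Sum>K\<in>\<T>. ?I (interior K) \<alpha> \<beta>)" if l: "length \<alpha> \<le> m" "length \<beta> \<le> m" for \<alpha> \<beta>
  proof -
    have "?I \<Omega> \<alpha> \<beta> = (\<Sum>K\<in>\<T>. LINT x|lebesgue_on (interior K).
        \<kappa> \<alpha> \<beta> x * weak_deriv \<Omega> \<alpha> u x * weak_deriv \<Omega> \<beta> v x)"
      by (intro integral_over_elements[OF dom tri] form_integrable[OF \<Omega> k u v l])
    also have "\<dots> = (\<Sum>K\<in>\<T>. ?I (interior K) \<alpha> \<beta>)"
    proof (rule sum.cong)
      fix K assume K: "K \<in> \<T>"
      note sub = element_interior_subset[OF dom tri K]
      note mono = sub open_lebesgue[OF open_interior] open_lebesgue[OF \<Omega>]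
      have uK: "u \<in> sobolev (interior K) m" and vK: "v \<in> sobolev (interior K) m"
        using sobolev_mono[OF mono] u v by blast+
      have eq: "AE x in lebesgue_on (interior K). weak_deriv \<Omega> \<gamma> w x = weak_deriv (interior K) \<gamma> w x"
        if w: "w \<in> sobolev \<Omega> m" and "length \<gamma> \<le> m" for w \<gamma>
        using weak_deriv_AE_eq[OF open_interior has_weak_deriv_mono[OF mono weak_deriv_works(1)[OF \<Omega> that]]]
        by eventually_elim simp
      show "(LINT x|lebesgue_on (interior K). \<kappa> \<alpha> \<beta> x * weak_deriv \<Omega> \<alpha> u x * weak_deriv \<Omega> \<beta> v x)
          = ?I (interior K) \<alpha> \<beta>"
      proof (rule form_term_cong[OF open_interior bounded_coefficients_element[OF dom tri K k] _ _ _ _ l])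
        show "weak_deriv \<Omega> \<alpha> u \<in> l2 (interior K)" "weak_deriv \<Omega> \<beta> v \<in> l2 (interior K)"
          using l2_mono[OF mono] weak_deriv_works(2)[OF \<Omega>] u v l by blast+
      qed (use weak_deriv_works(2)[OF open_interior] uK vK l eq u v in blast)+
    qed simp
    finally show ?thesis .
  qed
  then have "form_on m \<kappa> \<Omega> u v = (\<Sum>\<alpha> | length \<alpha> \<le> m. \<Sum>\<beta> | length \<beta> \<le> m. \<Sum>K\<in>\<T>. ?I (interior K) \<alpha> \<beta>)"
    unfolding form_on_def by (intro sum.cong refl) auto
  also have "\<dots> = (\<Sum>\<alpha> | length \<alpha> \<le> m. \<Sum>K\<in>\<T>. \<Sum>\<beta> | length \<beta> \<le> m. ?I (interior K) \<alpha> \<beta>)"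
    by (intro sum.cong refl sum.swap)
  also have "\<dots> = (\<Sum>K\<in>\<T>. \<Sum>\<alpha> | length \<alpha> \<le> m. \<Sum>\<beta> | length \<beta> \<le> m. ?I (interior K) \<alpha> \<beta>)"
    by (rule sum.swap)
  finally show ?thesis by (simp add: piecewise_form_def form_on_def)
qed

lemma piecewise_form_linear:
  assumes dom: "lipschitz_domain \<Omega>" and tri: "fe_triangulation \<Omega> \<T>" and k: "bounded_coefficients m \<kappa> \<Omega>"
    and f: "\<And>K. K \<in> \<T> \<Longrightarrow> f \<in> sobolev (interior K) m" and g: "\<And>K. K \<in> \<T> \<Longrightarrow> g \<in> sobolev (interior K) m"
    and v: "\<And>K. K \<in> \<T> \<Longrightarrow> v \<in> sobolev (interior K) m"
  shows "piecewise_form m \<kappa> \<T> (\<lambda>x. f x + g x) v = piecewise_form m \<kappa> \<T> f v + piecewise_form m \<kappa> \<T> g v"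
    and "piecewise_form m \<kappa> \<T> (\<lambda>x. c * f x) v = c * piecewise_form m \<kappa> \<T> f v"
  using assms bounded_coefficients_element[OF dom tri _ k]
  by (auto simp: piecewise_form_def form_on_add form_on_scale sum_distrib_left simp flip: sum.distrib
      intro!: sum.cong)

section \<open>The mass form and the energy forms\<close>

definition mass_form :: "(real^'n) set \<Rightarrow> (real^'n \<Rightarrow> real) \<Rightarrow> (real^'n \<Rightarrow> real) \<Rightarrow> (real^'n \<Rightarrow> real) \<Rightarrow> real" where
  "mass_form \<Omega> \<rho> f g = l2_inner \<Omega> (\<lambda>x. \<rho> x * f x) g"

lemma energy_norm_form_norm: "energy_norm = form_norm"
  by (simp add: fun_eq_iff energy_norm_def form_norm_def)

lemma l2_norm_form_norm: "l2_norm \<Omega> = form_norm (l2_inner \<Omega>)"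
  by (simp add: fun_eq_iff l2_norm_def form_norm_def)

lemma semi_inner_l2: "semi_inner (l2 \<Omega>) (l2_inner \<Omega>)"
proof
  show "subspace (l2 \<Omega>)" by (rule subspace_l2)
qed (auto simp: l2_inner_add plus_fun_def scaleR_fun_def l2_inner_scale
    simp del: plus_fun_apply, auto simp: l2_inner_def mult.commute)

lemma semi_inner_mass:
  assumes rho: "\<rho> \<in> linf \<Omega>" "AE x in lebesgue_on \<Omega>. 0 < \<rho> x"
  shows "semi_inner (l2 \<Omega>) (mass_form \<Omega> \<rho>)"
proof
  show "subspace (l2 \<Omega>)" by (rule subspace_l2)
  fix f g h assume f: "f \<in> l2 \<Omega>" and g: "g \<in> l2 \<Omega>" and h: "h \<in> l2 \<Omega>"
  show "mass_form \<Omega> \<rho> (f + g) h = mass_form \<Omega> \<rho> f h + mass_form \<Omega> \<rho> g h"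
    using l2_inner_add[OF l2_linf_mult[OF rho(1) f] l2_linf_mult[OF rho(1) g] h]
    by (simp add: mass_form_def distrib_left)
next
  fix f h :: "real^'a \<Rightarrow> real" and c assume f: "f \<in> l2 \<Omega>" and h: "h \<in> l2 \<Omega>"
  show "mass_form \<Omega> \<rho> (c *\<^sub>R f) h = c * mass_form \<Omega> \<rho> f h"
    unfolding mass_form_def l2_inner_scale[symmetric] by (simp add: mult_ac)
  show "mass_form \<Omega> \<rho> f h = mass_form \<Omega> \<rho> h f"
    by (simp add: mass_form_def l2_inner_def mult_ac)
next
  fix f assume "f \<in> l2 \<Omega>"
  show "0 \<le> mass_form \<Omega> \<rho> f f"
    unfolding mass_form_def l2_inner_def
  proof (rule integral_nonneg_AE)
    show "AE x in lebesgue_on \<Omega>. 0 \<le> \<rho> x * f x * f x"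
      using rho(2) by eventually_elim (simp add: mult.assoc)
  qed
qed

lemma mass_norm_eq:
  assumes rho: "\<rho> \<in> linf \<Omega>" "AE x in lebesgue_on \<Omega>. 0 < \<rho> x" and f: "f \<in> l2 \<Omega>"
  shows "l2_norm \<Omega> (\<lambda>x. sqrt (\<rho> x) * f x) = form_norm (mass_form \<Omega> \<rho>) f"
proof -
  have m: "\<rho> \<in> borel_measurable (lebesgue_on \<Omega>)" "f \<in> borel_measurable (lebesgue_on \<Omega>)"
    using rho f by (auto simp: linf_def l2_def)
  have "(LINT x|lebesgue_on \<Omega>. (sqrt (\<rho> x) * f x) * (sqrt (\<rho> x) * f x))
      = (LINT x|lebesgue_on \<Omega>. \<rho> x * f x * f x)"
  proof (rule integral_cong_AE)
    show "AE x in lebesgue_on \<Omega>. sqrt (\<rho> x) * f x * (sqrt (\<rho> x) * f x) = \<rho> x * f x * f x"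
      using rho(2)
    proof eventually_elim
      case (elim x)
      then have "sqrt (\<rho> x) * sqrt (\<rho> x) = \<rho> x" by simp
      then show ?case by (metis mult.assoc mult.left_commute)
    qed
  qed (use m in measurable)
  then show ?thesis by (simp add: l2_norm_def form_norm_def mass_form_def l2_inner_def)
qed

lemma ae_zero_mass_norm: "ae_zero \<Omega> f \<Longrightarrow> form_norm (mass_form \<Omega> \<rho>) f = 0"
  unfolding form_norm_def mass_form_def l2_inner_def ae_zero_def
  by (subst integral_eq_zero_AE) (auto elim!: eventually_mono)

lemma mass_norm_le_l2_norm:
  assumes rho: "\<rho> \<in> linf \<Omega>"
  shows "\<exists>R\<ge>0. \<forall>f\<in>l2 \<Omega>. form_norm (mass_form \<Omega> \<rho>) f \<le> R * l2_norm \<Omega> f"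
proof -
  obtain C where C: "AE x in lebesgue_on \<Omega>. \<bar>\<rho> x\<bar> \<le> C" using rho by (auto simp: linf_def)
  have "form_norm (mass_form \<Omega> \<rho>) f \<le> sqrt \<bar>C\<bar> * l2_norm \<Omega> f" if f: "f \<in> l2 \<Omega>" for f
  proof -
    have i: "integrable (lebesgue_on \<Omega>) (\<lambda>x. f x * f x)" using l2_mult_integrable[OF f f] .
    have "(LINT x|lebesgue_on \<Omega>. \<rho> x * f x * f x) \<le> (LINT x|lebesgue_on \<Omega>. \<bar>C\<bar> * (f x * f x))"
    proof (rule integral_mono_AE)
      show "integrable (lebesgue_on \<Omega>) (\<lambda>x. \<rho> x * f x * f x)"
        using linf_mult_integrable[OF rho i] by (simp add: mult.assoc)
      show "integrable (lebesgue_on \<Omega>) (\<lambda>x. \<bar>C\<bar> * (f x * f x))" using i by simp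
      show "AE x in lebesgue_on \<Omega>. \<rho> x * f x * f x \<le> \<bar>C\<bar> * (f x * f x)"
        using C by eventually_elim (simp add: mult.assoc mult_right_mono)
    qed
    then have "mass_form \<Omega> \<rho> f f \<le> \<bar>C\<bar> * l2_inner \<Omega> f f" by (simp add: mass_form_def l2_inner_def)
    then have "sqrt (mass_form \<Omega> \<rho> f f) \<le> sqrt (\<bar>C\<bar> * l2_inner \<Omega> f f)" by (rule real_sqrt_le_mono)
    then show ?thesis by (simp add: form_norm_def l2_norm_def real_sqrt_mult)
  qed
  then show ?thesis by (intro exI[of _ "sqrt \<bar>C\<bar>"]) simp
qed

lemma l2_norm_le_sobolev_norm:
  assumes D: "open D" and f: "f \<in> sobolev D m"
  shows "l2_norm D f \<le> sobolev_norm D m f"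
proof -
  have "l2_inner D (weak_deriv D [] f) (weak_deriv D [] f) = l2_inner D f f"
    unfolding l2_inner_def
  proof (rule integral_cong_AE)
    show "AE x in lebesgue_on D. weak_deriv D [] f x * weak_deriv D [] f x = f x * f x"
      using weak_deriv_Nil[OF D f] by eventually_elim simp
  qed (use weak_deriv_works(2)[OF D f, of "[]"] sobolev_l2[OF f] in \<open>auto simp: l2_def\<close>)
  then have eq: "l2_norm D (weak_deriv D [] f) = l2_norm D f" by (simp add: l2_norm_def)
  have "(l2_norm D (weak_deriv D [] f))\<^sup>2 \<le> (\<Sum>\<alpha> | length \<alpha> \<le> m. (l2_norm D (weak_deriv D \<alpha> f))\<^sup>2)"
    by (intro member_le_sum) (auto simp: finite_lists_bounded)
  then have "sqrt ((l2_norm D f)\<^sup>2) \<le> sobolev_norm D m f"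
    unfolding eq sobolev_norm_def by (rule real_sqrt_le_mono)
  then show ?thesis by simp
qed

text \<open>Coercivity bounds the norm of \<open>V\<close> by the energy, and that norm is equivalent to the Sobolev
norm, of which the \<open>L\<^sup>2\<close> norm is a part.\<close>

lemma Poincare_energy:
  assumes \<Omega>: "open \<Omega>" and V: "standard_sobolev_space \<Omega> m V normV" and a: "bounded_coercive_on V normV a"
  shows "\<exists>\<gamma>\<ge>0. \<forall>v\<in>V. l2_norm \<Omega> v \<le> \<gamma> * form_norm a v"
proof -
  obtain c C where c: "0 < c" "\<And>v. v \<in> V \<Longrightarrow> c * sobolev_norm \<Omega> m v \<le> normV v"
    and sub: "V \<subseteq> sobolev \<Omega> m" and nrm: "is_norm_on \<Omega> V normV"
    using V unfolding standard_sobolev_space_def by blast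
  obtain C' where C': "0 < C'" "\<And>v. v \<in> V \<Longrightarrow> (normV v)\<^sup>2 \<le> C' * a v v"
    using a unfolding bounded_coercive_on_def by blast
  have "l2_norm \<Omega> v \<le> (sqrt C' / c) * form_norm a v" if v: "v \<in> V" for v
  proof -
    have "0 \<le> normV v" using nrm v by (simp add: is_norm_on_def)
    then have "normV v = sqrt ((normV v)\<^sup>2)" by simp
    also have "\<dots> \<le> sqrt (C' * a v v)" using C'(2)[OF v] by (rule real_sqrt_le_mono)
    finally have "normV v \<le> sqrt C' * form_norm a v" by (simp add: form_norm_def real_sqrt_mult)
    moreover have "c * l2_norm \<Omega> v \<le> normV v"
      using l2_norm_le_sobolev_norm[OF \<Omega>, of v m] sub v c
      by (meson mult_le_cancel_left_pos order_trans subsetD)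
    ultimately have "c * l2_norm \<Omega> v \<le> sqrt C' * form_norm a v" by linarith
    then show ?thesis using c by (simp add: field_simps)
  qed
  then show ?thesis using c C' by (intro exI[of _ "sqrt C' / c"]) auto
qed

lemma l2_Cauchy_converges:
  assumes f: "\<And>k. f k \<in> l2 \<Omega>" and C: "form_Cauchy (l2_inner \<Omega>) f"
  shows "\<exists>z\<in>l2 \<Omega>. (\<lambda>k. l2_norm \<Omega> (f k - z)) \<longlonglongrightarrow> 0"
proof -
  interpret semi_inner "l2 \<Omega>" "l2_inner \<Omega>" by (rule semi_inner_l2)
  have sq: "(form_norm (l2_inner \<Omega>) (g - h))\<^sup>2 = (LINT x|lebesgue_on \<Omega>. (g x - h x)\<^sup>2)"
    if "g \<in> l2 \<Omega>" "h \<in> l2 \<Omega>" for g h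
    using norm_square[of "g - h"] that by (simp add: l2_inner_def power2_eq_square)
  have "\<exists>z\<in>borel_measurable (lebesgue_on \<Omega>). (\<forall>k. integrable (lebesgue_on \<Omega>) (\<lambda>x. (f k x - z x)\<^sup>2)) \<and>
    (\<lambda>k. LINT x|lebesgue_on \<Omega>. (f k x - z x)\<^sup>2) \<longlonglongrightarrow> 0"
  proof (rule L2_complete)
    show "f k \<in> borel_measurable (lebesgue_on \<Omega>)" for k using f by (simp add: l2_def)
    have "f m - f n \<in> l2 \<Omega>" for m n using f by simp
    then show "integrable (lebesgue_on \<Omega>) (\<lambda>x. (f m x - f n x)\<^sup>2)" for m n
      by (simp add: l2_def)
    fix e :: real assume e: "0 < e"
    then obtain K where K: "\<And>m n. \<lbrakk>K \<le> m; K \<le> n\<rbrakk> \<Longrightarrow> form_norm (l2_inner \<Omega>) (f m - f n) < sqrt e"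
      using C unfolding form_Cauchy_def by (meson real_sqrt_gt_0_iff)
    have "(LINT x|lebesgue_on \<Omega>. (f m x - f n x)\<^sup>2) < e" if "K \<le> m" "K \<le> n" for m n
    proof -
      have "(form_norm (l2_inner \<Omega>) (f m - f n))\<^sup>2 < (sqrt e)\<^sup>2"
        using K[OF that] f by (intro power_strict_mono) auto
      then show ?thesis using e sq[OF f f, of m n] by simp
    qed
    then show "\<exists>K. \<forall>m\<ge>K. \<forall>n\<ge>K. (LINT x|lebesgue_on \<Omega>. (f m x - f n x)\<^sup>2) < e" by blast
  qed
  then obtain z where z: "z \<in> borel_measurable (lebesgue_on \<Omega>)"
    "\<And>k. integrable (lebesgue_on \<Omega>) (\<lambda>x. (f k x - z x)\<^sup>2)"
    "(\<lambda>k. LINT x|lebesgue_on \<Omega>. (f k x - z x)\<^sup>2) \<longlonglongrightarrow> 0" by blast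
  have "f 0 - z \<in> l2 \<Omega>" using z f[of 0] by (auto simp: l2_def fun_diff_def)
  then have "f 0 - (f 0 - z) \<in> l2 \<Omega>" using X_simps(3)[OF f[of 0]] by blast
  then have zl: "z \<in> l2 \<Omega>" by simp
  have "(\<lambda>k. sqrt (LINT x|lebesgue_on \<Omega>. (f k x - z x)\<^sup>2)) \<longlonglongrightarrow> sqrt 0"
    by (intro tendsto_real_sqrt z)
  moreover have "l2_norm \<Omega> (f k - z) = sqrt (LINT x|lebesgue_on \<Omega>. (f k x - z x)\<^sup>2)" for k
    by (simp add: l2_norm_def l2_inner_def power2_eq_square)
  ultimately show ?thesis using zl by (intro bexI[of _ z]) simp_all
qed

lemma frac_seminorm_le: "frac_seminorm \<Omega> m s f \<le> frac_norm \<Omega> m s f"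
  by (simp add: frac_norm_def real_le_rsqrt)

lemma frac_seminorm_nonneg: "0 \<le> frac_seminorm \<Omega> m s f"
  by (auto simp: frac_seminorm_def sobolev_seminorm_def slobodeckij_def split_beta
      intro!: sum_nonneg Bochner_Integration.integral_nonneg)

lemma fun_sum_eq: "fun_sum S T = {f + g | f g. f \<in> S \<and> g \<in> T}"
  by (simp add: fun_sum_def plus_fun_def)

lemma mesh_size_nonneg:
  assumes "lipschitz_domain \<Omega>" and tri: "fe_triangulation \<Omega> \<T>"
  shows "0 \<le> mesh_size \<T>"
proof -
  have "closure \<Omega> \<noteq> {}" using assms(1) by (simp add: lipschitz_domain_def)
  moreover have "\<Union>\<T> = closure \<Omega>" using tri by (simp add: fe_triangulation_def)
  ultimately obtain K where K: "K \<in> \<T>" by (metis Sup_empty ex_in_conv)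
  have "0 \<le> diameter K" using element_convex_compact(2)[OF tri K] by (simp add: diameter_ge_0 compact_imp_bounded)
  also have "\<dots> \<le> mesh_size \<T>"
    unfolding mesh_size_def using tri K by (intro Max_ge) (auto simp: fe_triangulation_def)
  finally show ?thesis .
qed

section \<open>The finite element discretisations as Galerkin approximations\<close>

text \<open>The setting of the theorem except for the exact eigenfunctions.\<close>

locale fe_problem =
  fixes \<Omega> :: "(real^'n) set" and m :: nat
    and V :: "(real^'n \<Rightarrow> real) set" and normV :: "(real^'n \<Rightarrow> real) \<Rightarrow> real"
    and \<kappa> :: "'n list \<Rightarrow> 'n list \<Rightarrow> real^'n \<Rightarrow> real" and \<rho> :: "real^'n \<Rightarrow> real"
    and a :: "(real^'n \<Rightarrow> real) \<Rightarrow> (real^'n \<Rightarrow> real) \<Rightarrow> real"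
    and \<T> :: "'i \<Rightarrow> (real^'n) set set" and Vh :: "'i \<Rightarrow> (real^'n \<Rightarrow> real) set"
    and ah :: "'i \<Rightarrow> (real^'n \<Rightarrow> real) \<Rightarrow> (real^'n \<Rightarrow> real) \<Rightarrow> real"
    and N :: "'i \<Rightarrow> nat" and lamh :: "'i \<Rightarrow> nat \<Rightarrow> real" and uh :: "'i \<Rightarrow> nat \<Rightarrow> real^'n \<Rightarrow> real"
    and s :: real
  assumes dom: "lipschitz_domain \<Omega>"
    and V: "standard_sobolev_space \<Omega> m V normV"
    and rho: "\<rho> \<in> linf \<Omega>" "AE x in lebesgue_on \<Omega>. 0 < \<rho> x"
    and a_def: "a = form_on m \<kappa> \<Omega>" and coefficients: "bounded_coefficients m \<kappa> \<Omega>"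
    and a: "bounded_coercive_on V normV a"
    and mesh: "\<And>h. fe_triangulation \<Omega> (\<T> h)"
    and Vh: "\<And>h. fe_space \<Omega> m (\<T> h) (Vh h)"
    and ah_def: "\<And>h. ah h = piecewise_form m \<kappa> (\<T> h)"
    and eigen_h: "\<And>h. discrete_eigen_system \<Omega> \<rho> (ah h) (Vh h) (N h) (lamh h) (uh h)"
    and s: "0 < s"
    and regularity: "elliptic_regularity \<Omega> m \<rho> a V s"
    and H1: "cond_H1 \<Omega> V Vh ah"
    and H2: "cond_H2 \<Omega> m V \<T> Vh ah s"
    and H3: "cond_H3 \<Omega> m a V \<T> Vh ah s"
begin

abbreviation "b \<equiv> mass_form \<Omega> \<rho>"

lemma \<Omega>: "open \<Omega>"
  using dom by (simp add: lipschitz_domain_def)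

lemma V_sobolev: "v \<in> V \<Longrightarrow> v \<in> sobolev \<Omega> m"
  using V by (auto simp: standard_sobolev_space_def)

lemma V_subspace: "subspace V" and Vh_subspace: "subspace (Vh h)"
  using V Vh[of h] by (simp_all add: standard_sobolev_space_def fe_space_def fun_subspace_iff)

lemma V_subset: "V \<subseteq> fun_sum V (Vh h)" and Vh_subset: "Vh h \<subseteq> fun_sum V (Vh h)"
proof -
  have "f \<in> fun_sum V (Vh h)" if "f \<in> V" for f
    using that subspace_0[OF Vh_subspace[of h]] unfolding fun_sum_eq
    by (intro CollectI exI[of _ f] exI[of _ 0]) simp
  moreover have "f \<in> fun_sum V (Vh h)" if "f \<in> Vh h" for f
    using that subspace_0[OF V_subspace] unfolding fun_sum_eq
    by (intro CollectI exI[of _ 0] exI[of _ f]) simp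
  ultimately show "V \<subseteq> fun_sum V (Vh h)" "Vh h \<subseteq> fun_sum V (Vh h)" by blast+
qed

lemma sum_subspace: "subspace (fun_sum V (Vh h))"
  using subspace_sums[OF V_subspace Vh_subspace] by (simp add: fun_sum_eq)

lemma sum_sobolev: "\<lbrakk>f \<in> fun_sum V (Vh h); K \<in> \<T> h\<rbrakk> \<Longrightarrow> f \<in> sobolev (interior K) m"
proof -
  assume f: "f \<in> fun_sum V (Vh h)" and K: "K \<in> \<T> h"
  obtain v w where vw: "v \<in> V" "w \<in> Vh h" "f = v + w" using f by (auto simp: fun_sum_eq)
  have "v \<in> sobolev (interior K) m"
    using sobolev_mono[OF element_interior_subset[OF dom mesh K] open_lebesgue[OF open_interior]
        open_lebesgue[OF \<Omega>] V_sobolev[OF vw(1)]] .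
  moreover have "w \<in> sobolev (interior K) m" using Vh[of h] vw K by (auto simp: fe_space_def)
  ultimately show ?thesis
    unfolding vw by (intro subspace_add subspace_sobolev open_interior)
qed

lemma sum_l2: "fun_sum V (Vh h) \<subseteq> l2 \<Omega>"
  using l2_from_elements[OF dom mesh[of h]] sobolev_l2 sum_sobolev by blast

lemma V_l2: "V \<subseteq> l2 \<Omega>"
  using V_sobolev sobolev_l2 by blast

lemma energy_semi_inner: "semi_inner (fun_sum V (Vh h)) (ah h)"
proof
  fix f g v :: "real^'n \<Rightarrow> real" and c :: real
  assume f: "f \<in> fun_sum V (Vh h)" and v: "v \<in> fun_sum V (Vh h)"
  show "ah h (c *\<^sub>R f) v = c * ah h f v"
    using piecewise_form_linear(2)[OF dom mesh coefficients sum_sobolev[OF f] sum_sobolev[OF f] sum_sobolev[OF v]]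
    by (simp add: ah_def scaleR_fun_def)
  show "ah h f v = ah h v f" using H1 f v by (simp add: cond_H1_def symmetric_on_def)
  show "0 \<le> ah h f f" using H1 f by (simp add: cond_H1_def)
  assume g: "g \<in> fun_sum V (Vh h)"
  show "ah h (f + g) v = ah h f v + ah h g v"
    using piecewise_form_linear(1)[OF dom mesh coefficients sum_sobolev[OF f] sum_sobolev[OF g] sum_sobolev[OF v]]
    by (simp add: ah_def plus_fun_def)
qed (rule sum_subspace)

lemma ah_eq_a: "\<lbrakk>u \<in> V; v \<in> V\<rbrakk> \<Longrightarrow> ah h u v = a u v"
  unfolding ah_def a_def
  using form_on_elements[OF dom mesh coefficients V_sobolev V_sobolev] by simp

text \<open>The infimum in (H2) need not be attained, hence the slack \<open>e\<close>.\<close>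

lemma approximation_bound:
  "\<exists>C>0. \<forall>h. \<forall>v \<in> V \<inter> frac_sobolev \<Omega> m s. \<forall>e>0. \<exists>w\<in>Vh h.
    form_norm (ah h) (v - w) \<le> C * mesh_size (\<T> h) powr s * frac_seminorm \<Omega> m s v + e"
proof -
  obtain C where C: "0 < C" "\<And>h v. v \<in> V \<inter> frac_sobolev \<Omega> m s \<Longrightarrow>
      (INF vh \<in> Vh h. energy_norm (ah h) (\<lambda>x. v x - vh x)) \<le> C * mesh_size (\<T> h) powr s * frac_seminorm \<Omega> m s v"
    using H2 unfolding cond_H2_def by blast
  have "\<exists>w\<in>Vh h. form_norm (ah h) (v - w) \<le> C * mesh_size (\<T> h) powr s * frac_seminorm \<Omega> m s v + e"
    if v: "v \<in> V \<inter> frac_sobolev \<Omega> m s" and e: "0 < e" for h v e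
  proof -
    have "(INF vh \<in> Vh h. energy_norm (ah h) (\<lambda>x. v x - vh x))
        < C * mesh_size (\<T> h) powr s * frac_seminorm \<Omega> m s v + e"
      using C(2)[OF v, of h] e by linarith
    then obtain y where "y \<in> (\<lambda>vh. energy_norm (ah h) (\<lambda>x. v x - vh x)) ` Vh h"
        "y < C * mesh_size (\<T> h) powr s * frac_seminorm \<Omega> m s v + e"
      using cInf_lessD[of "(\<lambda>vh. energy_norm (ah h) (\<lambda>x. v x - vh x)) ` Vh h"]
        subspace_0[OF Vh_subspace[of h]] by blast
    then show ?thesis by (auto simp: energy_norm_form_norm fun_diff_def intro!: less_imp_le)
  qed
  with C(1) show ?thesis by blast
qed

text \<open>(H3) bounds a quotient from above and only for \<open>w\<close> that do not vanish almost everywhere. The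
absolute value is obtained by replacing \<open>w\<close> by \<open>-w\<close>; for vanishing \<open>w\<close> both terms on the left are
zero, the first one by the Cauchy--Schwarz inequality for \<open>a\<^sub>h\<close>.\<close>

lemma consistency_bound:
  "\<exists>C>0. \<forall>h. \<forall>v \<in> V \<inter> frac_sobolev \<Omega> m s. \<forall>g. represents_A \<Omega> a V v g \<longrightarrow> (\<forall>w\<in>Vh h.
    \<bar>ah h v w - l2_inner \<Omega> g w\<bar> \<le> C * mesh_size (\<T> h) powr s * frac_seminorm \<Omega> m s v * form_norm (ah h) w)"
proof -
  obtain C where C: "0 < C" "\<And>h v g. \<lbrakk>v \<in> V \<inter> frac_sobolev \<Omega> m s; represents_A \<Omega> a V v g\<rbrakk> \<Longrightarrow>
      (SUP vh \<in> {vh \<in> Vh h. \<not> ae_zero \<Omega> vh}.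
         ereal ((ah h v vh - l2_inner \<Omega> g vh) / energy_norm (ah h) vh))
        \<le> ereal (C * mesh_size (\<T> h) powr s * frac_seminorm \<Omega> m s v)"
    using H3 unfolding cond_H3_def by blast
  have "\<bar>ah h v w - l2_inner \<Omega> g w\<bar> \<le> C * mesh_size (\<T> h) powr s * frac_seminorm \<Omega> m s v * form_norm (ah h) w"
    if v: "v \<in> V \<inter> frac_sobolev \<Omega> m s" and g: "represents_A \<Omega> a V v g" and w: "w \<in> Vh h" for h v g w
  proof -
    interpret E: semi_inner "fun_sum V (Vh h)" "ah h" by (rule energy_semi_inner)
    define B where "B = C * mesh_size (\<T> h) powr s * frac_seminorm \<Omega> m s v"
    have vX: "v \<in> fun_sum V (Vh h)" using v V_subset by blast
    have pos: "form_norm (ah h) w = 0 \<longleftrightarrow> ae_zero \<Omega> w" if "w \<in> Vh h" for w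
      using H1 that by (simp add: cond_H1_def is_norm_on_def energy_norm_form_norm)
    show ?thesis
    proof (cases "ae_zero \<Omega> w")
      case True
      then have "form_norm (ah h) w = 0" using pos w by simp
      moreover from this have "ah h v w = 0"
        using E.Cauchy_Schwarz[of v w] vX w Vh_subset[of h] by auto
      moreover have "l2_inner \<Omega> g w = 0"
        using True unfolding l2_inner_def ae_zero_def
        by (intro integral_eq_zero_AE) (auto elim!: eventually_mono)
      ultimately show ?thesis by simp
    next
      case False
      have one: "ah h v y - l2_inner \<Omega> g y \<le> B * form_norm (ah h) y"
        if y: "y \<in> Vh h" "\<not> ae_zero \<Omega> y" for y
      proof -
        have "ereal ((ah h v y - l2_inner \<Omega> g y) / form_norm (ah h) y)
            \<le> (SUP vh \<in> {vh \<in> Vh h. \<not> ae_zero \<Omega> vh}.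
               ereal ((ah h v vh - l2_inner \<Omega> g vh) / form_norm (ah h) vh))"
          using y by (intro SUP_upper) simp
        also have "\<dots> \<le> ereal B"
          using C(2)[OF v g, of h] by (simp only: B_def energy_norm_form_norm)
        finally have "(ah h v y - l2_inner \<Omega> g y) / form_norm (ah h) y \<le> B" by simp
        moreover have "0 \<le> form_norm (ah h) y" using y Vh_subset[of h] by auto
        then have "0 < form_norm (ah h) y" using pos y by (simp add: order_le_less)
        ultimately show ?thesis by (simp add: pos_divide_le_eq)
      qed
      have wX: "w \<in> fun_sum V (Vh h)" using w Vh_subset by blast
      have "(-1) *\<^sub>R w \<in> Vh h" using w Vh_subspace by (rule subspace_scale[rotated])
      moreover have "\<not> ae_zero \<Omega> ((-1) *\<^sub>R w)" using False by (simp add: ae_zero_def)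
      ultimately have neg: "ah h v ((-1) *\<^sub>R w) - l2_inner \<Omega> g ((-1) *\<^sub>R w)
          \<le> B * form_norm (ah h) ((-1) *\<^sub>R w)"
        by (rule one)
      have "ah h v ((-1) *\<^sub>R w) = - ah h v w"
        using E.scale_right[OF wX vX, of "-1"] by simp
      moreover have "l2_inner \<Omega> g ((-1) *\<^sub>R w) = - l2_inner \<Omega> g w"
        by (simp add: l2_inner_def)
      moreover have "form_norm (ah h) ((-1) *\<^sub>R w) = form_norm (ah h) w"
        using E.norm_scale[OF wX, of "-1"] by simp
      ultimately have "- ah h v w - - l2_inner \<Omega> g w \<le> B * form_norm (ah h) w"
        using neg by (simp only:)
      then show ?thesis using one[OF w False] unfolding B_def[symmetric] by linarith
    qed
  qed
  with C(1) show ?thesis by blast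
qed

text \<open>Regularity provides \<open>T\<close> and bounds the seminorm of \<open>T f\<close> by the mass norm of \<open>f\<close>; therefore (H2)
and (H3) become the assumptions of \<open>galerkin\<close> with \<open>\<eta> = C h\<^sup>s\<close>. The constant \<open>C'\<close> is for
estimates in terms of the seminorm of a particular solution. In the completeness property, only
the images under \<open>T\<close> are claimed to converge: as \<open>\<rho>\<close> may come arbitrarily close to zero, a Cauchy
sequence for the mass form need not have a limit in \<open>L\<^sup>2\<close>, but \<open>T\<close> maps it to a Cauchy sequence
for the ordinary \<open>L\<^sup>2\<close> norm.\<close>

lemma galerkin_family:
  obtains T \<gamma> C C' where "0 \<le> C" "0 < C'"
    and "\<And>h. galerkin (l2 \<Omega>) b (fun_sum V (Vh h)) (ah h) V (Vh h) T \<gamma>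
      (C * mesh_size (\<T> h) powr s) (N h) (lamh h) (uh h)"
    and "\<And>f. \<lbrakk>\<And>k. f k \<in> l2 \<Omega>; form_Cauchy b f\<rbrakk>
      \<Longrightarrow> \<exists>z\<in>l2 \<Omega>. (\<lambda>k::nat. form_norm b (T (f k) - z)) \<longlonglongrightarrow> 0"
    and "\<And>h v e. \<lbrakk>v \<in> V \<inter> frac_sobolev \<Omega> m s; 0 < e\<rbrakk> \<Longrightarrow> \<exists>w\<in>Vh h.
      form_norm (ah h) (v - w) \<le> C' * mesh_size (\<T> h) powr s * frac_seminorm \<Omega> m s v + e"
    and "\<And>h v f w. \<lbrakk>v \<in> V \<inter> frac_sobolev \<Omega> m s; f \<in> l2 \<Omega>; \<And>v'. v' \<in> V \<Longrightarrow> a v v' = b f v'; w \<in> Vh h\<rbrakk> \<Longrightarrow>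
      \<bar>ah h v w - b f w\<bar> \<le> C' * mesh_size (\<T> h) powr s * frac_seminorm \<Omega> m s v * form_norm (ah h) w"
proof -
  interpret M: semi_inner "l2 \<Omega>" b by (rule semi_inner_mass[OF rho])
  interpret E: semi_inner "fun_sum V (Vh h)" "ah h" for h by (rule energy_semi_inner)
  interpret L: semi_inner "l2 \<Omega>" "l2_inner \<Omega>" by (rule semi_inner_l2)
  obtain C2 where C2: "0 < C2" "\<And>h v e. \<lbrakk>v \<in> V \<inter> frac_sobolev \<Omega> m s; 0 < e\<rbrakk> \<Longrightarrow> \<exists>w\<in>Vh h.
      form_norm (ah h) (v - w) \<le> C2 * mesh_size (\<T> h) powr s * frac_seminorm \<Omega> m s v + e"
    using approximation_bound by blast
  obtain C3 where C3: "0 < C3" "\<And>h v g w. \<lbrakk>v \<in> V \<inter> frac_sobolev \<Omega> m s; represents_A \<Omega> a V v g; w \<in> Vh h\<rbrakk> \<Longrightarrow>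
      \<bar>ah h v w - l2_inner \<Omega> g w\<bar> \<le> C3 * mesh_size (\<T> h) powr s * frac_seminorm \<Omega> m s v * form_norm (ah h) w"
    using consistency_bound by blast
  define C' where "C' = max C2 C3"
  have C': "0 < C'" "C2 \<le> C'" "C3 \<le> C'" using C2 C3 by (auto simp: C'_def)
  have p0: "0 \<le> mesh_size (\<T> h) powr s * frac_seminorm \<Omega> m s v" for h v
    using frac_seminorm_nonneg by (intro mult_nonneg_nonneg) auto
  have app: "\<exists>w\<in>Vh h. form_norm (ah h) (v - w) \<le> C' * mesh_size (\<T> h) powr s * frac_seminorm \<Omega> m s v + e"
    if v: "v \<in> V \<inter> frac_sobolev \<Omega> m s" "0 < e" for h v e
  proof -
    obtain w where "w \<in> Vh h" "form_norm (ah h) (v - w) \<le> C2 * mesh_size (\<T> h) powr s * frac_seminorm \<Omega> m s v + e"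
      using C2(2)[OF v] by blast
    moreover have "C2 * mesh_size (\<T> h) powr s * frac_seminorm \<Omega> m s v
        \<le> C' * mesh_size (\<T> h) powr s * frac_seminorm \<Omega> m s v"
      using mult_right_mono[OF C'(2) p0[of h v]] by (simp add: mult.assoc)
    ultimately show ?thesis by force
  qed
  have con: "\<bar>ah h v w - b f w\<bar> \<le> C' * mesh_size (\<T> h) powr s * frac_seminorm \<Omega> m s v * form_norm (ah h) w"
    if v: "v \<in> V \<inter> frac_sobolev \<Omega> m s" and f: "f \<in> l2 \<Omega>" "\<And>v'. v' \<in> V \<Longrightarrow> a v v' = b f v'" and w: "w \<in> Vh h"
    for h v f w
  proof -
    have "represents_A \<Omega> a V v (\<lambda>x. \<rho> x * f x)"
      using f l2_linf_mult[OF rho(1) f(1)] by (simp add: represents_A_def mass_form_def)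
    from C3(2)[OF v this w] have "\<bar>ah h v w - b f w\<bar>
        \<le> C3 * mesh_size (\<T> h) powr s * frac_seminorm \<Omega> m s v * form_norm (ah h) w"
      by (simp add: mass_form_def)
    also have "\<dots> \<le> C' * mesh_size (\<T> h) powr s * frac_seminorm \<Omega> m s v * form_norm (ah h) w"
    proof (rule mult_right_mono)
      show "C3 * mesh_size (\<T> h) powr s * frac_seminorm \<Omega> m s v
          \<le> C' * mesh_size (\<T> h) powr s * frac_seminorm \<Omega> m s v"
        using mult_right_mono[OF C'(3) p0[of h v]] by (simp add: mult.assoc)
      show "0 \<le> form_norm (ah h) w" using w Vh_subset[of h] by auto
    qed
    finally show ?thesis .
  qed
  obtain C1 where C1: "0 < C1" "\<forall>f \<in> l2 \<Omega>. \<exists>w \<in> V \<inter> frac_sobolev \<Omega> m s.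
        (\<forall>v \<in> V. a w v = l2_inner \<Omega> (\<lambda>x. \<rho> x * f x) v) \<and>
        frac_norm \<Omega> m s w \<le> C1 * l2_norm \<Omega> (\<lambda>x. sqrt (\<rho> x) * f x)"
    using regularity unfolding elliptic_regularity_def by (elim exE conjE)
  obtain T where T0: "\<forall>f \<in> l2 \<Omega>. T f \<in> V \<inter> frac_sobolev \<Omega> m s \<and>
        (\<forall>v \<in> V. a (T f) v = l2_inner \<Omega> (\<lambda>x. \<rho> x * f x) v) \<and>
        frac_norm \<Omega> m s (T f) \<le> C1 * l2_norm \<Omega> (\<lambda>x. sqrt (\<rho> x) * f x)"
    using C1(2) unfolding Bex_def by (elim bchoice[THEN exE]) blast
  have T: "T f \<in> V \<inter> frac_sobolev \<Omega> m s" "\<And>v. v \<in> V \<Longrightarrow> a (T f) v = b f v"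
      "frac_norm \<Omega> m s (T f) \<le> C1 * form_norm b f" if f: "f \<in> l2 \<Omega>" for f
    using bspec[OF T0 f] mass_norm_eq[OF rho f] by (simp_all add: mass_form_def)
  have T_semi: "frac_seminorm \<Omega> m s (T f) \<le> C1 * form_norm b f" if "f \<in> l2 \<Omega>" for f
    using T(3)[OF that] frac_seminorm_le[of \<Omega> m s "T f"] by linarith
  obtain \<gamma>' where \<gamma>': "0 \<le> \<gamma>'" "\<And>v. v \<in> V \<Longrightarrow> l2_norm \<Omega> v \<le> \<gamma>' * form_norm a v"
    using Poincare_energy[OF \<Omega> V a] by blast
  obtain R where R: "0 \<le> R" "\<And>f. f \<in> l2 \<Omega> \<Longrightarrow> form_norm b f \<le> R * l2_norm \<Omega> f"
    using mass_norm_le_l2_norm[OF rho(1)] by blast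
  have nah: "form_norm (ah h) v = form_norm a v" if "v \<in> V" for h v
    using ah_eq_a[OF that that] by (simp add: form_norm_def)
  let ?G = "\<lambda>h. galerkin (l2 \<Omega>) b (fun_sum V (Vh h)) (ah h) V (Vh h) T (R * \<gamma>')
      (C' * C1 * mesh_size (\<T> h) powr s) (N h) (lamh h) (uh h)"
  have G: "?G h" for h
  proof
    have Ts: "C' * mesh_size (\<T> h) powr s * frac_seminorm \<Omega> m s (T f)
        \<le> C' * C1 * mesh_size (\<T> h) powr s * form_norm b f" if f: "f \<in> l2 \<Omega>" for f
      using mult_left_mono[OF T_semi[OF f], of "C' * mesh_size (\<T> h) powr s"] C' by (simp add: mult_ac)
    show "fun_sum V (Vh h) \<subseteq> l2 \<Omega>" "V \<subseteq> fun_sum V (Vh h)" "Vh h \<subseteq> fun_sum V (Vh h)"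
      by (rule sum_l2 V_subset Vh_subset)+
    show "subspace V" "subspace (Vh h)" by (rule V_subspace Vh_subspace)+
    show "T f \<in> V" if "f \<in> l2 \<Omega>" for f using T that by blast
    show "ah h (T f) v = b f v" if "f \<in> l2 \<Omega>" "v \<in> V" for f v
      using T that ah_eq_a[of "T f" v h] by auto
    show "\<exists>w\<in>Vh h. form_norm (ah h) (T f - w) \<le> C' * C1 * mesh_size (\<T> h) powr s * form_norm b f + e"
      if f: "f \<in> l2 \<Omega>" and e: "0 < e" for f e
      using app[OF T(1)[OF f] e, of h] Ts[OF f] by force
    show "\<bar>ah h (T f) w - b f w\<bar> \<le> C' * C1 * mesh_size (\<T> h) powr s * form_norm b f * form_norm (ah h) w"
      if f: "f \<in> l2 \<Omega>" and w: "w \<in> Vh h" for f w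
    proof -
      have "0 \<le> form_norm (ah h) w" using w Vh_subset[of h] by auto
      then show ?thesis
        using con[OF T(1)[OF f] f T(2)[OF f] w] mult_right_mono[OF Ts[OF f]] by fastforce
    qed
    show "form_norm b v \<le> R * \<gamma>' * form_norm (ah h) v" if v: "v \<in> V" for v
      using R(2)[of v] mult_left_mono[OF \<gamma>'(2)[OF v] R(1)] v V_l2 by (auto simp: nah mult.assoc)
    show "0 \<le> R * \<gamma>'" using R \<gamma>' by simp
    show "0 \<le> C' * C1 * mesh_size (\<T> h) powr s" using C' C1 by simp
    have D: "has_dim \<Omega> (Vh h) (N h)" "\<And>i. i \<in> {1..N h} \<Longrightarrow> eigenpair \<Omega> \<rho> (ah h) (Vh h) (lamh h i) (uh h i)"
      "\<And>i. i \<in> {1..N h} \<Longrightarrow> 0 < lamh h i"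
      "\<And>i j. \<lbrakk>i \<in> {1..N h}; j \<in> {1..N h}; i \<le> j\<rbrakk> \<Longrightarrow> lamh h i \<le> lamh h j"
      "\<And>i j. \<lbrakk>i \<in> {1..N h}; j \<in> {1..N h}\<rbrakk> \<Longrightarrow> b (uh h i) (uh h j) = (if i = j then 1 else 0)"
      using eigen_h[of h] unfolding discrete_eigen_system_def mass_form_def by blast+
    show uW: "uh h j \<in> Vh h" if "j \<in> {1..N h}" for j
      using D(2)[OF that] by (simp add: eigenpair_def)
    show "ah h (uh h j) w = lamh h j * b (uh h j) w" if "j \<in> {1..N h}" "w \<in> Vh h" for j w
      using D(2)[OF that(1)] that(2) by (simp add: eigenpair_def mass_form_def)
    obtain e where e: "\<And>j. j \<in> {1..N h} \<Longrightarrow> e j \<in> Vh h"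
      "\<And>f. f \<in> Vh h \<Longrightarrow> \<exists>c. ae_zero \<Omega> (\<lambda>x. f x - (\<Sum>j=1..N h. c j * e j x))"
      using D(1) unfolding has_dim_def by blast
    show "form_norm b (w - (\<Sum>j=1..N h. b w (uh h j) *\<^sub>R uh h j)) = 0" if w: "w \<in> Vh h" for w
    proof (rule M.orthonormal_complete[where W="Vh h" and e=e])
      show "Vh h \<subseteq> l2 \<Omega>" using Vh_subset[of h] sum_l2[of h] by blast
      fix f assume "f \<in> Vh h"
      then obtain c where "ae_zero \<Omega> (\<lambda>x. f x - (\<Sum>j=1..N h. c j * e j x))" using e(2) by blast
      moreover have "(\<lambda>x. f x - (\<Sum>j=1..N h. c j * e j x)) = f - (\<Sum>j=1..N h. c j *\<^sub>R e j)"
        by (simp add: fun_eq_iff sum_fun_apply)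
      ultimately show "\<exists>c. form_norm b (f - (\<Sum>j=1..N h. c j *\<^sub>R e j)) = 0"
        using ae_zero_mass_norm by (metis (no_types, lifting))
    qed (use w e uW D Vh_subspace in auto)
  qed (use eigen_h[of h] in \<open>auto simp: discrete_eigen_system_def mass_form_def\<close>)
  have comp: "\<exists>z\<in>l2 \<Omega>. (\<lambda>k::nat. form_norm b (T (f k) - z)) \<longlonglongrightarrow> 0"
    if f: "\<And>k. f k \<in> l2 \<Omega>" and C: "form_Cauchy b f" for f
  proof -
    \<comment> \<open>Any index will do: \<open>T\<close> and the energy on \<open>V\<close> do not depend on it.\<close>
    obtain h :: 'i where True by blast
    interpret Gh: galerkin "l2 \<Omega>" b "fun_sum V (Vh h)" "ah h" V "Vh h" T "R * \<gamma>'"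
      "C' * C1 * mesh_size (\<T> h) powr s" "N h" "lamh h" "uh h" by (rule G)
    have diff: "l2_norm \<Omega> (T (f p) - T (f q)) \<le> \<gamma>' * (R * \<gamma>') * form_norm b (f p - f q)" for p q
    proof -
      have "T (f p) - T (f q) \<in> V" using T(1) f V_subspace by (intro subspace_diff) auto
      then have "l2_norm \<Omega> (T (f p) - T (f q)) \<le> \<gamma>' * form_norm (ah h) (T (f p) - T (f q))"
        using \<gamma>'(2) nah by simp
      also have "\<dots> \<le> \<gamma>' * (R * \<gamma>' * form_norm b (f p - f q))"
        using Gh.energy_T_diff[OF f f] \<gamma>' by (intro mult_left_mono) auto
      finally show ?thesis by (simp add: mult.assoc)
    qed
    have "form_Cauchy (l2_inner \<Omega>) (\<lambda>k. T (f k))"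
      unfolding form_Cauchy_def
    proof (intro allI impI)
      fix e :: real assume e: "0 < e"
      define D where "D = \<gamma>' * (R * \<gamma>') + 1"
      have D: "0 < D" using \<gamma>' R by (simp add: D_def add_nonneg_pos)
      obtain K where K: "\<And>p q. \<lbrakk>K \<le> p; K \<le> q\<rbrakk> \<Longrightarrow> form_norm b (f p - f q) < e / D"
        using C e D unfolding form_Cauchy_def by (meson divide_pos_pos)
      have "form_norm (l2_inner \<Omega>) (T (f p) - T (f q)) < e" if "K \<le> p" "K \<le> q" for p q
      proof -
        have "form_norm (l2_inner \<Omega>) (T (f p) - T (f q)) \<le> \<gamma>' * (R * \<gamma>') * form_norm b (f p - f q)"
          using diff[of p q] by (simp add: l2_norm_form_norm)
        also have "\<dots> \<le> D * form_norm b (f p - f q)"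
          using f by (intro mult_right_mono) (auto simp: D_def)
        also have "\<dots> < D * (e / D)" using K[OF that] D by (intro mult_strict_left_mono)
        finally show ?thesis using D by simp
      qed
      then show "\<exists>K. \<forall>p\<ge>K. \<forall>q\<ge>K. form_norm (l2_inner \<Omega>) (T (f p) - T (f q)) < e" by blast
    qed
    moreover have Tl2: "T (f k) \<in> l2 \<Omega>" for k using T(1)[OF f[of k]] V_l2 by blast
    ultimately obtain z where z: "z \<in> l2 \<Omega>" "(\<lambda>k. l2_norm \<Omega> (T (f k) - z)) \<longlonglongrightarrow> 0"
      using l2_Cauchy_converges[of "\<lambda>k. T (f k)" \<Omega>] by blast
    have "(\<lambda>k. form_norm b (T (f k) - z)) \<longlonglongrightarrow> 0"
    proof (rule Lim_null_comparison)
      show "\<forall>\<^sub>F k in sequentially. norm (form_norm b (T (f k) - z)) \<le> R * l2_norm \<Omega> (T (f k) - z)"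
        using R(2) Tl2 z by (intro always_eventually) simp
      show "(\<lambda>k. R * l2_norm \<Omega> (T (f k) - z)) \<longlonglongrightarrow> 0"
        using tendsto_mult_left[OF z(2), of R] by simp
    qed
    with z show ?thesis by blast
  qed
  have C0: "0 \<le> C' * C1" using C' C1 by simp
  show thesis by (rule that[OF C0 C'(1) G comp app con])
qed

end

section \<open>Convergence of the discrete eigenvalues and the error estimate\<close>

context fe_problem
begin

lemma eventually_small:
  assumes C: "0 \<le> C" and e: "0 < e"
  shows "\<exists>h0>0. \<forall>h. mesh_size (\<T> h) \<le> h0 \<longrightarrow> C * mesh_size (\<T> h) powr s \<le> e"
proof (intro exI[of _ "(e / (C + 1)) powr (1 / s)"] conjI allI impI)
  show "0 < (e / (C + 1)) powr (1 / s)" using C e by simp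
  fix h assume "mesh_size (\<T> h) \<le> (e / (C + 1)) powr (1 / s)"
  then have "mesh_size (\<T> h) powr s \<le> ((e / (C + 1)) powr (1 / s)) powr s"
    using s mesh_size_nonneg[OF dom mesh] by (intro powr_mono2) auto
  also have "\<dots> = e / (C + 1)" using s C e by (simp add: powr_powr)
  finally have "C * mesh_size (\<T> h) powr s \<le> C * (e / (C + 1))" using C by (rule mult_left_mono)
  also have "\<dots> \<le> e" using C e by (simp add: field_simps)
  finally show "C * mesh_size (\<T> h) powr s \<le> e" .
qed

lemma eigen_systemD:
  assumes "eigen_system \<Omega> \<rho> a V lam u"
  shows "1 \<le> i \<Longrightarrow> u i \<in> V" "\<lbrakk>1 \<le> i; v \<in> V\<rbrakk> \<Longrightarrow> a (u i) v = lam i * b (u i) v"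
    "\<lbrakk>1 \<le> i; i \<le> j\<rbrakk> \<Longrightarrow> lam i \<le> lam j" "1 \<le> i \<Longrightarrow> 0 < lam i"
    "\<lbrakk>1 \<le> i; 1 \<le> j\<rbrakk> \<Longrightarrow> b (u i) (u j) = (if i = j then 1 else 0)"
proof -
  show "1 \<le> i \<Longrightarrow> u i \<in> V" "\<lbrakk>1 \<le> i; v \<in> V\<rbrakk> \<Longrightarrow> a (u i) v = lam i * b (u i) v"
    "\<lbrakk>1 \<le> i; 1 \<le> j\<rbrakk> \<Longrightarrow> b (u i) (u j) = (if i = j then 1 else 0)"
    using assms by (simp_all add: eigen_system_def eigenpair_def mass_form_def)
  show mono: "lam i \<le> lam j" if "1 \<le> i" "i \<le> j" for i j
    using that(2,1) by (induction rule: dec_induct)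
      (use assms in \<open>auto simp: eigen_system_def intro: order_trans\<close>)
  show "0 < lam i" if "1 \<le> i"
    using mono[of 1 i] that assms unfolding eigen_system_def by force
qed

lemma discrete_eigenvalue_le:
  assumes C: "0 \<le> C"
    and G: "\<And>h. galerkin (l2 \<Omega>) b (fun_sum V (Vh h)) (ah h) V (Vh h) T \<gamma>
      (C * mesh_size (\<T> h) powr s) (N h) (lamh h) (uh h)"
    and eigen: "eigen_system \<Omega> \<rho> a V lam u" and i: "1 \<le> i" and c: "lam i < c"
  shows "\<exists>h0>0. \<forall>h. mesh_size (\<T> h) \<le> h0 \<longrightarrow> i \<le> N h \<and> lamh h i \<le> c"
proof -
  note eig = eigen_systemD[OF eigen]
  \<comment> \<open>For \<open>\<eta> \<le> 1\<close> one has \<open>\<delta> \<le> \<eta> (4 \<gamma> + 3)\<close>, so \<open>\<eta> \<le> e\<close> gives \<open>\<delta> \<le> 1 / lam i - 1 / c\<close>.\<close>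
  define e where "e = (1 / lam i - 1 / c) / (4 * \<bar>\<gamma>\<bar> + 3)"
  have e: "0 < e" using eig(4)[OF i] c by (simp add: e_def frac_less2)
  obtain h0 where h0: "0 < h0" "\<And>h. mesh_size (\<T> h) \<le> h0 \<Longrightarrow> C * mesh_size (\<T> h) powr s \<le> min 1 e"
    using eventually_small[OF C, of "min 1 e"] e by auto
  have "i \<le> N h \<and> lamh h i \<le> c" if h: "mesh_size (\<T> h) \<le> h0" for h
  proof -
    interpret galerkin "l2 \<Omega>" b "fun_sum V (Vh h)" "ah h" V "Vh h" T \<gamma>
      "C * mesh_size (\<T> h) powr s" "N h" "lamh h" "uh h" by (rule G)
    have "\<delta> \<le> e * (4 * \<bar>\<gamma>\<bar> + 3)"
      unfolding \<delta>_def using h0(2)[OF h] \<eta> \<gamma> by (intro mult_mono) auto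
    then have \<delta>: "\<delta> \<le> 1 / lam i - 1 / c" by (simp add: e_def)
    then have small: "\<delta> < 1 / lam i" using eig(4)[OF i] c by (smt (verit) divide_pos_pos)
    have Tu: "b (T v) (u j) = b v (u j) / lam j" if v: "v \<in> l2 \<Omega>" and j: "j \<in> {1..i}" for v j
    proof -
      have uV: "u j \<in> V" using eig(1) j by simp
      have "lam j * b (u j) (T v) = ah h (u j) (T v)"
        using eig(2)[of j "T v"] ah_eq_a[OF uV T_V[OF v]] T_V[OF v] j by simp
      also have "\<dots> = b v (u j)"
        using energy.sym[of "u j" "T v"] T_weak[OF v uV] uV v by simp
      finally show ?thesis
        using eig(4)[of j] j uV v by (simp add: mass.sym field_simps)
    qed
    have uL: "u j \<in> l2 \<Omega>" if "j \<in> {1..i}" for j using eig(1)[of j] that V_l2 by auto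
    have on: "b (u p) (u q) = (if p = q then 1 else 0)" if "p \<in> {1..i}" "q \<in> {1..i}" for p q
      using eig(5)[of p q] that by simp
    have lam: "0 < lam j \<and> lam j \<le> lam i" if "j \<in> {1..i}" for j
      using eig(3)[of j i] eig(4)[of j] that by simp
    note up = discrete_eigenvalue_upper[OF uL on Tu lam i small]
    have "1 / c \<le> 1 / lamh h i" using up(2) \<delta> by simp
    moreover have "0 < lamh h i" using ev_pos[of i] up(1) i by simp
    moreover have "0 < c" using eig(4)[OF i] c by simp
    ultimately show ?thesis using up(1) by (simp add: field_simps)
  qed
  with h0(1) show ?thesis by blast
qed

text \<open>Otherwise, on a sequence of meshes of size tending to zero, \<open>l + 1\<close> discrete eigenvalues stay
below \<open>c\<close>. Their eigenfunctions have \<open>l + 1\<close> orthonormal limits, which are exact eigenfunctions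
for eigenvalues at most \<open>c\<close> and hence lie in the span of \<open>u 1, \<dots>, u l\<close>.\<close>

lemma discrete_eigenvalue_ge:
  assumes C: "0 \<le> C"
    and G: "\<And>h. galerkin (l2 \<Omega>) b (fun_sum V (Vh h)) (ah h) V (Vh h) T \<gamma>
      (C * mesh_size (\<T> h) powr s) (N h) (lamh h) (uh h)"
    and comp: "\<And>f. \<lbrakk>\<And>k. f k \<in> l2 \<Omega>; form_Cauchy b f\<rbrakk>
      \<Longrightarrow> \<exists>z\<in>l2 \<Omega>. (\<lambda>k::nat. form_norm b (T (f k) - z)) \<longlonglongrightarrow> 0"
    and eigen: "eigen_system \<Omega> \<rho> a V lam u" and c: "c < lam (Suc l)"
  shows "\<exists>h0>0. \<forall>h. mesh_size (\<T> h) \<le> h0 \<and> Suc l \<le> N h \<longrightarrow> c < lamh h (Suc l)"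
proof (rule ccontr)
  assume neg: "\<not> ?thesis"
  note eig = eigen_systemD[OF eigen]
  have "\<exists>h. mesh_size (\<T> h) \<le> inverse (Suc k) \<and> Suc l \<le> N h \<and> lamh h (Suc l) \<le> c" for k :: nat
  proof -
    have "0 < inverse (real (Suc k))" by simp
    then show ?thesis using neg by (meson not_le)
  qed
  then obtain H where H: "\<And>k. mesh_size (\<T> (H k)) \<le> inverse (Suc k)" "\<And>k. Suc l \<le> N (H k)"
    "\<And>k. lamh (H k) (Suc l) \<le> c" by metis
  have "(\<lambda>k. C * mesh_size (\<T> (H k)) powr s) \<longlonglongrightarrow> C * 0"
  proof (intro tendsto_mult tendsto_const)
    have "(\<lambda>k. inverse (real (Suc k)) powr s) \<longlonglongrightarrow> 0"
      by (rule tendsto_zero_powrI[OF LIMSEQ_inverse_real_of_nat tendsto_const]) (use s in auto)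
    moreover have "\<forall>\<^sub>F k in sequentially. norm (mesh_size (\<T> (H k)) powr s) \<le> inverse (real (Suc k)) powr s"
      using H(1) s mesh_size_nonneg[OF dom mesh] by (intro always_eventually) (simp add: powr_mono2)
    ultimately show "(\<lambda>k. mesh_size (\<T> (H k)) powr s) \<longlonglongrightarrow> 0" by (rule Lim_null_comparison[rotated])
  qed
  then have \<eta>: "(\<lambda>k. C * mesh_size (\<T> (H k)) powr s) \<longlonglongrightarrow> 0" by simp
  have le_c: "lamh (H k) j \<le> c" if j: "j \<in> {1..Suc l}" for k j
  proof -
    have "lamh (H k) j \<le> lamh (H k) (Suc l)"
      using galerkin.ev_mono[OF G[of "H k"], of j "Suc l"] j H(2)[of k] by simp
    then show ?thesis using H(3)[of k] by simp
  qed
  have "\<exists>w \<mu>. (\<forall>j\<in>{1..Suc l}. w j \<in> V \<and> \<mu> j \<le> c \<and>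
        (\<forall>k. \<forall>v\<in>V. ah (H k) (w j) v = \<mu> j * b (w j) v)) \<and>
      (\<forall>j\<in>{1..Suc l}. \<forall>j'\<in>{1..Suc l}. b (w j) (w j') = (if j = j' then 1 else 0))"
  proof (rule limit_eigenfunctions)
    show "galerkin (l2 \<Omega>) b (fun_sum V (Vh (H k))) (ah (H k)) V (Vh (H k)) T \<gamma>
      (C * mesh_size (\<T> (H k)) powr s) (N (H k)) (lamh (H k)) (uh (H k))" for k by (rule G)
    show "Suc l \<le> N (H k)" for k by (rule H(2))
    show "lamh (H k) j \<le> c" if "j \<in> {1..Suc l}" for k j using that by (rule le_c)
    show "\<exists>z\<in>l2 \<Omega>. (\<lambda>k::nat. form_norm b (T (f k) - z)) \<longlonglongrightarrow> 0"
      if "\<And>k. f k \<in> l2 \<Omega>" "form_Cauchy b f" for f using that by (rule comp)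
  qed (rule \<eta>)
  then obtain w \<mu> where w\<mu>: "(\<forall>j\<in>{1..Suc l}. w j \<in> V \<and> \<mu> j \<le> c \<and>
        (\<forall>k. \<forall>v\<in>V. ah (H k) (w j) v = \<mu> j * b (w j) v)) \<and>
      (\<forall>j\<in>{1..Suc l}. \<forall>j'\<in>{1..Suc l}. b (w j) (w j') = (if j = j' then 1 else 0))"
    by (elim exE)
  have w: "w j \<in> V \<and> \<mu> j \<le> c \<and> (\<forall>k. \<forall>v\<in>V. ah (H k) (w j) v = \<mu> j * b (w j) v)"
    if "j \<in> {1..Suc l}" for j
    using conjunct1[OF w\<mu>] that by (rule bspec)
  have on: "b (w j) (w j') = (if j = j' then 1 else 0)" if "j \<in> {1..Suc l}" "j' \<in> {1..Suc l}" for j j'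
    using bspec[OF bspec[OF conjunct2[OF w\<mu>] that(1)] that(2)] .
  interpret M: semi_inner "l2 \<Omega>" b by (rule semi_inner_mass[OF rho])
  have "card {1..Suc l} \<le> card {1..l}"
  proof (rule M.orthogonal_card_le[where \<psi>=w and e=u and d="\<lambda>_. 1"])
    fix j assume j: "j \<in> {1..Suc l}"
    have "b (w j) (w j) = 1" using on[OF j j] by simp
    then have "l2_norm \<Omega> (\<lambda>x. sqrt (\<rho> x) * w j x) = 1"
      using mass_norm_eq[OF rho, of "w j"] w[OF j] V_l2 by (auto simp: form_norm_def)
    then have "eigenpair \<Omega> \<rho> a V (\<mu> j) (w j)"
      using w[OF j] ah_eq_a[of "w j"] by (simp add: eigenpair_def mass_form_def)
    then obtain d where d: "ae_zero \<Omega> (\<lambda>x. w j x - (\<Sum>i | 1 \<le> i \<and> lam i = \<mu> j. d i * u i x))"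
      using eigen unfolding eigen_system_def by blast
    have sub: "{i. 1 \<le> i \<and> lam i = \<mu> j} \<subseteq> {1..l}"
    proof
      fix i assume i: "i \<in> {i. 1 \<le> i \<and> lam i = \<mu> j}"
      then have "lam i < lam (Suc l)" using w[OF j] c by auto
      then have "\<not> Suc l \<le> i" using eig(3)[of "Suc l" i] by auto
      then show "i \<in> {1..l}" using i by simp
    qed
    have "(\<lambda>x. w j x - (\<Sum>i | 1 \<le> i \<and> lam i = \<mu> j. d i * u i x))
        = w j - (\<Sum>i=1..l. (if lam i = \<mu> j then d i else 0) *\<^sub>R u i)"
    proof
      fix x
      have "(\<Sum>i | 1 \<le> i \<and> lam i = \<mu> j. d i * u i x) = (\<Sum>i=1..l. (if lam i = \<mu> j then d i else 0) * u i x)"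
        using sub by (intro sum.mono_neutral_cong_left) auto
      then show "w j x - (\<Sum>i | 1 \<le> i \<and> lam i = \<mu> j. d i * u i x)
          = (w j - (\<Sum>i=1..l. (if lam i = \<mu> j then d i else 0) *\<^sub>R u i)) x"
        by (simp add: sum_fun_apply)
    qed
    then have "form_norm b (w j - (\<Sum>i=1..l. (if lam i = \<mu> j then d i else 0) *\<^sub>R u i)) = 0"
      using ae_zero_mass_norm[OF d] by simp
    then show "\<exists>d. form_norm b (w j - (\<Sum>i=1..l. d i *\<^sub>R u i)) = 0"
      by (intro exI[of _ "\<lambda>i. if lam i = \<mu> j then d i else 0"])
  qed (use on w V_l2 eig(1) in auto)
  then show False by simp
qed

text \<open>What remains for \<open>eigenfunction_error\<close> is a bound for the mass norm of \<open>u\<^sub>l - P\<close> by a multiple of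
\<open>h\<^sup>s r\<close>, where \<open>r\<close> is the seminorm of \<open>u\<^sub>l\<close>. The last term in \<open>duality\<close> is of order \<open>h\<^sup>s\<close> without the
factor \<open>r\<close>; for \<open>r > 0\<close>, dividing by \<open>r\<close> moves the factor into the constant, which may depend on
\<open>u\<^sub>l\<close>. For \<open>r = 0\<close>, the energy of \<open>u\<^sub>l - P\<close> is zero, and then \<open>u\<^sub>l - P\<close> vanishes almost everywhere
by the hypothesis on this degenerate case.\<close>

lemma eigenfunction_estimate:
  assumes eigen: "eigen_system \<Omega> \<rho> a V lam u"
    and l: "1 \<le> l" "\<forall>j\<ge>1. lam j = lam l \<longrightarrow> j = l"
    and sign: "\<forall>h. l \<le> N h \<longrightarrow> (\<forall>P \<in> Vh h.
        (\<forall>vh \<in> Vh h. ah h P vh = lam l * l2_inner \<Omega> (\<lambda>x. \<rho> x * u l x) vh) \<longrightarrow>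
        0 \<le> l2_inner \<Omega> (\<lambda>x. \<rho> x * P x) (uh h l))"
    and u_regular: "u l \<in> V \<inter> frac_sobolev \<Omega> m s"
    and degenerate: "frac_seminorm \<Omega> m s (u l) = 0 \<longrightarrow>
        (\<forall>h. \<forall>w \<in> fun_sum V (Vh h). energy_norm (ah h) w = 0 \<longrightarrow> ae_zero \<Omega> w)"
  shows "\<exists>C>0. \<exists>h0>0. \<forall>h. mesh_size (\<T> h) \<le> h0 \<longrightarrow>
      l \<le> N h \<and>
      energy_norm (ah h) (\<lambda>x. u l x - uh h l x)
        \<le> C * mesh_size (\<T> h) powr s * frac_seminorm \<Omega> m s (u l)"
proof (rule galerkin_family)
  fix T \<gamma> C C'
  assume C: "0 \<le> C" and C': "0 < C'"
    and G: "\<And>h. galerkin (l2 \<Omega>) b (fun_sum V (Vh h)) (ah h) V (Vh h) T \<gamma>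
      (C * mesh_size (\<T> h) powr s) (N h) (lamh h) (uh h)"
    and comp: "\<And>f. \<lbrakk>\<And>k. f k \<in> l2 \<Omega>; form_Cauchy b f\<rbrakk>
      \<Longrightarrow> \<exists>z\<in>l2 \<Omega>. (\<lambda>k::nat. form_norm b (T (f k) - z)) \<longlonglongrightarrow> 0"
    and app: "\<And>h v e. \<lbrakk>v \<in> V \<inter> frac_sobolev \<Omega> m s; 0 < e\<rbrakk> \<Longrightarrow> \<exists>w\<in>Vh h.
      form_norm (ah h) (v - w) \<le> C' * mesh_size (\<T> h) powr s * frac_seminorm \<Omega> m s v + e"
    and con: "\<And>h v f w. \<lbrakk>v \<in> V \<inter> frac_sobolev \<Omega> m s; f \<in> l2 \<Omega>; \<And>v'. v' \<in> V \<Longrightarrow> a v v' = b f v'; w \<in> Vh h\<rbrakk> \<Longrightarrow>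
      \<bar>ah h v w - b f w\<bar> \<le> C' * mesh_size (\<T> h) powr s * frac_seminorm \<Omega> m s v * form_norm (ah h) w"
  note eig = eigen_systemD[OF eigen]
  note le = discrete_eigenvalue_le[OF C G eigen] and ge = discrete_eigenvalue_ge[OF C G comp eigen]
  \<comment> \<open>Half the distances of \<open>lam l\<close> from its neighbours; for \<open>l = 1\<close> there is no lower one.\<close>
  define g1 where "g1 = (if l = 1 then 1 else (lam l - lam (l - 1)) / 2)"
  define g2 where "g2 = (lam (Suc l) - lam l) / 2"
  define g where "g = min g1 g2"
  have lam_l: "0 < lam l" using eig(4) l by simp
  have g1: "0 < g1"
  proof (cases "l = 1")
    case False
    then have "1 \<le> l - 1" "l - 1 \<noteq> l" using l(1) by auto
    then have "lam (l - 1) \<noteq> lam l" "lam (l - 1) \<le> lam l"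
      using l(2) eig(3)[of "l - 1" l] by auto
    then show ?thesis using False by (simp add: g1_def)
  qed (simp add: g1_def)
  have g2: "0 < g2"
    using eig(3)[of l "Suc l"] l(1) l(2)[rule_format, of "Suc l"] by (auto simp: g2_def order_le_less)
  have g: "0 < g" using g1 g2 by (simp add: g_def)
  obtain h1 where h1: "0 < h1" "\<And>h. mesh_size (\<T> h) \<le> h1 \<Longrightarrow> l \<le> N h \<and> lamh h l \<le> 2 * lam l"
    using le[of l "2 * lam l"] l lam_l by auto
  have "\<exists>h2>0. \<forall>h. mesh_size (\<T> h) \<le> h2 \<longrightarrow> l = 1 \<or> lamh h (l - 1) \<le> lam l - g1"
  proof (cases "l = 1")
    case True then show ?thesis by (intro exI[of _ 1]) simp
  next
    case False
    then have "lam (l - 1) < lam l - g1" using g1 by (simp add: g1_def field_simps)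
    then show ?thesis using le[of "l - 1" "lam l - g1"] l False by fastforce
  qed
  then obtain h2 where h2: "0 < h2" "\<And>h. mesh_size (\<T> h) \<le> h2 \<Longrightarrow> l = 1 \<or> lamh h (l - 1) \<le> lam l - g1"
    by blast
  have "lam l + g2 < lam (Suc l)" using g2 by (simp add: g2_def field_simps)
  then obtain h3 where h3: "0 < h3"
    "\<And>h. \<lbrakk>mesh_size (\<T> h) \<le> h3; Suc l \<le> N h\<rbrakk> \<Longrightarrow> lam l + g2 < lamh h (Suc l)"
    using ge[of "lam l + g2" l] by blast
  obtain h4 where h4: "0 < h4" "\<And>h. mesh_size (\<T> h) \<le> h4 \<Longrightarrow> C * mesh_size (\<T> h) powr s \<le> 1"
    using eventually_small[OF C, of 1] by auto
  define h0 where "h0 = min (min h1 h2) (min h3 h4)"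
  have h0: "0 < h0" using h1 h2 h3 h4 by (simp add: h0_def)
  define r where "r = frac_seminorm \<Omega> m s (u l)"
  have r: "0 \<le> r" by (simp add: r_def frac_seminorm_nonneg)
  define K2 where "K2 = 3 * \<gamma> + (if r = 0 then 0 else C * (\<gamma> + 3) * lam l / (C' * r))"
  define Kg where "Kg = lam l * sqrt (1 / g + lam l / g\<^sup>2) + (1 + lam l / g) * sqrt (2 * lam l)"
  have Kg: "0 \<le> Kg" using lam_l g by (simp add: Kg_def)
  have uV: "u l \<in> V" and uL: "u l \<in> l2 \<Omega>" using u_regular V_l2 by auto
  have bu: "form_norm b (u l) = 1" using eig(5)[of l l] l by (simp add: form_norm_def)
  have main: "l \<le> N h \<and> form_norm (ah h) (u l - uh h l)
      \<le> ((3 + Kg * \<bar>K2\<bar>) * C') * mesh_size (\<T> h) powr s * r"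
    if h: "mesh_size (\<T> h) \<le> h0" for h
  proof -
    interpret galerkin "l2 \<Omega>" b "fun_sum V (Vh h)" "ah h" V "Vh h" T \<gamma>
      "C * mesh_size (\<T> h) powr s" "N h" "lamh h" "uh h" by (rule G)
    define t where "t = mesh_size (\<T> h) powr s"
    have t: "0 \<le> t" by (simp add: t_def)
    define \<kappa>h where "\<kappa>h = C' * t * r"
    have \<kappa>0: "0 \<le> \<kappa>h" using C' t r by (simp add: \<kappa>h_def)
    have lN: "l \<le> N h" "lamh h l \<le> 2 * lam l" using h1(2)[of h] h by (auto simp: h0_def)
    have lin: "l \<in> {1..N h}" using lN l by simp
    define f where "f = lam l *\<^sub>R u l"
    have f: "f \<in> l2 \<Omega>" using uL by (simp add: f_def)
    have bf: "b f v = lam l * b (u l) v" if "v \<in> l2 \<Omega>" for v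
      using uL that by (simp add: f_def mass.scale_left)
    have auf: "a (u l) v = b f v" if "v \<in> V" for v
      using eig(2)[OF l(1) that] bf[of v] that by simp
    define P where "P = S f"
    have PW: "P \<in> Vh h" by (simp add: P_def S_W)
    have e1: "form_norm (ah h) (u l - P) \<le> 3 * \<kappa>h"
      unfolding P_def
    proof (rule Strang[OF uV f])
      show "\<exists>w\<in>Vh h. form_norm (ah h) (u l - w) \<le> \<kappa>h + e" if "0 < e" for e
        using app[OF u_regular that, of h] by (simp add: \<kappa>h_def t_def r_def)
      show "\<bar>ah h (u l) w - b f w\<bar> \<le> \<kappa>h * form_norm (ah h) w" if "w \<in> Vh h" for w
        using con[OF u_regular f auf that] by (simp add: \<kappa>h_def t_def r_def)
    qed
    have uPX: "u l - P \<in> fun_sum V (Vh h)" using uV PW by simp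
    have e2: "form_norm b (u l - P) \<le> \<bar>K2\<bar> * \<kappa>h"
    proof (cases "r = 0")
      case True
      then have "form_norm (ah h) (u l - P) = 0"
        using e1 energy.norm_nonneg[OF uPX] by (simp add: \<kappa>h_def)
      then have "ae_zero \<Omega> (u l - P)"
        using degenerate uPX True by (simp add: energy_norm_form_norm r_def)
      then have "form_norm b (u l - P) = 0" by (rule ae_zero_mass_norm)
      then show ?thesis using \<kappa>0 by simp
    next
      case False
      have "form_norm b (u l - P) \<le> \<gamma> * form_norm (ah h) (u l - P) + C * t * form_norm (ah h) P"
        using duality[OF uV PW] by (simp add: t_def)
      also have "\<dots> \<le> \<gamma> * (3 * \<kappa>h) + C * t * ((\<gamma> + 3) * lam l)"
      proof (intro add_mono mult_left_mono e1 \<gamma>)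
        have "form_norm (ah h) P \<le> (\<gamma> + 3 * (C * t)) * lam l"
          using energy_S_le(1)[OF f] uL bu lam_l by (simp add: P_def f_def mass.norm_scale t_def)
        also have "\<dots> \<le> (\<gamma> + 3) * lam l"
          using h4(2)[of h] h lam_l by (intro mult_right_mono) (auto simp: h0_def t_def)
        finally show "form_norm (ah h) P \<le> (\<gamma> + 3) * lam l" .
        show "0 \<le> C * t" using C t by simp
      qed
      also have "\<dots> = K2 * \<kappa>h" using False C' by (simp add: K2_def \<kappa>h_def field_simps)
      also have "\<dots> \<le> \<bar>K2\<bar> * \<kappa>h" using \<kappa>0 by (intro mult_right_mono) auto
      finally show ?thesis .
    qed
    have gap: "g \<le> \<bar>lamh h j - lam l\<bar>" if j: "j \<in> {1..N h}" "j \<noteq> l" for j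
    proof (cases "j < l")
      case True
      then have "lamh h j \<le> lamh h (l - 1)" using ev_mono[of j "l - 1"] j lN by simp
      moreover have "lamh h (l - 1) \<le> lam l - g1" using h2(2)[of h] h True j by (auto simp: h0_def)
      ultimately show ?thesis using g1 by (simp add: g_def)
    next
      case False
      then have "lamh h (Suc l) \<le> lamh h j" using ev_mono[of "Suc l" j] j by simp
      moreover have "lam l + g2 < lamh h (Suc l)" using h3(2)[of h] h False j by (auto simp: h0_def)
      ultimately show ?thesis using g2 by (simp add: g_def)
    qed
    have sgn: "0 \<le> b P (uh h l)"
      using sign[rule_format, OF lN(1) PW] S_weak[OF f] bf Vh_subset[of h] sum_l2[of h]
      by (simp add: P_def mass_form_def)
    have "form_norm (ah h) (u l - uh h l) \<le> 3 * \<kappa>h + Kg * (\<bar>K2\<bar> * \<kappa>h)"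
      unfolding Kg_def
      using eigenfunction_error[OF uV bu lam_l lin, of "3 * \<kappa>h" "\<bar>K2\<bar> * \<kappa>h" g "2 * lam l"]
        e1 e2 gap g lN(2) sgn by (simp add: P_def f_def)
    then show ?thesis using lN by (simp add: \<kappa>h_def t_def algebra_simps)
  qed
  have "0 < (3 + Kg * \<bar>K2\<bar>) * C'" using Kg C' by (simp add: add_pos_nonneg)
  with h0 main show ?thesis
    unfolding energy_norm_form_norm r_def fun_diff_def by blast
qed

end

theorem theorem3p6:
  fixes \<Omega> :: "(real^'n) set" and m :: nat
    and V :: "(real^'n \<Rightarrow> real) set" and normV :: "(real^'n \<Rightarrow> real) \<Rightarrow> real"
    and \<kappa> :: "'n list \<Rightarrow> 'n list \<Rightarrow> real^'n \<Rightarrow> real" and \<rho> :: "real^'n \<Rightarrow> real"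
    and a :: "(real^'n \<Rightarrow> real) \<Rightarrow> (real^'n \<Rightarrow> real) \<Rightarrow> real"
    and lam :: "nat \<Rightarrow> real" and u :: "nat \<Rightarrow> real^'n \<Rightarrow> real"
    and \<T> :: "'i \<Rightarrow> (real^'n) set set" and Vh :: "'i \<Rightarrow> (real^'n \<Rightarrow> real) set"
    and ah :: "'i \<Rightarrow> (real^'n \<Rightarrow> real) \<Rightarrow> (real^'n \<Rightarrow> real) \<Rightarrow> real"
    and N :: "'i \<Rightarrow> nat" and lamh :: "'i \<Rightarrow> nat \<Rightarrow> real" and uh :: "'i \<Rightarrow> nat \<Rightarrow> real^'n \<Rightarrow> real"
    and s \<S> :: real and l :: nat
  assumes domain: "bounded \<Omega>" "lipschitz_domain \<Omega>" "piecewise_flat_boundary \<Omega>"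
    and m: "1 \<le> m"
    and V: "standard_sobolev_space \<Omega> m V normV"
    and rho: "\<rho> \<in> linf \<Omega>" "AE x in lebesgue_on \<Omega>. 0 < \<rho> x"
    and a_def: "a = form_on m \<kappa> \<Omega>" and a_elliptic: "elliptic \<Omega> m \<kappa>"
    and a: "symmetric_on V a" "bounded_coercive_on V normV a"
    and eigen: "eigen_system \<Omega> \<rho> a V lam u"
    and mesh: "\<forall>h. fe_triangulation \<Omega> (\<T> h)" "shape_regular \<T>"
    and Vh: "\<forall>h. fe_space \<Omega> m (\<T> h) (Vh h)"
    and ah_def: "\<forall>h. ah h = piecewise_form m \<kappa> (\<T> h)"
    and eigen_h: "\<forall>h. discrete_eigen_system \<Omega> \<rho> (ah h) (Vh h) (N h) (lamh h) (uh h)"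
    and l: "1 \<le> l" "\<forall>j\<ge>1. lam j = lam l \<longrightarrow> j = l"
    and exponents: "0 < s" "s \<le> \<S>" "\<S> \<le> 1"
    and regularity: "elliptic_regularity \<Omega> m \<rho> a V s"
    and sign: "\<forall>h. l \<le> N h \<longrightarrow> (\<forall>P \<in> Vh h.
        (\<forall>vh \<in> Vh h. ah h P vh = lam l * l2_inner \<Omega> (\<lambda>x. \<rho> x * u l x) vh) \<longrightarrow>
        0 \<le> l2_inner \<Omega> (\<lambda>x. \<rho> x * P x) (uh h l))"
    and H1: "cond_H1 \<Omega> V Vh ah"
    and H2: "\<forall>r. 0 < r \<and> r \<le> \<S> \<longrightarrow> cond_H2 \<Omega> m V \<T> Vh ah r"
    and H3: "cond_H3 \<Omega> m a V \<T> Vh ah s"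
    and u_regular: "u l \<in> V \<inter> frac_sobolev \<Omega> m s"
    and degenerate: "frac_seminorm \<Omega> m s (u l) = 0 \<longrightarrow>
        (\<forall>h. \<forall>w \<in> fun_sum V (Vh h). energy_norm (ah h) w = 0 \<longrightarrow> ae_zero \<Omega> w)"
  shows "\<exists>C>0. \<exists>h0>0. \<forall>h. mesh_size (\<T> h) \<le> h0 \<longrightarrow>
      l \<le> N h \<and>
      energy_norm (ah h) (\<lambda>x. u l x - uh h l x)
        \<le> C * mesh_size (\<T> h) powr s * frac_seminorm \<Omega> m s (u l)"
proof -
  have "bounded_coefficients m \<kappa> \<Omega>"
    using a_elliptic by (simp add: elliptic_def bounded_coefficients_def)
  then interpret fe_problem \<Omega> m V normV \<kappa> \<rho> a \<T> Vh ah N lamh uh s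
    using domain V rho a_def a mesh Vh ah_def eigen_h exponents regularity H1 H2 H3
    by unfold_locales auto
  show ?thesis
    by (rule eigenfunction_estimate[OF eigen l sign u_regular degenerate])
qed

end
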